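(* Let $Z=(Z_n)_{n\ge0}$ be a supercritical Galton–Watson process with $Z_0=1$ whose offspring law $(p_j)_{j\ge0}$ is of Schröder type and of type $(d,\mu)$, and let $(c_n)$, $W$, $w$ be as described in the context. Then for every sequence of integers $k_n$ with $k_n\equiv\mu \pmod d$, $k_n\to\infty$ and $k_n=o(c_n)$, as $n\to\infty$, $$\mathbf P(Z_n=k_n)=\frac{d}{m^{n-a_n}c_{a_n}}\,w\Big(\frac{k_n}{m^{n-a_n}c_{a_n}}\Big)\big(1+o(1)\big)$$ and $$\mathbf P(0<Z_n\le k_n)=\mathbf P\Big(0<W<\frac{k_n}{m^{n-a_n}c_{a_n}}\Big)\big(1+o(1)\big),$$ where for fixed $n$, $a_n:=\min\{\ell\ge1:\ c_\ell\ge k_n\}$.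
   Context: A Galton–Watson process $Z$ has offspring generating function $f(s)=\sum_{j\ge0}p_js^j$, $0\le s\le 1$, assumed non-degenerate ($p_j<1$ for all $j$) and supercritical: $m:=f'(1)\in(1,\infty)$. $Z_0=1$. The offspring law is of Schröder type if $p_0+p_1>0$ and of Böttcher type if $p_0+p_1=0$. It is of type $(d,\mu)$ if $d\ge1$ is the greatest common divisor of $\{j-\ell:\ j\ne\ell,\ p_jp_\ell>0\}$ and $\mu\ge0$ is the minimal $j$ with $p_j>0$. $(c_n)_{n\ge0}$ is a fixed sequence of positive constants such that $c_n^{-1}Z_n\to W$ almost surely for a non-degenerate random variable $W$, and satisfying: $c_0=1$, $c_n<c_{n+1}\le m c_n$ for $n\ge0$, $c_n=m^nL(m^n)$ with $L$ slowly varying at infinity, and $c_n=m^n$ whenever $\mathbf E Z_1\log Z_1<\infty$. The law of $W$ restricted to $(0,\infty)$ has a positive continuous density, denoted $w$. *)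

theory Defs
  imports "HOL-Probability.Probability" "HOL-Library.Landau_Symbols"
begin

definition offspring_mean :: "nat pmf \<Rightarrow> real" where
  "offspring_mean p = measure_pmf.expectation p real"

definition nondegenerate_law :: "nat pmf \<Rightarrow> bool" where
  "nondegenerate_law p \<longleftrightarrow> (\<forall>j. pmf p j < 1)"

definition supercritical_law :: "nat pmf \<Rightarrow> bool" where
  "supercritical_law p \<longleftrightarrow> integrable (measure_pmf p) real \<and> offspring_mean p > 1"

definition schroeder_type :: "nat pmf \<Rightarrow> bool" where
  "schroeder_type p \<longleftrightarrow> pmf p 0 + pmf p 1 > 0"

definition law_span :: "nat pmf \<Rightarrow> nat" where
  "law_span p = Gcd {nat \<bar>int j - int l\<bar> | j l. j \<noteq> l \<and> pmf p j * pmf p l > 0}"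

definition law_min :: "nat pmf \<Rightarrow> nat" where
  "law_min p = (LEAST j. pmf p j > 0)"

definition of_type :: "nat pmf \<Rightarrow> nat \<Rightarrow> nat \<Rightarrow> bool" where
  "of_type p d \<mu> \<longleftrightarrow> d \<ge> 1 \<and> d = law_span p \<and> \<mu> = law_min p"

text \<open>E Z_1 log Z_1 < infinity (the terms are nonnegative; 0 log 0 = 0).\<close>
definition xlogx_finite :: "nat pmf \<Rightarrow> bool" where
  "xlogx_finite p \<longleftrightarrow> integrable (measure_pmf p) (\<lambda>j. real j * ln (real j))"

definition slowly_varying :: "(real \<Rightarrow> real) \<Rightarrow> bool" where
  "slowly_varying L \<longleftrightarrow> L \<in> borel_measurable borel \<and> (\<forall>\<^sub>F x in at_top. L x > 0) \<and>
     (\<forall>t>0. ((\<lambda>x. L (t * x) / L x) \<longlongrightarrow> 1) at_top)"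

fun gw_Z :: "(nat \<Rightarrow> nat \<Rightarrow> 'a \<Rightarrow> nat) \<Rightarrow> nat \<Rightarrow> 'a \<Rightarrow> nat" where
  "gw_Z \<xi> 0 \<omega> = 1"
| "gw_Z \<xi> (Suc n) \<omega> = (\<Sum>i<gw_Z \<xi> n \<omega>. \<xi> n i \<omega>)"

definition gw_offspring_family :: "'a measure \<Rightarrow> nat pmf \<Rightarrow> (nat \<Rightarrow> nat \<Rightarrow> 'a \<Rightarrow> nat) \<Rightarrow> bool" where
  "gw_offspring_family M p \<xi> \<longleftrightarrow> prob_space M \<and>
     prob_space.indep_vars M (\<lambda>_. count_space UNIV) (\<lambda>ni. \<xi> (fst ni) (snd ni)) UNIV \<and>
     (\<forall>n i. distr M (count_space UNIV) (\<xi> n i) = measure_pmf p)"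

definition admissible_norming :: "nat pmf \<Rightarrow> (nat \<Rightarrow> real) \<Rightarrow> bool" where
  "admissible_norming p c \<longleftrightarrow>
     (\<forall>n. c n > 0) \<and> c 0 = 1 \<and>
     (\<forall>n. c n < c (Suc n) \<and> c (Suc n) \<le> offspring_mean p * c n) \<and>
     (\<exists>L. slowly_varying L \<and> (\<forall>n. c n = offspring_mean p ^ n * L (offspring_mean p ^ n))) \<and>
     (xlogx_finite p \<longrightarrow> (\<forall>n. c n = offspring_mean p ^ n))"

end

theory Submission
  imports Defs
begin

text \<open>
  Split the population at generation \<open>N = n - a\<close> with \<open>a = a\<^sub>n\<close>, so that \<open>k / c\<^sub>a\<close> stays in a compact subset
  of \<open>(0,\<infinity>)\<close>. Then \<open>P(Z\<^sub>n = k)\<close> is the mixture over \<open>j\<close>, with weights \<open>P(Z\<^sub>N = j)\<close>, of the laws of \<open>Z\<^sub>a\<close>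
  started from \<open>j\<close> ancestors, and \<open>m\<^sup>N W\<close> is the same mixture of the limits of these laws. In the Schroeder case
  all relevant weights decay like \<open>\<gamma>\<^sup>N\<close>, \<open>\<gamma> = f'(q)\<close> with \<open>q\<close> the extinction probability, and the
  contributions of large \<open>j\<close> are summable. Hence both sides agree up to an error \<open>o(\<gamma>\<^sup>N)\<close>, uniformly in \<open>N \<ge> 0\<close>,
  whereas both are at least of order \<open>\<gamma>\<^sup>N\<close>, because with such a probability exactly one family founded in
  generation \<open>N\<close> survives.

  For distribution functions the agreement follows from almost sure convergence. It is transferred to point
  probabilities by a Hoelder estimate for \<open>k e\<^bsup>-k/c\<^esup> P(Z\<^sub>n = k)\<close>, the coefficients of \<open>z f\<^sub>n'(z)\<close> on a circle slightly
  inside the unit disc: at angles of order \<open>1 / c\<^sub>b\<close> the factorisation \<open>f\<^sub>n' = f\<^bsub>n-b\<^esub>'(f\<^sub>b) f\<^sub>b'\<close> has its inner value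
  \<open>f\<^sub>b\<close> bounded away from the unit circle, which makes the first factor of order \<open>\<gamma>\<^bsup>n-b\<^esup>\<close>, while \<open>f\<^sub>b'\<close> is of order
  \<open>c\<^sub>b (1 + \<delta>)\<^bsup>a-b\<^esup>\<close>. So the contributions of the arcs between angles \<open>1 / c\<^sub>b\<close> and \<open>1 / c\<^bsub>b-1\<^esub>\<close> are summable.
\<close>

section \<open>Generating functions\<close>

text \<open>Scaling explains why derivatives are estimated. Let \<open>l = a - b\<close>. On angles
  between \<open>1 / c b\<close> and \<open>1 / c (b - 1)\<close> the non-constant part of the
  generating function of \<open>Z (N + a)\<close> has order \<open>\<gamma> ^ (N + l)\<close>, so
  this arc contributes about \<open>\<gamma> ^ (N + l) / c b\<close>, while the target is
  \<open>\<gamma> ^ N / c a\<close>. The ratio behaves like \<open>(\<gamma> * m) ^ l\<close> and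
  need not be summable. For the derivative the factor \<open>c b\<close> cancels the arc length, the
  ratio becomes \<open>(\<gamma> * (1 + \<delta>)) ^ l\<close> with \<delta> as small as desired,
  and part of the remaining decay pays for a Hoelder exponent. Hoelder continuity allows a point
  probability to be replaced by its average over a short window, that is, by an increment of a
  distribution function. The window length is fixed first and \<open>a\<close> is taken large
  afterwards. The density of \<open>m ^ N * W\<close> at \<open>y\<close> involves \<open>w\<close>
  at \<open>y / m ^ N\<close>, close to 0 for large \<open>N\<close>, where nothing is assumed about
  \<open>w\<close>. Its regularity uniformly in \<open>N\<close> therefore has to be inherited from
  the lattice probabilities.\<close>

definition pgf :: "nat pmf \<Rightarrow> 'a::{real_normed_field,banach,second_countable_topology} \<Rightarrow> 'a" where
  "pgf p x = measure_pmf.expectation p (\<lambda>k. x ^ k)"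

text \<open>Both functions are polymorphic so that complex values on a circle can be dominated by
  real values at its radius. A non-integrable integrand has expectation 0, so the formula has its
  analytic meaning inside the open disc, and at 1 under a finite mean.\<close>

definition pgf_deriv :: "nat pmf \<Rightarrow> 'a::{real_normed_field,banach,second_countable_topology} \<Rightarrow> 'a" where
  "pgf_deriv p x = measure_pmf.expectation p (\<lambda>k. of_nat k * x ^ (k - 1))"

lemma integrable_pmf_bounded:
  fixes f :: "'b \<Rightarrow> 'a::{banach,second_countable_topology}"
  assumes "\<And>k. norm (f k) \<le> C"
  shows "integrable (measure_pmf p) f"
  by (rule measure_pmf.integrable_const_bound[where B=C]) (use assms in auto)

lemma sums_pmf_expectation:
  fixes f :: "nat \<Rightarrow> 'a::{banach,second_countable_topology}"
  assumes "integrable (measure_pmf p) f"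
  shows "(\<lambda>k. pmf p k *\<^sub>R f k) sums measure_pmf.expectation p f"
proof -
  have "integrable (count_space UNIV) (\<lambda>k. pmf p k *\<^sub>R f k)"
    using assms by (simp add: measure_pmf_eq_density integrable_density)
  from sums_integral_count_space_nat[OF this] show ?thesis
    by (simp add: measure_pmf_eq_density integral_density)
qed

lemma pow_norm_le_1: "norm (x::'a::real_normed_field) \<le> 1 \<Longrightarrow> norm (x ^ k) \<le> 1"
  by (simp add: norm_power power_le_one)

text \<open>A bounded integrand makes the derivative available in the open disc for every law,
  without moments. The bound rests on \<open>(j + 1) * x ^ j = j * x ^ j + x ^ j\<close>, a null
  sequence.\<close>

lemma bounded_nat_times_power:
  fixes x :: real
  assumes "0 \<le> x" "x < 1"
  obtains C where "\<And>k. real k * x ^ (k - 1) \<le> C"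
proof -
  have "(\<lambda>n. of_nat n * x ^ n) \<longlonglongrightarrow> 0"
    using assms by (intro powser_times_n_limit_0) auto
  moreover have "(\<lambda>n. x ^ n) \<longlonglongrightarrow> 0"
    using assms by (intro LIMSEQ_power_zero) auto
  ultimately have "(\<lambda>n. of_nat n * x ^ n + x ^ n) \<longlonglongrightarrow> 0 + 0" by (rule tendsto_add)
  then have "Bseq (\<lambda>n. of_nat n * x ^ n + x ^ n)" by (intro convergent_imp_Bseq convergentI)
  then obtain K where K: "\<And>n. norm (of_nat n * x ^ n + x ^ n) \<le> K" by (auto simp: Bseq_def)
  have K0: "0 \<le> K" using K[of 0] norm_ge_zero order_trans by blast
  have "real k * x ^ (k - 1) \<le> K" for k
  proof (cases k)
    case (Suc j)
    then show ?thesis using K[of j] assms by (simp add: algebra_simps)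
  qed (use K0 in auto)
  then show thesis by (rule that)
qed

lemma integrable_pgf:
  "norm x \<le> 1 \<Longrightarrow> integrable (measure_pmf p) (\<lambda>k. (x::'a::{real_normed_field,banach,second_countable_topology}) ^ k)"
  by (rule integrable_pmf_bounded[where C=1]) (rule pow_norm_le_1)

lemma integrable_pgf_deriv:
  fixes x :: "'a::{real_normed_field,banach,second_countable_topology}"
  assumes "norm x < 1"
  shows "integrable (measure_pmf p) (\<lambda>k. of_nat k * x ^ (k - 1))"
proof -
  obtain C where "\<And>k. real k * norm x ^ (k - 1) \<le> C"
    using bounded_nat_times_power[of "norm x"] assms by auto
  then show ?thesis
    by (intro integrable_pmf_bounded[where C=C]) (simp add: norm_mult norm_power)
qed

lemma norm_pgf_le:
  fixes x :: "'a::{real_normed_field,banach,second_countable_topology}"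
  assumes "norm x \<le> s" "s \<le> 1"
  shows "norm (pgf p x) \<le> pgf p s"
proof -
  have s0: "0 \<le> s" using assms(1) norm_ge_zero order_trans by blast
  have "norm (pgf p x) \<le> measure_pmf.expectation p (\<lambda>k. norm (x ^ k))"
    unfolding pgf_def by simp
  also have "\<dots> \<le> measure_pmf.expectation p (\<lambda>k. s ^ k)"
    using assms s0 by (intro integral_mono integrable_norm integrable_pgf) (auto simp: norm_power power_mono)
  finally show ?thesis by (simp add: pgf_def)
qed

lemma norm_pgf_deriv_le:
  fixes x :: "'a::{real_normed_field,banach,second_countable_topology}"
  assumes "norm x \<le> s" "s < 1"
  shows "norm (pgf_deriv p x) \<le> pgf_deriv p s"
proof -
  have s0: "0 \<le> s" using assms(1) norm_ge_zero order_trans by blast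
  have "norm (pgf_deriv p x) \<le> measure_pmf.expectation p (\<lambda>k. norm (of_nat k * x ^ (k - 1)))"
    unfolding pgf_deriv_def by simp
  also have "\<dots> \<le> measure_pmf.expectation p (\<lambda>k. of_nat k * s ^ (k - 1))"
    using assms s0
    by (intro integral_mono integrable_norm integrable_pgf_deriv)
       (auto simp: norm_power norm_mult intro!: mult_left_mono power_mono)
  finally show ?thesis by (simp add: pgf_deriv_def)
qed

lemma pgf_1 [simp]: "pgf p 1 = 1"
  by (simp add: pgf_def)

lemma pgf_nonneg: "0 \<le> (s::real) \<Longrightarrow> 0 \<le> pgf p s"
  unfolding pgf_def by (intro integral_nonneg_AE) auto

lemma pgf_deriv_nonneg: "0 \<le> (s::real) \<Longrightarrow> 0 \<le> pgf_deriv p s"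
  unfolding pgf_deriv_def by (intro integral_nonneg_AE) auto

lemma pgf_mono: "0 \<le> (s::real) \<Longrightarrow> s \<le> t \<Longrightarrow> t \<le> 1 \<Longrightarrow> pgf p s \<le> pgf p t"
  unfolding pgf_def by (intro integral_mono integrable_pgf) (auto intro: power_mono)

lemma pgf_le_1: "0 \<le> (s::real) \<Longrightarrow> s \<le> 1 \<Longrightarrow> pgf p s \<le> 1"
  using pgf_mono[of s 1 p] by simp

lemma pgf_norm_le_1:
  fixes x :: "'a::{real_normed_field,banach,second_countable_topology}"
  shows "norm x \<le> 1 \<Longrightarrow> norm (pgf p x) \<le> 1"
  using norm_pgf_le[of x 1 p] by simp

lemma pgf_of_real: "pgf p (of_real s :: complex) = of_real (pgf p s)"
  by (simp add: pgf_def flip: of_real_power)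

lemma pgf_deriv_of_real: "pgf_deriv p (of_real s :: complex) = of_real (pgf_deriv p s)"
proof -
  have "(\<lambda>k. of_nat k * (of_real s :: complex) ^ (k - 1)) = (\<lambda>k. complex_of_real (real k * s ^ (k - 1)))"
    by auto
  then show ?thesis
    unfolding pgf_deriv_def by (simp del: of_real_mult of_real_power)
qed

lemma pgf_0: "pgf p (0::real) = pmf p 0"
proof -
  have "(\<lambda>k. (0::real) ^ k) = indicator {0}" by (auto simp: fun_eq_iff indicator_def power_0_left)
  then show ?thesis by (simp add: pgf_def pmf.rep_eq)
qed

lemma DERIV_pgf:
  fixes x :: "'a::{real_normed_field,banach,second_countable_topology}"
  assumes "norm x < 1"
  shows "(pgf p has_field_derivative pgf_deriv p x) (at x)"
proof -
  let ?c = "\<lambda>k. of_real (pmf p k) :: 'a"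
  have S: "(\<lambda>k. ?c k * z ^ k) sums pgf p z" if "norm z \<le> 1" for z :: 'a
    using sums_pmf_expectation[OF integrable_pgf[OF that, of p]] by (simp add: pgf_def scaleR_conv_of_real)
  \<comment> \<open>Convergence of the series at 1 suffices for termwise differentiation in the open
    unit disc.\<close>
  have D: "((\<lambda>z. \<Sum>k. ?c k * z ^ k) has_field_derivative (\<Sum>k. diffs ?c k * x ^ k)) (at x)"
    by (rule termdiffs_strong[where K=1]) (use S[of 1] assms in \<open>auto dest: sums_summable\<close>)
  have "(\<lambda>k. pmf p k *\<^sub>R (of_nat k * x ^ (k - 1))) sums pgf_deriv p x"
    unfolding pgf_deriv_def by (rule sums_pmf_expectation[OF integrable_pgf_deriv[OF assms]])
  then have "(\<lambda>k. pmf p (Suc k) *\<^sub>R (of_nat (Suc k) * x ^ k)) sums pgf_deriv p x"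
    using sums_Suc_iff [of "\<lambda>k. pmf p k *\<^sub>R (of_nat k * x ^ (k - 1))" "pgf_deriv p x"] by (simp del: of_nat_Suc)
  then have "(\<Sum>k. diffs ?c k * x ^ k) = pgf_deriv p x"
    by (simp add: diffs_def sums_iff scaleR_conv_of_real mult_ac del: of_nat_Suc)
  with D have D: "((\<lambda>z. \<Sum>k. ?c k * z ^ k) has_field_derivative pgf_deriv p x) (at x)" by simp
  show ?thesis
  proof (rule has_field_derivative_transform_within_open[OF D, where S="ball 0 1"])
    fix z :: 'a assume "z \<in> ball 0 1"
    then show "(\<Sum>k. ?c k * z ^ k) = pgf p z" using S[of z] by (simp add: sums_iff)
  qed (use assms in auto)
qed

lemma continuous_on_pgf:
  "continuous_on (cball 0 1) (pgf p :: 'a::{real_normed_field,banach,second_countable_topology} \<Rightarrow> 'a)"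
  unfolding continuous_on_def
proof (intro ballI, unfold tendsto_at_iff_sequentially, intro allI impI)
  fix x :: 'a and X assume X: "\<forall>i. X i \<in> cball 0 1 - {x}" "X \<longlonglongrightarrow> x"
  show "(pgf p \<circ> X) \<longlonglongrightarrow> pgf p x"
    unfolding pgf_def o_def
    by (rule integral_dominated_convergence[where w="\<lambda>_. 1"])
       (use X in \<open>auto intro!: tendsto_intros pow_norm_le_1 AE_I2\<close>)
qed

lemma pmf_expectation_bind:
  fixes f :: "'b \<Rightarrow> real"
  assumes "\<And>x. \<bar>f x\<bar> \<le> C"
  shows "measure_pmf.expectation (bind_pmf p N) f =
         measure_pmf.expectation p (\<lambda>x. measure_pmf.expectation (N x) f)"
  unfolding measure_pmf_bind
  by (rule integral_bind[where K="count_space UNIV" and B=C and B'=1])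
     (use assms in \<open>auto simp: measure_pmf.emeasure_space_1 measure_pmf_in_subprob_space intro!: measure_pmf.finite_measure\<close>)

lemma pmf_expectation_bind_complex:
  fixes f :: "'b \<Rightarrow> complex"
  assumes "\<And>x. norm (f x) \<le> C"
  shows "measure_pmf.expectation (bind_pmf p N) f =
         measure_pmf.expectation p (\<lambda>x. measure_pmf.expectation (N x) f)"
proof -
  have int: "integrable (measure_pmf q) f" for q
    using assms by (rule integrable_pmf_bounded)
  have int2: "integrable (measure_pmf p) (\<lambda>x. measure_pmf.expectation (N x) f)"
  proof (rule integrable_pmf_bounded[where C=C])
    fix x
    have "norm (measure_pmf.expectation (N x) f) \<le> measure_pmf.expectation (N x) (\<lambda>x. norm (f x))" by simp
    also have "\<dots> \<le> measure_pmf.expectation (N x) (\<lambda>x. C)"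
      using assms int by (intro integral_mono) auto
    finally show "norm (measure_pmf.expectation (N x) f) \<le> C" by simp
  qed
  have R: "\<bar>Re (f x)\<bar> \<le> C" "\<bar>Im (f x)\<bar> \<le> C" for x
    using assms[of x] abs_Re_le_cmod[of "f x"] abs_Im_le_cmod[of "f x"] by linarith+
  show ?thesis
  proof (rule complex_eqI)
    show "Re (measure_pmf.expectation (bind_pmf p N) f) = Re (measure_pmf.expectation p (\<lambda>x. measure_pmf.expectation (N x) f))"
      using pmf_expectation_bind[of "\<lambda>x. Re (f x)" C p N] R int int2 by (simp flip: integral_Re)
    show "Im (measure_pmf.expectation (bind_pmf p N) f) = Im (measure_pmf.expectation p (\<lambda>x. measure_pmf.expectation (N x) f))"
      using pmf_expectation_bind[of "\<lambda>x. Im (f x)" C p N] R int int2 by (simp flip: integral_Im)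
  qed
qed

section \<open>Laws of the generations and their generating functions\<close>

definition conv_pmf :: "nat pmf \<Rightarrow> nat pmf \<Rightarrow> nat pmf" where
  "conv_pmf p q = bind_pmf p (\<lambda>x. map_pmf ((+) x) q)"

lemma pgf_conv_complex:
  assumes "norm (z::complex) \<le> 1"
  shows "pgf (conv_pmf p q) z = pgf p z * pgf q z"
  unfolding pgf_def conv_pmf_def
  by (subst pmf_expectation_bind_complex[where C=1]) (simp_all add: power_add assms pow_norm_le_1)

primrec offspring_sum :: "nat pmf \<Rightarrow> nat \<Rightarrow> nat pmf" where
  "offspring_sum p 0 = return_pmf 0"
| "offspring_sum p (Suc j) = conv_pmf (offspring_sum p j) p"

text \<open>\<open>gw_law p n j\<close> is the law of the \<open>n\<close>-th generation started from \<open>j\<close> ancestors.\<close>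

primrec gw_law :: "nat pmf \<Rightarrow> nat \<Rightarrow> nat \<Rightarrow> nat pmf" where
  "gw_law p 0 j = return_pmf j"
| "gw_law p (Suc n) j = bind_pmf (gw_law p n j) (offspring_sum p)"

lemma pgf_return: "pgf (return_pmf j) x = x ^ j"
  by (simp add: pgf_def)

lemma pgf_offspring_sum_complex:
  "norm (z::complex) \<le> 1 \<Longrightarrow> pgf (offspring_sum p j) z = pgf p z ^ j"
  by (induction j) (auto simp: pgf_return pgf_conv_complex)

lemma pgf_iter_norm_le_1:
  fixes x :: "'a::{real_normed_field,banach,second_countable_topology}"
  shows "norm x \<le> 1 \<Longrightarrow> norm ((pgf p ^^ n) x) \<le> 1"
  by (induction n) (auto simp: pgf_norm_le_1)

lemma pgf_gw_law_complex:
  "norm (z::complex) \<le> 1 \<Longrightarrow> pgf (gw_law p n j) z = ((pgf p ^^ n) z) ^ j"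
proof (induction n arbitrary: z)
  case (Suc n)
  have "pgf (gw_law p (Suc n) j) z = measure_pmf.expectation (gw_law p n j) (\<lambda>i. pgf (offspring_sum p i) z)"
    unfolding pgf_def gw_law.simps
    by (subst pmf_expectation_bind_complex[where C=1]) (simp_all add: Suc.prems pow_norm_le_1)
  also have "\<dots> = pgf (gw_law p n j) (pgf p z)"
    using pgf_offspring_sum_complex[OF Suc.prems, of p] by (simp add: pgf_def[of "gw_law p n j"])
  also have "\<dots> = ((pgf p ^^ n) (pgf p z)) ^ j"
    using Suc.prems by (intro Suc.IH pgf_norm_le_1)
  finally show ?case by (simp add: funpow_swap1)
qed (simp add: pgf_return)

lemma pgf_iter_of_real: "(pgf p ^^ n) (of_real s :: complex) = of_real ((pgf p ^^ n) s)"
  by (induction n) (simp_all add: pgf_of_real)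

lemma pgf_gw_law_real:
  assumes "\<bar>s\<bar> \<le> (1::real)"
  shows "pgf (gw_law p n j) s = ((pgf p ^^ n) s) ^ j"
proof -
  have "complex_of_real (pgf (gw_law p n j) s) = of_real (((pgf p ^^ n) s) ^ j)"
    using pgf_gw_law_complex[of "of_real s" p n j] assms by (simp add: pgf_iter_of_real pgf_of_real)
  then show ?thesis by (simp only: of_real_eq_iff)
qed

text \<open>The \<open>n\<close>-fold iterate of the generating function, encoded as the generating
  function of a law: positivity, monotonicity, differentiability and modulus bounds then hold
  without induction on \<open>n\<close>. The iterate description is confined to the closed unit
  disc.\<close>

definition gwf :: "nat pmf \<Rightarrow> nat \<Rightarrow> 'a::{real_normed_field,banach,second_countable_topology} \<Rightarrow> 'a" where
  "gwf p n = pgf (gw_law p n 1)"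

definition gwf' :: "nat pmf \<Rightarrow> nat \<Rightarrow> 'a::{real_normed_field,banach,second_countable_topology} \<Rightarrow> 'a" where
  "gwf' p n = pgf_deriv (gw_law p n 1)"

lemma pgf_gw_law: "\<bar>s::real\<bar> \<le> 1 \<Longrightarrow> pgf (gw_law p n j) s = gwf p n s ^ j"
  by (simp add: gwf_def pgf_gw_law_real)

lemma gwf_complex: "norm (z::complex) \<le> 1 \<Longrightarrow> gwf p n z = (pgf p ^^ n) z"
  by (simp add: gwf_def pgf_gw_law_complex)

lemma gwf_real: "\<bar>s::real\<bar> \<le> 1 \<Longrightarrow> gwf p n s = (pgf p ^^ n) s"
  by (simp add: gwf_def pgf_gw_law_real)

lemma gwf_add: "norm (z::complex) \<le> 1 \<Longrightarrow> gwf p (m + n) z = gwf p m (gwf p n z)"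
  by (simp add: gwf_complex funpow_add pgf_iter_norm_le_1)

lemma gwf_add_real: "\<bar>s::real\<bar> \<le> 1 \<Longrightarrow> gwf p (m + n) s = gwf p m (gwf p n s)"
  using pgf_iter_norm_le_1[of s n p] by (simp add: gwf_real funpow_add)

lemma gwf_Suc_real: "\<bar>s::real\<bar> \<le> 1 \<Longrightarrow> gwf p (Suc n) s = pgf p (gwf p n s)"
  by (simp add: gwf_real)

lemma gwf_0 [simp]: "gwf p 0 x = x"
  by (simp add: gwf_def pgf_return)

lemma gwf_one: "norm (z::complex) \<le> 1 \<Longrightarrow> gwf p 1 z = pgf p z"
  by (simp add: gwf_complex)

lemma gwf_of_real: "gwf p n (of_real s :: complex) = of_real (gwf p n s)"
  by (simp add: gwf_def pgf_of_real)

lemma gwf'_of_real: "gwf' p n (of_real s :: complex) = of_real (gwf' p n s)"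
  by (simp add: gwf'_def pgf_deriv_of_real)

section \<open>Iteration of the generating function\<close>

lemma gw_law_1_1 [simp]: "gw_law p (Suc 0) (Suc 0) = p"
proof -
  have "(+) (0::nat) = (\<lambda>x. x)" by auto
  then show ?thesis by (simp add: bind_return_pmf conv_pmf_def pmf.map_ident)
qed

text \<open>The chord slope of the generating function, written through the factorisation of
  \<open>x ^ k - y ^ k\<close>. This form stays meaningful on the diagonal, where it is the
  derivative, and its nonnegative coefficients make it increasing in both arguments, which takes the
  place of convexity.\<close>

definition pgf_diff_quot :: "nat pmf \<Rightarrow> real \<Rightarrow> real \<Rightarrow> real" where
  "pgf_diff_quot p x y = measure_pmf.expectation p (\<lambda>k. \<Sum>i<k. y ^ (k - Suc i) * x ^ i)"

locale supercritical_offspring =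
  fixes p :: "nat pmf" and m :: real
  assumes supercrit: "supercritical_law p" and m_eq: "m = offspring_mean p"
begin

lemma integrable_offspring: "integrable (measure_pmf p) real"
  using supercrit by (simp add: supercritical_law_def)

lemma m_gt_1: "1 < m"
  using supercrit by (simp add: supercritical_law_def m_eq)

lemma m_pos: "0 < m" using m_gt_1 by simp

lemma exists_positive_offspring: "\<exists>k\<ge>1. pmf p k > 0"
proof (rule ccontr)
  assume "\<not> ?thesis"
  then have "pmf p k = 0" if "k \<ge> 1" for k using that pmf_nonneg[of p k] by (meson antisym_conv2 not_le)
  then have "AE k in measure_pmf p. real k = 0"
    by (intro AE_pmfI) (metis One_nat_def Suc_leI gr0I of_nat_0 set_pmf_iff)
  then have "offspring_mean p = 0"
    unfolding offspring_mean_def by (rule integral_eq_zero_AE)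
  with m_gt_1 show False by (simp add: m_eq)
qed

lemma pmf_0_lt_1: "pmf p 0 < 1"
proof -
  obtain k where k: "k \<ge> 1" "pmf p k > 0" using exists_positive_offspring by auto
  have "pmf p 0 + pmf p k = measure (measure_pmf p) {0,k}"
    using k by (subst measure_measure_pmf_finite) auto
  also have "\<dots> \<le> 1" by simp
  finally show ?thesis using k by linarith
qed

text \<open>By convexity the graph lies below the chord from \<open>(0, pmf p 0)\<close> to
  \<open>(1, 1)\<close>. This keeps \<open>[0, 1)\<close> invariant.\<close>

lemma pgf_le_affine:
  assumes "0 \<le> (s::real)" "s \<le> 1"
  shows "pgf p s \<le> 1 - (1 - pmf p 0) * (1 - s)"
proof -
  have "pgf p s \<le> measure_pmf.expectation p (\<lambda>k. indicator {0} k * (1 - s) + s)"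
    unfolding pgf_def
  proof (rule integral_mono)
    show "integrable (measure_pmf p) (\<lambda>k. s ^ k)" using assms by (intro integrable_pgf) auto
    show "s ^ k \<le> indicator {0} k * (1 - s) + s" for k
      using assms power_decreasing[of 1 k s] by (cases k) auto
  qed (rule integrable_pmf_bounded[where C=1], use assms in \<open>auto simp: indicator_def\<close>)
  also have "\<dots> = pmf p 0 * (1 - s) + s"
    by (subst Bochner_Integration.integral_add)
       (auto simp: pmf.rep_eq intro!: integrable_pmf_bounded[where C=1] split: split_indicator)
  finally show ?thesis by (simp add: algebra_simps)
qed

lemma pgf_lt_1: "0 \<le> (s::real) \<Longrightarrow> s < 1 \<Longrightarrow> pgf p s < 1"
  using pgf_le_affine[of s] pmf_0_lt_1 mult_pos_pos[of "1 - pmf p 0" "1 - s"] by linarith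

lemma gwf_bounds:
  assumes "0 \<le> (s::real)" "s < 1"
  shows "0 \<le> gwf p n s" "gwf p n s < 1"
proof -
  show "gwf p n s < 1"
  proof (induction n)
    case (Suc n)
    have "0 \<le> gwf p n s" using assms by (simp add: gwf_def pgf_nonneg)
    with Suc show ?case using assms by (simp add: gwf_Suc_real pgf_lt_1)
  qed (use assms in simp)
  show "0 \<le> gwf p n s" using assms by (simp add: gwf_def pgf_nonneg)
qed

lemma gwf_mono: "0 \<le> (s::real) \<Longrightarrow> s \<le> t \<Longrightarrow> t \<le> 1 \<Longrightarrow> gwf p n s \<le> gwf p n t"
  by (simp add: gwf_def pgf_mono)

lemma norm_gwf_lt_1: "norm (z::complex) < 1 \<Longrightarrow> norm (gwf p n z) < 1"
  using norm_pgf_le[of z "norm z" "gw_law p n 1"] gwf_bounds[of "norm z" n] by (auto simp: gwf_def)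

lemma gwf'_add:
  assumes "norm (z::complex) < 1"
  shows "gwf' p (M + n) z = gwf' p M (gwf p n z) * gwf' p n z"
proof (rule DERIV_unique)
  show "(gwf p (M + n) has_field_derivative gwf' p (M + n) z) (at z)"
    unfolding gwf_def gwf'_def by (rule DERIV_pgf[OF assms])
  have "(gwf p n has_field_derivative gwf' p n z) (at z)"
    unfolding gwf_def gwf'_def by (rule DERIV_pgf[OF assms])
  moreover have "(gwf p M has_field_derivative gwf' p M (gwf p n z)) (at (gwf p n z))"
    unfolding gwf_def[of p M] gwf'_def by (rule DERIV_pgf[OF norm_gwf_lt_1[OF assms]])
  ultimately have "((gwf p M \<circ> gwf p n) has_field_derivative gwf' p M (gwf p n z) * gwf' p n z) (at z)"
    by (intro DERIV_chain)
  then show "(gwf p (M + n) has_field_derivative gwf' p M (gwf p n z) * gwf' p n z) (at z)"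
    by (rule has_field_derivative_transform_within_open[where S="ball 0 1"])
       (use assms in \<open>auto simp: gwf_add\<close>)
qed

lemma gwf'_add_real:
  assumes "0 \<le> (s::real)" "s < 1"
  shows "gwf' p (M + n) s = gwf' p M (gwf p n s) * gwf' p n s"
proof -
  have "complex_of_real (gwf' p (M + n) s) = of_real (gwf' p M (gwf p n s) * gwf' p n s)"
    using gwf'_add[of "of_real s" M n] assms by (simp add: gwf_of_real gwf'_of_real)
  then show ?thesis by (simp only: of_real_eq_iff)
qed

lemma gwf'_prod:
  assumes "0 \<le> (s::real)" "s < 1"
  shows "gwf' p n s = (\<Prod>i<n. pgf_deriv p (gwf p i s))"
proof (induction n)
  case 0
  then show ?case by (simp add: gwf'_def pgf_deriv_def)
next
  case (Suc n)
  have "gwf' p (1 + n) s = gwf' p 1 (gwf p n s) * gwf' p n s"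
    using assms by (rule gwf'_add_real)
  then show ?case using Suc by (simp add: gwf'_def del: gw_law.simps)
qed

lemma diff_quot_term_le:
  assumes "x \<in> {0..1}" "y \<in> {0..(1::real)}"
  shows "(\<Sum>i<k. y ^ (k - Suc i) * x ^ i) \<le> real k" "0 \<le> (\<Sum>i<k. y ^ (k - Suc i) * x ^ i)"
proof -
  have "(\<Sum>i<k. y ^ (k - Suc i) * x ^ i) \<le> (\<Sum>i<k. 1)"
    using assms by (intro sum_mono mult_le_one) (auto simp: power_le_one)
  then show "(\<Sum>i<k. y ^ (k - Suc i) * x ^ i) \<le> real k" by simp
  show "0 \<le> (\<Sum>i<k. y ^ (k - Suc i) * x ^ i)" using assms by (auto intro!: sum_nonneg)
qed

lemma integrable_diff_quot:
  assumes "x \<in> {0..1}" "y \<in> {0..(1::real)}"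
  shows "integrable (measure_pmf p) (\<lambda>k. \<Sum>i<k. y ^ (k - Suc i) * x ^ i)"
  by (rule Bochner_Integration.integrable_bound[OF integrable_offspring])
     (use diff_quot_term_le[OF assms] in auto)

lemma pgf_diff:
  assumes "x \<in> {0..1}" "y \<in> {0..(1::real)}"
  shows "pgf p x - pgf p y = (x - y) * pgf_diff_quot p x y"
proof -
  have "pgf p x - pgf p y = measure_pmf.expectation p (\<lambda>k. x ^ k - y ^ k)"
    using assms by (simp add: pgf_def integrable_pgf)
  also have "\<dots> = measure_pmf.expectation p (\<lambda>k. (x - y) * (\<Sum>i<k. y ^ (k - Suc i) * x ^ i))"
    by (simp add: power_diff_sumr2)
  finally show ?thesis by (simp add: pgf_diff_quot_def)
qed

lemma pgf_diff_quot_mono: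
  assumes "x \<in> {0..1}" "y \<in> {0..1}" "x \<le> x'" "y \<le> y'" "x' \<le> 1" "y' \<le> 1"
  shows "pgf_diff_quot p x y \<le> pgf_diff_quot p x' y'"
  unfolding pgf_diff_quot_def
  by (intro integral_mono integrable_diff_quot sum_mono mult_mono power_mono) (use assms in auto)

lemma pgf_diff_quot_nonneg: "x \<in> {0..1} \<Longrightarrow> y \<in> {0..1} \<Longrightarrow> 0 \<le> pgf_diff_quot p x y"
  unfolding pgf_diff_quot_def using diff_quot_term_le(2) by (intro integral_nonneg_AE) auto

lemma pgf_diff_quot_diag: "pgf_diff_quot p x x = pgf_deriv p x"
proof -
  have "(\<Sum>i<k. x ^ (k - Suc i) * x ^ i) = real k * x ^ (k - 1)" for k
  proof -
    have "(\<Sum>i<k. x ^ (k - Suc i) * x ^ i) = (\<Sum>i<k. x ^ (k - 1))"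
      by (intro sum.cong refl) (auto simp flip: power_add)
    then show ?thesis by simp
  qed
  then show ?thesis by (simp add: pgf_diff_quot_def pgf_deriv_def)
qed

text \<open>Chord slopes ending at 1 tend to the mean by dominated convergence, with
  \<open>k\<close> as dominating function. Monotonicity extends the bound from one point of the
  sequence to everything on its right.\<close>

lemma pgf_diff_quot_near_1:
  assumes "\<epsilon> > 0"
  obtains s0 where "0 \<le> s0" "s0 < 1" "\<And>s. s0 \<le> s \<Longrightarrow> s \<le> 1 \<Longrightarrow> m - \<epsilon> < pgf_diff_quot p s 1"
proof -
  define s where "s n = 1 - 1 / real (Suc n)" for n
  have s: "0 \<le> s n" "s n < 1" for n by (auto simp: s_def)
  have s_lim: "s \<longlonglongrightarrow> 1"
    unfolding s_def using tendsto_diff[OF tendsto_const[of 1] LIMSEQ_inverse_real_of_nat] by (simp add: field_simps)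
  have "(\<lambda>n. measure_pmf.expectation p (\<lambda>k. \<Sum>i<k. 1 ^ (k - Suc i) * s n ^ i)) \<longlonglongrightarrow> measure_pmf.expectation p real"
  proof (rule integral_dominated_convergence[where w=real])
    show "AE k in measure_pmf p. (\<lambda>n. \<Sum>i<k. 1 ^ (k - Suc i) * s n ^ i) \<longlonglongrightarrow> real k"
    proof (rule AE_I2)
      fix k
      have "(\<lambda>n. \<Sum>i<k. 1 ^ (k - Suc i) * s n ^ i) \<longlonglongrightarrow> (\<Sum>i<k. 1 ^ (k - Suc i) * 1 ^ i)"
        by (intro tendsto_intros s_lim)
      then show "(\<lambda>n. \<Sum>i<k. 1 ^ (k - Suc i) * s n ^ i) \<longlonglongrightarrow> real k" by simp
    qed
    show "AE k in measure_pmf p. norm (\<Sum>i<k. 1 ^ (k - Suc i) * s n ^ i) \<le> real k" for n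
      using diff_quot_term_le[of "s n" 1] s(1)[of n] s(2)[of n] by (intro AE_I2) auto
  qed (auto intro: integrable_offspring)
  then have "(\<lambda>n. pgf_diff_quot p (s n) 1) \<longlonglongrightarrow> m"
    by (simp add: pgf_diff_quot_def m_eq offspring_mean_def)
  then have "\<forall>\<^sub>F n in sequentially. m - \<epsilon> < pgf_diff_quot p (s n) 1"
    by (rule order_tendstoD) (use assms in auto)
  then obtain n where n: "m - \<epsilon> < pgf_diff_quot p (s n) 1" by (auto simp: eventually_sequentially)
  show thesis
  proof (rule that[of "s n"])
    fix t assume "s n \<le> t" "t \<le> 1"
    then show "m - \<epsilon> < pgf_diff_quot p t 1"
      using s[of n] pgf_diff_quot_mono[of "s n" 1 t 1] n by auto
  qed (use s in auto)
qed

lemma pgf_below_diagonal_near_1: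
  assumes "s0 < (1::real)"
  obtains s1 where "s0 < s1" "0 \<le> s1" "s1 < 1" "pgf p s1 < s1"
proof -
  \<comment> \<open>With tolerance \<open>m - 1\<close> the chord slope exceeds 1, which pushes the
    graph below the diagonal.\<close>
  obtain t where t: "0 \<le> t" "t < 1" "\<And>s. t \<le> s \<Longrightarrow> s \<le> 1 \<Longrightarrow> m - (m - 1) < pgf_diff_quot p s 1"
    by (rule pgf_diff_quot_near_1[of "m - 1"]) (use m_gt_1 in simp, blast)
  define s1 where "s1 = (1 + max t s0) / 2"
  have s1: "t \<le> s1" "s0 < s1" "s1 < 1" "0 \<le> s1" using t assms by (auto simp: s1_def)
  have "1 - pgf p s1 = (1 - s1) * pgf_diff_quot p s1 1"
    using pgf_diff[of s1 1] s1 by (simp add: algebra_simps)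
  also have "(1 - s1) * pgf_diff_quot p s1 1 > (1 - s1) * 1"
    using t(3)[of s1] s1 by (intro mult_strict_left_mono) auto
  finally have "pgf p s1 < s1" by simp
  then show thesis using that s1 by blast
qed

text \<open>A fixed point is chosen before uniqueness is known. It turns out to be the limit of
  \<open>gwf p n 0\<close>, hence the extinction probability.\<close>

definition ext_prob :: real where "ext_prob = (SOME x. 0 \<le> x \<and> x < 1 \<and> pgf p x = x)"

lemma ext_prob: "0 \<le> ext_prob" "ext_prob < 1" "pgf p ext_prob = ext_prob"
proof -
  obtain s1 :: real where s1: "0 < s1" "0 \<le> s1" "s1 < 1" "pgf p s1 < s1"
    by (rule pgf_below_diagonal_near_1[OF zero_less_one]) blast
  have "continuous_on {0..s1} (\<lambda>x. pgf p x - x)"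
  proof (rule continuous_on_diff)
    have "{0..s1} \<subseteq> cball 0 1" using s1(3) by auto
    then show "continuous_on {0..s1} (pgf p)" by (rule continuous_on_subset[OF continuous_on_pgf])
  qed (rule continuous_on_id)
  moreover have "pgf p s1 - s1 \<le> 0" "0 \<le> pgf p 0 - (0::real)" "0 \<le> s1" using s1 by (auto simp: pgf_0)
  ultimately have "\<exists>x. 0 \<le> x \<and> x \<le> s1 \<and> pgf p x - x = 0"
    using IVT2'[of "\<lambda>x. pgf p x - x" s1 0 0] by blast
  then obtain x where "0 \<le> x" "x \<le> s1" "pgf p x - x = 0" by blast
  then have "\<exists>x::real. 0 \<le> x \<and> x < 1 \<and> pgf p x = x" using s1 by (intro exI[of _ x]) auto
  then have "0 \<le> ext_prob \<and> ext_prob < 1 \<and> pgf p ext_prob = ext_prob"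
    unfolding ext_prob_def by (rule someI_ex)
  then show "0 \<le> ext_prob" "ext_prob < 1" "pgf p ext_prob = ext_prob" by blast+
qed

text \<open>\<open>\<kappa>\<close> is the slope of the chord of \<open>pgf p\<close> between its fixed point and a point \<open>s1\<close> below the diagonal; by
  monotonicity of difference quotients it dominates all slopes on \<open>[0, s1]\<close>.\<close>

lemma pgf_contraction:
  assumes "s0 < 1"
  obtains s1 \<kappa> where "s0 \<le> s1" "0 \<le> s1" "s1 < 1" "ext_prob \<le> s1" "0 \<le> \<kappa>" "\<kappa> < 1" "pgf_deriv p ext_prob \<le> \<kappa>"
    "\<And>n s. 0 \<le> s \<Longrightarrow> s \<le> s1 \<Longrightarrow> gwf p n s \<in> {0..s1} \<and> \<bar>gwf p n s - ext_prob\<bar> \<le> \<kappa> ^ n"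
proof -
  obtain s1 where s1: "max s0 ext_prob < s1" "0 \<le> s1" "s1 < 1" "pgf p s1 < s1"
    by (rule pgf_below_diagonal_near_1[of "max s0 ext_prob"]) (use assms ext_prob in simp, blast)
  define \<kappa> where "\<kappa> = pgf_diff_quot p s1 ext_prob"
  have *: "pgf p s1 - ext_prob = (s1 - ext_prob) * \<kappa>"
    using pgf_diff[of s1 ext_prob] s1 ext_prob by (simp add: \<kappa>_def)
  have \<kappa>: "0 \<le> \<kappa>" using s1 ext_prob by (auto simp: \<kappa>_def intro!: pgf_diff_quot_nonneg)
  have \<kappa>1: "\<kappa> < 1"
  proof (rule ccontr)
    assume "\<not> \<kappa> < 1"
    then have "(s1 - ext_prob) * 1 \<le> (s1 - ext_prob) * \<kappa>" using s1 by (intro mult_left_mono) auto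
    then show False using * s1 by auto
  qed
  have step: "pgf p s \<in> {0..s1} \<and> \<bar>pgf p s - ext_prob\<bar> \<le> \<kappa> * \<bar>s - ext_prob\<bar>" if "s \<in> {0..s1}" for s
  proof -
    have "\<bar>pgf p s - ext_prob\<bar> = \<bar>s - ext_prob\<bar> * pgf_diff_quot p s ext_prob"
      using pgf_diff[of s ext_prob] that s1 ext_prob pgf_diff_quot_nonneg[of s ext_prob] by (simp add: abs_mult)
    also have "\<dots> \<le> \<bar>s - ext_prob\<bar> * \<kappa>"
      unfolding \<kappa>_def using that s1 ext_prob by (intro mult_left_mono pgf_diff_quot_mono) auto
    finally have "\<bar>pgf p s - ext_prob\<bar> \<le> \<kappa> * \<bar>s - ext_prob\<bar>" by (simp add: mult.commute)
    moreover have "pgf p s \<le> pgf p s1" using that s1 by (intro pgf_mono) auto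
    ultimately show ?thesis using s1 that by (auto intro: pgf_nonneg)
  qed
  have iter: "gwf p n s \<in> {0..s1} \<and> \<bar>gwf p n s - ext_prob\<bar> \<le> \<kappa> ^ n" if "0 \<le> s" "s \<le> s1" for n s
  proof (induction n)
    case 0
    then show ?case using that s1 ext_prob by (auto simp: abs_le_iff)
  next
    case (Suc n)
    have "\<bar>pgf p (gwf p n s) - ext_prob\<bar> \<le> \<kappa> * \<kappa> ^ n"
      using step[of "gwf p n s"] Suc \<kappa> mult_left_mono[of "\<bar>gwf p n s - ext_prob\<bar>" "\<kappa> ^ n" \<kappa>] by linarith
    then show ?case using step[of "gwf p n s"] Suc that s1 by (simp add: gwf_Suc_real)
  qed
  have "pgf_deriv p ext_prob \<le> \<kappa>"
    unfolding \<kappa>_def pgf_diff_quot_diag[symmetric] using s1 ext_prob by (intro pgf_diff_quot_mono) auto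
  with \<kappa> \<kappa>1 s1 iter show thesis by (intro that[of s1 \<kappa>]) auto
qed

text \<open>A fixed point is a constant orbit, and every orbit starting below 1 contracts to
  \<open>ext_prob\<close>.\<close>

lemma pgf_fixed_point_unique:
  assumes "0 \<le> x" "x < 1" "pgf p x = x"
  shows "x = ext_prob"
proof -
  obtain s1 \<kappa> where s1: "x \<le> s1" "0 \<le> s1" "s1 < 1" "ext_prob \<le> s1" "0 \<le> \<kappa>" "\<kappa> < 1" "pgf_deriv p ext_prob \<le> \<kappa>"
    and *: "\<And>n s. 0 \<le> s \<Longrightarrow> s \<le> s1 \<Longrightarrow> gwf p n s \<in> {0..s1} \<and> \<bar>gwf p n s - ext_prob\<bar> \<le> \<kappa> ^ n"
    by (rule pgf_contraction[OF assms(2)]) blast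
  have fx: "gwf p n x = x" for n
    by (induction n) (use assms in \<open>auto simp: gwf_Suc_real\<close>)
  have "(\<lambda>n. \<kappa> ^ n) \<longlonglongrightarrow> 0" using s1 by (intro LIMSEQ_power_zero) auto
  moreover have "\<bar>x - ext_prob\<bar> \<le> \<kappa> ^ n" for n using *[of x n] assms s1 fx by auto
  ultimately have "\<bar>x - ext_prob\<bar> \<le> 0"
    by (intro LIMSEQ_le_const) auto
  then show ?thesis by simp
qed

lemma gwf_0_tendsto: "(\<lambda>n. gwf p n 0) \<longlonglongrightarrow> ext_prob"
proof -
  obtain s1 \<kappa> where s1: "0 \<le> s1" "0 \<le> s1" "s1 < 1" "ext_prob \<le> s1" "0 \<le> \<kappa>" "\<kappa> < 1" "pgf_deriv p ext_prob \<le> \<kappa>"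
    and *: "\<And>n s. 0 \<le> s \<Longrightarrow> s \<le> s1 \<Longrightarrow> gwf p n s \<in> {0..s1} \<and> \<bar>gwf p n s - ext_prob\<bar> \<le> \<kappa> ^ n"
    by (rule pgf_contraction[OF zero_less_one]) blast
  have "(\<lambda>n. \<kappa> ^ n) \<longlonglongrightarrow> 0" using s1 by (intro LIMSEQ_power_zero) auto
  then have "(\<lambda>n. gwf p n 0 - ext_prob) \<longlonglongrightarrow> 0"
    by (rule Lim_null_comparison[rotated]) (use *[of 0] s1 in auto)
  then show ?thesis by (simp add: LIM_zero_iff)
qed

text \<open>Turns geometric convergence of an orbit to \<open>ext_prob\<close> into geometric
  convergence of the factors \<open>pgf_deriv p (gwf p i s)\<close> of the iterated
  derivative.\<close>

lemma pgf_deriv_lipschitz: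
  assumes "0 \<le> s" "s < (1::real)"
  obtains \<Lambda> where "0 \<le> \<Lambda>" "\<And>x y. x \<in> {0..s} \<Longrightarrow> y \<in> {0..s} \<Longrightarrow> \<bar>pgf_deriv p x - pgf_deriv p y\<bar> \<le> \<Lambda> * \<bar>x - y\<bar>"
proof -
  \<comment> \<open>The square root shares \<open>s ^ (k - 2)\<close> between the two linear factors
    \<open>k\<close> and \<open>k - 1\<close>. The floor \<open>1/4\<close> gives
    \<open>2 * t \<ge> 1\<close>, which pays for the odd power of \<open>t\<close>.\<close>
  define t where "t = sqrt (max s (1/4))"
  have t: "1/2 \<le> t" "t < 1" "s \<le> t^2"
  proof -
    show "1/2 \<le> t" unfolding t_def by (rule real_le_rsqrt) (simp add: power2_eq_square)
  qed (use assms in \<open>auto simp: t_def\<close>)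
  obtain C where C: "\<And>k. real k * t ^ (k - 1) \<le> C"
    using bounded_nat_times_power[of t] t by auto
  have C0: "0 \<le> C" using C[of 0] by simp
  have B: "real k * (real (k - 1) * s ^ (k - 2)) \<le> 2 * C\<^sup>2" for k
  proof (cases "k \<ge> 2")
    case True
    then obtain j where j: "k = j + 2" by (metis add.commute le_Suc_ex)
    have "s ^ j \<le> (t\<^sup>2) ^ j" using assms t by (intro power_mono) auto
    also have "\<dots> \<le> 2 * t * (t\<^sup>2) ^ j" using t by simp
    also have "\<dots> = 2 * (t ^ (k - 1) * t ^ (k - 2))"
      by (simp add: j power2_eq_square power_mult_distrib)
    finally have "real k * (real (k - 1) * s ^ (k - 2)) \<le> real k * (real (k - 1) * (2 * (t ^ (k - 1) * t ^ (k - 2))))"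
      by (intro mult_left_mono) (auto simp: j)
    also have "\<dots> = 2 * ((real k * t ^ (k - 1)) * (real (k - 1) * t ^ (k - 1 - 1)))"
      by (simp add: j)
    also have "\<dots> \<le> 2 * (C * C)"
      using C[of k] C[of "k - 1"] C0 t by (intro mult_left_mono mult_mono) auto
    finally show ?thesis by (simp add: power2_eq_square)
  next
    case False
    then have "k = 0 \<or> k = 1" by auto
    then show ?thesis using C0 by auto
  qed
  show thesis
  proof (rule that[of "2 * C\<^sup>2"])
    fix x y assume xy: "x \<in> {0..s}" "y \<in> {0..s}"
    have T: "\<bar>real k * x ^ (k - 1) - real k * y ^ (k - 1)\<bar> \<le> 2 * C\<^sup>2 * \<bar>x - y\<bar>" for k
    proof -
      have "(\<Sum>i<k-1. y ^ (k - 1 - Suc i) * x ^ i) \<le> (\<Sum>i<k-1. s ^ (k - 1 - Suc i) * s ^ i)"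
        using xy by (intro sum_mono mult_mono power_mono) auto
      also have "\<dots> = (\<Sum>i<k-1. s ^ (k - 2))"
        by (intro sum.cong refl) (auto simp flip: power_add)
      finally have le: "(\<Sum>i<k-1. y ^ (k - 1 - Suc i) * x ^ i) \<le> real (k - 1) * s ^ (k - 2)" by simp
      have ge: "0 \<le> (\<Sum>i<k-1. y ^ (k - 1 - Suc i) * x ^ i)" using xy by (auto intro!: sum_nonneg)
      have "\<bar>real k * x ^ (k - 1) - real k * y ^ (k - 1)\<bar> = real k * \<bar>x ^ (k - 1) - y ^ (k - 1)\<bar>"
        by (simp add: abs_mult flip: right_diff_distrib)
      also have "\<dots> = \<bar>x - y\<bar> * (real k * (\<Sum>i<k-1. y ^ (k - 1 - Suc i) * x ^ i))"
        using ge by (simp add: power_diff_sumr2 abs_mult)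
      also have "\<dots> \<le> \<bar>x - y\<bar> * (real k * (real (k - 1) * s ^ (k - 2)))"
        using le by (intro mult_left_mono) auto
      also have "\<dots> \<le> \<bar>x - y\<bar> * (2 * C\<^sup>2)" by (intro mult_left_mono B) auto
      finally show ?thesis by (simp add: mult_ac)
    qed
    have "\<bar>pgf_deriv p x - pgf_deriv p y\<bar> = \<bar>measure_pmf.expectation p (\<lambda>k. real k * x ^ (k - 1) - real k * y ^ (k - 1))\<bar>"
      unfolding pgf_deriv_def using xy assms integrable_pgf_deriv[of x p] integrable_pgf_deriv[of y p]
      by simp
    also have "\<dots> \<le> measure_pmf.expectation p (\<lambda>k. \<bar>real k * x ^ (k - 1) - real k * y ^ (k - 1)\<bar>)"
      by (rule integral_abs_bound)
    also have "\<dots> \<le> measure_pmf.expectation p (\<lambda>k. 2 * C\<^sup>2 * \<bar>x - y\<bar>)"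
      using T by (intro integral_mono integrable_pmf_bounded[where C="2 * C\<^sup>2 * \<bar>x - y\<bar>"]) auto
    finally show "\<bar>pgf_deriv p x - pgf_deriv p y\<bar> \<le> 2 * C\<^sup>2 * \<bar>x - y\<bar>" by simp
  qed simp
qed

end

section \<open>Exponential rate of the iterated derivative in the Schroeder case\<close>

locale schroeder_offspring = supercritical_offspring +
  assumes schroeder: "schroeder_type p"
begin

definition \<gamma> :: real where "\<gamma> = pgf_deriv p ext_prob"

text \<open>The Schroeder condition enters. If \<open>pmf p 1 > 0\<close>, the linear term alone is
  positive, with \<open>0 ^ 0 = 1\<close> covering \<open>ext_prob = 0\<close>. Otherwise
  \<open>pmf p 0 > 0\<close> forces \<open>ext_prob > 0\<close>, and any positive family size in the
  support serves.\<close>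

lemma \<gamma>_pos: "0 < \<gamma>"
proof -
  have le: "pmf p k * (real k * ext_prob ^ (k - 1)) \<le> \<gamma>" for k
  proof -
    have "pmf p k * (real k * ext_prob ^ (k - 1)) = measure_pmf.expectation p (\<lambda>j. indicator {k} j * (real k * ext_prob ^ (k - 1)))"
      by (simp add: pmf.rep_eq)
    also have "\<dots> \<le> measure_pmf.expectation p (\<lambda>j. real j * ext_prob ^ (j - 1))"
      using ext_prob integrable_pgf_deriv[of ext_prob p]
      by (intro integral_mono integrable_mult_left) (auto simp: indicator_def intro: integrable_pmf_bounded[where C=1])
    finally show ?thesis by (simp add: \<gamma>_def pgf_deriv_def)
  qed
  show ?thesis
  proof (cases "pmf p 1 > 0")
    case True
    then show ?thesis using le[of 1] by simp
  next
    case False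
    then have "pmf p 0 > 0"
      using schroeder pmf_nonneg[of p 1] by (auto simp: schroeder_type_def)
    then have "ext_prob > 0"
      using pgf_mono[of 0 ext_prob p] ext_prob by (auto simp: pgf_0)
    moreover obtain k where "k \<ge> 1" "pmf p k > 0" using exists_positive_offspring by auto
    ultimately have "0 < pmf p k * (real k * ext_prob ^ (k - 1))" by simp
    then show ?thesis using le[of k] by linarith
  qed
qed

lemma \<gamma>_lt_1: "\<gamma> < 1"
  unfolding \<gamma>_def by (rule pgf_contraction[OF zero_less_one]) (rule le_less_trans)

lemma geometric_sum_le:
  assumes "0 \<le> \<kappa>" "\<kappa> < (1::real)"
  shows "(\<Sum>i<n. \<kappa> ^ i) \<le> 1 / (1 - \<kappa>)"
proof -
  have "(\<Sum>i<n. \<kappa> ^ i) = (1 - \<kappa> ^ n) / (1 - \<kappa>)" using assms by (simp add: sum_gp_strict)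
  also have "\<dots> \<le> 1 / (1 - \<kappa>)" using assms by (intro divide_right_mono) auto
  finally show ?thesis .
qed

text \<open>The derivative is a product along the orbit of \<rho>. Each factor equals \<gamma> up to
  a relative error \<open>\<Lambda> / \<gamma> * \<kappa> ^ i\<close>, and these errors are
  summable.\<close>

lemma gwf'_upper:
  assumes "0 \<le> \<rho>" "\<rho> < 1"
  obtains C where "C > 0" "\<And>n. gwf' p n \<rho> \<le> C * \<gamma> ^ n"
proof -
  obtain s1 \<kappa> where s1: "\<rho> \<le> s1" "0 \<le> s1" "s1 < 1" "ext_prob \<le> s1" "0 \<le> \<kappa>" "\<kappa> < 1" "pgf_deriv p ext_prob \<le> \<kappa>"
    and *: "\<And>n s. 0 \<le> s \<Longrightarrow> s \<le> s1 \<Longrightarrow> gwf p n s \<in> {0..s1} \<and> \<bar>gwf p n s - ext_prob\<bar> \<le> \<kappa> ^ n"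
    by (rule pgf_contraction[OF assms(2)]) blast
  obtain \<Lambda> where \<Lambda>: "0 \<le> \<Lambda>" "\<And>x y. x \<in> {0..s1} \<Longrightarrow> y \<in> {0..s1} \<Longrightarrow> \<bar>pgf_deriv p x - pgf_deriv p y\<bar> \<le> \<Lambda> * \<bar>x - y\<bar>"
    by (rule pgf_deriv_lipschitz[OF s1(2,3)]) blast
  have factor: "pgf_deriv p (gwf p i \<rho>) \<le> \<gamma> * exp (\<Lambda> / \<gamma> * \<kappa> ^ i)" for i
  proof -
    have "\<bar>pgf_deriv p (gwf p i \<rho>) - \<gamma>\<bar> \<le> \<Lambda> * \<bar>gwf p i \<rho> - ext_prob\<bar>"
      unfolding \<gamma>_def using *[of \<rho> i] assms s1 ext_prob by (intro \<Lambda>) auto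
    also have "\<dots> \<le> \<Lambda> * \<kappa> ^ i" using *[of \<rho> i] assms s1 \<Lambda> by (intro mult_left_mono) auto
    finally have "pgf_deriv p (gwf p i \<rho>) \<le> \<gamma> * (1 + \<Lambda> / \<gamma> * \<kappa> ^ i)"
      using \<gamma>_pos by (simp add: algebra_simps)
    also have "\<dots> \<le> \<gamma> * exp (\<Lambda> / \<gamma> * \<kappa> ^ i)"
      using \<gamma>_pos by (intro mult_left_mono exp_ge_add_one_self) auto
    finally show ?thesis .
  qed
  have "gwf' p n \<rho> \<le> exp (\<Lambda> / \<gamma> * (1 / (1 - \<kappa>))) * \<gamma> ^ n" for n
  proof -
    have "gwf' p n \<rho> = (\<Prod>i<n. pgf_deriv p (gwf p i \<rho>))" using assms by (rule gwf'_prod)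
    also have "\<dots> \<le> (\<Prod>i<n. \<gamma> * exp (\<Lambda> / \<gamma> * \<kappa> ^ i))"
      using factor assms gwf_bounds by (intro prod_mono) (auto intro: pgf_deriv_nonneg)
    also have "\<dots> = \<gamma> ^ n * exp (\<Lambda> / \<gamma> * (\<Sum>i<n. \<kappa> ^ i))"
      by (simp add: prod.distrib exp_sum sum_distrib_left)
    also have "\<dots> \<le> \<gamma> ^ n * exp (\<Lambda> / \<gamma> * (1 / (1 - \<kappa>)))"
      using \<gamma>_pos \<Lambda> s1 geometric_sum_le by (intro mult_left_mono iffD2[OF exp_le_cancel_iff]) auto
    finally show ?thesis by (simp add: mult_ac)
  qed
  then show thesis by (intro that) auto
qed

text \<open>From \<open>gwf p a 0\<close> with \<open>a\<close> large the orbit is so close to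
  \<open>ext_prob\<close> that the relative errors of all factors add up to at most
  \<open>1/2\<close>. The threshold is independent of \<open>N\<close>, as the later uniformity
  requires.\<close>

lemma gwf'_lower:
  obtains a0 where "\<And>a N. a \<ge> a0 \<Longrightarrow> gwf' p N (gwf p a 0) \<ge> \<gamma> ^ N / 2"
proof -
  obtain s1 \<kappa> where s1: "0 \<le> s1" "0 \<le> s1" "s1 < 1" "ext_prob \<le> s1" "0 \<le> \<kappa>" "\<kappa> < 1" "pgf_deriv p ext_prob \<le> \<kappa>"
    and *: "\<And>n s. 0 \<le> s \<Longrightarrow> s \<le> s1 \<Longrightarrow> gwf p n s \<in> {0..s1} \<and> \<bar>gwf p n s - ext_prob\<bar> \<le> \<kappa> ^ n"
    by (rule pgf_contraction[OF zero_less_one]) blast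
  obtain \<Lambda> where \<Lambda>: "0 \<le> \<Lambda>" "\<And>x y. x \<in> {0..s1} \<Longrightarrow> y \<in> {0..s1} \<Longrightarrow> \<bar>pgf_deriv p x - pgf_deriv p y\<bar> \<le> \<Lambda> * \<bar>x - y\<bar>"
    by (rule pgf_deriv_lipschitz[OF s1(2,3)]) blast
  have "(\<lambda>a. \<Lambda> / \<gamma> * (1 / (1 - \<kappa>)) * \<kappa> ^ a) \<longlonglongrightarrow> \<Lambda> / \<gamma> * (1 / (1 - \<kappa>)) * 0"
    using s1 by (intro tendsto_intros LIMSEQ_power_zero) auto
  then have "\<forall>\<^sub>F a in sequentially. \<Lambda> / \<gamma> * (1 / (1 - \<kappa>)) * \<kappa> ^ a < 1 / 2"
    by (rule order_tendstoD) auto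
  then obtain a0 where a0: "\<And>a. a \<ge> a0 \<Longrightarrow> \<Lambda> / \<gamma> * (1 / (1 - \<kappa>)) * \<kappa> ^ a < 1 / 2"
    by (auto simp: eventually_sequentially)
  show thesis
  proof (rule that[of a0])
    fix a N assume a: "a \<ge> a0"
    define x where "x i = \<Lambda> / \<gamma> * \<kappa> ^ a * \<kappa> ^ i" for i
    have x0: "0 \<le> x i" for i using \<Lambda> \<gamma>_pos s1 by (simp add: x_def)
    have sum: "(\<Sum>i<n. x i) \<le> 1 / 2" for n
    proof -
      have "(\<Sum>i<n. x i) = \<Lambda> / \<gamma> * \<kappa> ^ a * (\<Sum>i<n. \<kappa> ^ i)" by (simp add: x_def sum_distrib_left)
      also have "\<dots> \<le> \<Lambda> / \<gamma> * \<kappa> ^ a * (1 / (1 - \<kappa>))"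
        using \<Lambda> \<gamma>_pos s1 geometric_sum_le by (intro mult_left_mono) auto
      also have "\<dots> = \<Lambda> / \<gamma> * (1 / (1 - \<kappa>)) * \<kappa> ^ a" by simp
      finally show ?thesis using a0[OF a] by linarith
    qed
    have x1: "x i \<le> 1" for i
    proof -
      have "x i \<le> (\<Sum>j<Suc i. x j)" using x0 by (intro member_le_sum) auto
      then show ?thesis using sum[of "Suc i"] by linarith
    qed
    have fa: "0 \<le> gwf p a (0::real)" "gwf p a 0 < (1::real)" using gwf_bounds[of 0 a] by auto
    have factor: "\<gamma> * (1 - x i) \<le> pgf_deriv p (gwf p i (gwf p a 0))" for i
    proof -
      have *: "gwf p (i + a) 0 \<in> {0..s1} \<and> \<bar>gwf p (i + a) 0 - ext_prob\<bar> \<le> \<kappa> ^ (i + a)"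
        using *[of 0 "i + a"] s1 by simp
      have "\<bar>pgf_deriv p (gwf p (i + a) 0) - \<gamma>\<bar> \<le> \<Lambda> * \<bar>gwf p (i + a) 0 - ext_prob\<bar>"
        unfolding \<gamma>_def using * s1 ext_prob by (intro \<Lambda>) auto
      also have "\<dots> \<le> \<Lambda> * \<kappa> ^ (i + a)" using * \<Lambda> by (intro mult_left_mono) auto
      finally have "\<gamma> - \<Lambda> * \<kappa> ^ (i + a) \<le> pgf_deriv p (gwf p (i + a) 0)" by linarith
      moreover have "\<gamma> * (1 - x i) = \<gamma> - \<Lambda> * \<kappa> ^ (i + a)"
        using \<gamma>_pos by (simp add: x_def algebra_simps power_add)
      ultimately show ?thesis by (simp add: gwf_add_real)
    qed
    have "\<gamma> ^ N * (1 / 2) \<le> \<gamma> ^ N * (1 - (\<Sum>i<N. x i))"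
      using sum[of N] \<gamma>_pos by (intro mult_left_mono) auto
    also have "\<dots> \<le> \<gamma> ^ N * (\<Prod>i<N. 1 - x i)"
      using x0 x1 \<gamma>_pos by (intro mult_left_mono Weierstrass_prod_ineq) auto
    also have "\<dots> = (\<Prod>i<N. \<gamma> * (1 - x i))" by (simp add: prod.distrib)
    also have "\<dots> \<le> (\<Prod>i<N. pgf_deriv p (gwf p i (gwf p a 0)))"
      using x1 \<gamma>_pos factor by (intro prod_mono) auto
    also have "\<dots> = gwf' p N (gwf p a 0)" using fa by (simp add: gwf'_prod)
    finally show "\<gamma> ^ N / 2 \<le> gwf' p N (gwf p a 0)" by simp
  qed
qed

end

section \<open>The law of the process\<close>

lemma measurable_sum_nat:
  fixes i :: nat
  assumes "\<And>u. u < i \<Longrightarrow> f u \<in> measurable N (count_space (UNIV::nat set))"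
  shows "(\<lambda>x. \<Sum>u<i. f u x) \<in> measurable N (count_space UNIV)"
  using assms
proof (induction i)
  case (Suc i)
  have [measurable]: "(\<lambda>x. \<Sum>u<i. f u x) \<in> measurable N (count_space UNIV)" "f i \<in> measurable N (count_space UNIV)"
    using Suc by auto
  show ?case by simp
qed simp

lemma measurable_gw_Z:
  assumes "\<And>n' u. n' < n \<Longrightarrow> X n' u \<in> measurable N (count_space UNIV)"
  shows "gw_Z X n \<in> measurable N (count_space UNIV)"
  using assms
proof (induction n)
  case (Suc n)
  have "(\<lambda>x. \<Sum>u<gw_Z X n x. X n u x) \<in> measurable N (count_space UNIV)"
    by (rule measurable_compose_countable[of "\<lambda>i x. \<Sum>u<i. X n u x"])
       (use Suc in \<open>auto intro!: measurable_sum_nat\<close>)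
  then show ?case by simp
next
  case 0
  have "gw_Z X 0 = (\<lambda>_. 1)" by auto
  then show ?case by simp
qed

lemma gw_Z_cong:
  assumes "\<And>n' u. n' < n \<Longrightarrow> X n' u x = Y n' u y"
  shows "gw_Z X n x = gw_Z Y n y"
  using assms by (induction n) auto

locale gw_process = prob_space M for M :: "'a measure" +
  fixes p :: "nat pmf" and \<xi> :: "nat \<Rightarrow> nat \<Rightarrow> 'a \<Rightarrow> nat"
  assumes gw_family: "gw_offspring_family M p \<xi>"
begin

abbreviation Z :: "nat \<Rightarrow> 'a \<Rightarrow> nat" where "Z n \<equiv> gw_Z \<xi> n"

lemma \<xi>_measurable [measurable]: "\<xi> n i \<in> measurable M (count_space UNIV)"
proof -
  have "indep_vars (\<lambda>_. count_space UNIV) (\<lambda>ni. \<xi> (fst ni) (snd ni)) UNIV"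
    using gw_family by (simp add: gw_offspring_family_def)
  then show ?thesis by (auto simp: indep_vars_def)
qed

lemma Z_measurable [measurable]: "Z n \<in> measurable M (count_space UNIV)"
  by (rule measurable_gw_Z) simp

lemma prob_\<xi>: "prob {\<omega> \<in> space M. \<xi> n i \<omega> = x} = pmf p x"
proof -
  have "prob {\<omega> \<in> space M. \<xi> n i \<omega> = x} = measure (distr M (count_space UNIV) (\<xi> n i)) {x}"
    by (subst measure_distr) (auto intro!: arg_cong[where f=prob])
  then show ?thesis using gw_family by (simp add: gw_offspring_family_def pmf.rep_eq)
qed

text \<open>Individual \<open>i\<close> of generation \<open>n\<close> reproduces independently of
  all earlier generations and of its elder siblings. Recording an earlier generation
  \<open>N\<close> as well leads to the joint law of two generations.\<close>

lemma prob_next_individual: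
  assumes "N \<le> n"
  shows "prob {\<omega> \<in> space M. Z N \<omega> = j \<and> Z n \<omega> = l \<and> (\<Sum>u<i. \<xi> n u \<omega>) = k \<and> \<xi> n i \<omega> = x} =
         prob {\<omega> \<in> space M. Z N \<omega> = j \<and> Z n \<omega> = l \<and> (\<Sum>u<i. \<xi> n u \<omega>) = k} * pmf p x"
proof -
  \<comment> \<open>Indices on which the conditioning event depends; \<open>(n, i)\<close> is not
    among them, so the two blocks are independent.\<close>
  define A where "A = {(n',u). n' < n \<or> n' = n \<and> u < i}"
  define R where "R = (\<lambda>\<omega>. restrict (\<lambda>ni. \<xi> (fst ni) (snd ni) \<omega>) A)"
  define R2 where "R2 = (\<lambda>\<omega>. restrict (\<lambda>ni. \<xi> (fst ni) (snd ni) \<omega>) {(n,i)})"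
  define X where "X = (\<lambda>n u (x::nat \<times> nat \<Rightarrow> nat). x (n,u))"
  define g :: "(nat \<times> nat \<Rightarrow> nat) \<Rightarrow> nat"
    where "g x = (if gw_Z X N x = j \<and> gw_Z X n x = l \<and> (\<Sum>u<i. X n u x) = k then 1 else 0)" for x
  let ?P = "PiM A (\<lambda>_. count_space (UNIV :: nat set))"
  have ind: "indep_var ?P R (PiM {(n,i)} (\<lambda>_. count_space UNIV)) R2"
    unfolding R_def R2_def
    by (rule indep_var_restrict[where I=UNIV])
       (use gw_family in \<open>auto simp: gw_offspring_family_def A_def\<close>)
  have X: "X n' u \<in> measurable ?P (count_space UNIV)" if "(n',u) \<in> A" for n' u
    unfolding X_def using that by (rule measurable_component_singleton)
  have [measurable]: "gw_Z X N \<in> measurable ?P (count_space UNIV)" "gw_Z X n \<in> measurable ?P (count_space UNIV)"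
    by (intro measurable_gw_Z X; use assms in \<open>auto simp: A_def\<close>)+
  have [measurable]: "(\<lambda>x. \<Sum>u<i. X n u x) \<in> measurable ?P (count_space UNIV)"
    by (intro measurable_sum_nat X) (auto simp: A_def)
  have g: "g \<in> measurable ?P (count_space UNIV)" unfolding g_def by measurable
  have "indep_var (count_space UNIV) (g \<circ> R) (count_space UNIV) ((\<lambda>x. x (n,i)) \<circ> R2)"
    by (rule indep_var_compose[OF ind g]) (auto intro: measurable_component_singleton)
  from indep_varD[OF this, of "{1}" "{x}"]
  have eq: "prob ((\<lambda>y. ((g \<circ> R) y, ((\<lambda>x. x (n,i)) \<circ> R2) y)) -` ({1} \<times> {x}) \<inter> space M) =
     prob ((g \<circ> R) -` {1} \<inter> space M) * prob (((\<lambda>x. x (n,i)) \<circ> R2) -` {x} \<inter> space M)" by simp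
  have gR: "g (R \<omega>) = Suc 0 \<longleftrightarrow> Z N \<omega> = j \<and> Z n \<omega> = l \<and> (\<Sum>u<i. \<xi> n u \<omega>) = k" for \<omega>
  proof -
    have "gw_Z X N (R \<omega>) = Z N \<omega>" "gw_Z X n (R \<omega>) = Z n \<omega>"
      by (intro gw_Z_cong; use assms in \<open>auto simp: X_def R_def A_def\<close>)+
    moreover have "(\<Sum>u<i. X n u (R \<omega>)) = (\<Sum>u<i. \<xi> n u \<omega>)"
      by (intro sum.cong) (auto simp: X_def R_def A_def)
    ultimately show ?thesis by (simp add: g_def)
  qed
  have "(\<lambda>y. ((g \<circ> R) y, ((\<lambda>x. x (n,i)) \<circ> R2) y)) -` ({1} \<times> {x}) \<inter> space M =
      {\<omega> \<in> space M. Z N \<omega> = j \<and> Z n \<omega> = l \<and> (\<Sum>u<i. \<xi> n u \<omega>) = k \<and> \<xi> n i \<omega> = x}"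
    by (auto simp: gR R2_def)
  moreover have "(g \<circ> R) -` {1} \<inter> space M = {\<omega> \<in> space M. Z N \<omega> = j \<and> Z n \<omega> = l \<and> (\<Sum>u<i. \<xi> n u \<omega>) = k}"
    by (auto simp: gR)
  moreover have "((\<lambda>x. x (n,i)) \<circ> R2) -` {x} \<inter> space M = {\<omega> \<in> space M. \<xi> n i \<omega> = x}"
    by (auto simp: R2_def)
  ultimately show ?thesis using eq prob_\<xi> by simp
qed

lemma prob_sums:
  fixes f :: "'a \<Rightarrow> nat"
  assumes [measurable]: "Measurable.pred M P" "f \<in> measurable M (count_space UNIV)"
  shows "(\<lambda>i. prob {\<omega> \<in> space M. P \<omega> \<and> f \<omega> = i}) sums prob {\<omega> \<in> space M. P \<omega>}"
proof -
  have "(\<lambda>i. prob {\<omega> \<in> space M. P \<omega> \<and> f \<omega> = i}) sums prob (\<Union>i. {\<omega> \<in> space M. P \<omega> \<and> f \<omega> = i})"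
    by (rule finite_measure_UNION) (auto simp: disjoint_family_on_def)
  also have "(\<Union>i. {\<omega> \<in> space M. P \<omega> \<and> f \<omega> = i}) = {\<omega> \<in> space M. P \<omega>}" by auto
  finally show ?thesis .
qed

lemma pmf_conv: "pmf (conv_pmf q r) k = (\<Sum>x\<le>k. pmf q (k - x) * pmf r x)"
proof -
  have *: "pmf (map_pmf ((+) y) r) k = (if y \<le> k then pmf r (k - y) else 0)" for y
  proof (cases "y \<le> k")
    case True
    then have "k = y + (k - y)" by simp
    then show ?thesis using True pmf_map_inj'[of "(+) y" r "k - y"] by (simp add: inj_on_def)
  next
    case False
    then have "k \<notin> set_pmf (map_pmf ((+) y) r)" by auto
    then show ?thesis using False by (simp add: pmf_eq_0_set_pmf)
  qed
  have "pmf (conv_pmf q r) k = measure_pmf.expectation q (\<lambda>y. if y \<le> k then pmf r (k - y) else 0)"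
    by (simp add: conv_pmf_def pmf_bind *)
  also have "\<dots> = (\<Sum>y\<in>{..k}. (if y \<le> k then pmf r (k - y) else 0) * pmf q y)"
    by (rule integral_measure_pmf_real) (auto split: if_splits)
  also have "\<dots> = (\<Sum>y\<le>k. pmf q y * pmf r (k - y))" by (intro sum.cong) auto
  also have "\<dots> = (\<Sum>x\<le>k. pmf q (k - x) * pmf r x)"
    by (rule sum.reindex_bij_witness[of _ "\<lambda>x. k - x" "\<lambda>x. k - x"]) auto
  finally show ?thesis .
qed

text \<open>Siblings are added one at a time. The number \<open>i\<close> of summands is
  deterministic and unrelated to \<open>Z n\<close>, which is what makes the induction
  possible.\<close>

lemma prob_offspring_sum:
  assumes "N \<le> n"
  shows "prob {\<omega> \<in> space M. Z N \<omega> = j \<and> Z n \<omega> = l \<and> (\<Sum>u<i. \<xi> n u \<omega>) = k} =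
         prob {\<omega> \<in> space M. Z N \<omega> = j \<and> Z n \<omega> = l} * pmf (offspring_sum p i) k"
proof (induction i arbitrary: k)
  case 0
  then show ?case by (cases "k = 0") auto
next
  case (Suc i)
  have [measurable]: "(\<lambda>\<omega>. \<Sum>u<i. \<xi> n u \<omega>) \<in> measurable M (count_space UNIV)"
    by (rule measurable_sum_nat) simp
  have "prob {\<omega> \<in> space M. Z N \<omega> = j \<and> Z n \<omega> = l \<and> (\<Sum>u<Suc i. \<xi> n u \<omega>) = k} =
     prob (\<Union>x\<in>{..k}. {\<omega> \<in> space M. Z N \<omega> = j \<and> Z n \<omega> = l \<and> (\<Sum>u<i. \<xi> n u \<omega>) = k - x \<and> \<xi> n i \<omega> = x})"
    by (rule arg_cong[where f=prob]) auto
  also have "\<dots> = (\<Sum>x\<le>k. prob {\<omega> \<in> space M. Z N \<omega> = j \<and> Z n \<omega> = l \<and> (\<Sum>u<i. \<xi> n u \<omega>) = k - x \<and> \<xi> n i \<omega> = x})"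
    by (rule finite_measure_finite_Union) (auto simp: disjoint_family_on_def)
  also have "\<dots> = (\<Sum>x\<le>k. prob {\<omega> \<in> space M. Z N \<omega> = j \<and> Z n \<omega> = l} * (pmf (offspring_sum p i) (k - x) * pmf p x))"
    by (intro sum.cong refl) (simp only: prob_next_individual[OF assms] Suc.IH mult.assoc)
  also have "\<dots> = prob {\<omega> \<in> space M. Z N \<omega> = j \<and> Z n \<omega> = l} * pmf (offspring_sum p (Suc i)) k"
    by (simp add: pmf_conv sum_distrib_left)
  finally show ?case .
qed

lemma prob_joint_singleton:
  "prob {\<omega> \<in> space M. Z N \<omega> = j \<and> Z (N + a) \<omega> = k} = prob {\<omega> \<in> space M. Z N \<omega> = j} * pmf (gw_law p a j) k"
proof (induction a arbitrary: k)
  case 0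
  have "{\<omega> \<in> space M. Z N \<omega> = j \<and> Z N \<omega> = k} = (if j = k then {\<omega> \<in> space M. Z N \<omega> = j} else {})" by auto
  then show ?case by (simp add: pmf_return)
next
  case (Suc a)
  let ?n = "N + a"
  have "(\<lambda>i. prob {\<omega> \<in> space M. (Z N \<omega> = j \<and> Z (Suc ?n) \<omega> = k) \<and> Z ?n \<omega> = i}) sums
      prob {\<omega> \<in> space M. Z N \<omega> = j \<and> Z (Suc ?n) \<omega> = k}"
    by (rule prob_sums) measurable
  moreover have "prob {\<omega> \<in> space M. (Z N \<omega> = j \<and> Z (Suc ?n) \<omega> = k) \<and> Z ?n \<omega> = i} =
     prob {\<omega> \<in> space M. Z N \<omega> = j} * (pmf (gw_law p a j) i * pmf (offspring_sum p i) k)" for i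
  proof -
    \<comment> \<open>On \<open>Z ?n = i\<close> the random number of summands may be frozen at
      \<open>i\<close>.\<close>
    have "{\<omega> \<in> space M. (Z N \<omega> = j \<and> Z (Suc ?n) \<omega> = k) \<and> Z ?n \<omega> = i} =
          {\<omega> \<in> space M. Z N \<omega> = j \<and> Z ?n \<omega> = i \<and> (\<Sum>u<i. \<xi> ?n u \<omega>) = k}" by auto
    then show ?thesis using prob_offspring_sum[of N ?n j i i k] Suc.IH[of i] by simp
  qed
  ultimately have 1: "(\<lambda>i. prob {\<omega> \<in> space M. Z N \<omega> = j} * (pmf (gw_law p a j) i * pmf (offspring_sum p i) k)) sums
      prob {\<omega> \<in> space M. Z N \<omega> = j \<and> Z (Suc ?n) \<omega> = k}" by simp
  have "(\<lambda>i. pmf (gw_law p a j) i *\<^sub>R pmf (offspring_sum p i) k) sums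
     measure_pmf.expectation (gw_law p a j) (\<lambda>i. pmf (offspring_sum p i) k)"
    by (rule sums_pmf_expectation, rule integrable_pmf_bounded[where C=1]) (auto simp: pmf_le_1)
  then have "(\<lambda>i. prob {\<omega> \<in> space M. Z N \<omega> = j} * (pmf (gw_law p a j) i * pmf (offspring_sum p i) k)) sums
     (prob {\<omega> \<in> space M. Z N \<omega> = j} * pmf (gw_law p (Suc a) j) k)"
    by (intro sums_mult) (simp add: pmf_bind)
  with 1 show ?case using sums_unique2 by auto
qed

lemma prob_joint:
  "prob {\<omega> \<in> space M. Z N \<omega> = j \<and> Z (N + a) \<omega> \<in> A} = prob {\<omega> \<in> space M. Z N \<omega> = j} * measure (gw_law p a j) A"
proof -
  have "(\<lambda>k. prob {\<omega> \<in> space M. (Z N \<omega> = j \<and> Z (N + a) \<omega> \<in> A) \<and> Z (N + a) \<omega> = k}) sums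
      prob {\<omega> \<in> space M. Z N \<omega> = j \<and> Z (N + a) \<omega> \<in> A}"
    by (rule prob_sums) measurable
  moreover have "prob {\<omega> \<in> space M. (Z N \<omega> = j \<and> Z (N + a) \<omega> \<in> A) \<and> Z (N + a) \<omega> = k} =
     prob {\<omega> \<in> space M. Z N \<omega> = j} * (pmf (gw_law p a j) k *\<^sub>R (indicator A k :: real))" for k
  proof -
    have "{\<omega> \<in> space M. (Z N \<omega> = j \<and> Z (N + a) \<omega> \<in> A) \<and> Z (N + a) \<omega> = k} =
      (if k \<in> A then {\<omega> \<in> space M. Z N \<omega> = j \<and> Z (N + a) \<omega> = k} else {})" by auto
    then show ?thesis by (simp add: prob_joint_singleton)
  qed
  moreover have "(\<lambda>k. pmf (gw_law p a j) k *\<^sub>R (indicator A k :: real)) sums measure_pmf.expectation (gw_law p a j) (indicator A)"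
    by (rule sums_pmf_expectation, rule integrable_pmf_bounded[where C=1]) (auto simp: indicator_def)
  then have "(\<lambda>k. prob {\<omega> \<in> space M. Z N \<omega> = j} * (pmf (gw_law p a j) k *\<^sub>R (indicator A k :: real))) sums
    (prob {\<omega> \<in> space M. Z N \<omega> = j} * measure (gw_law p a j) A)"
    by (intro sums_mult) simp
  ultimately show ?thesis using sums_unique2 by fastforce
qed

lemma prob_Z_in: "prob {\<omega> \<in> space M. Z n \<omega> \<in> A} = measure (gw_law p n 1) A"
  using prob_joint[of 0 1 n A] by (simp add: prob_space)

lemma prob_Z_eq: "prob {\<omega> \<in> space M. Z n \<omega> = k} = pmf (gw_law p n 1) k"
  using prob_Z_in[of n "{k}"] by (simp add: pmf.rep_eq)

lemma expectation_Z: 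
  fixes f :: "nat \<Rightarrow> 'b::{banach,second_countable_topology}"
  shows "expectation (\<lambda>\<omega>. f (Z n \<omega>)) = measure_pmf.expectation (gw_law p n 1) f"
proof -
  have "distr M (count_space UNIV) (Z n) = measure_pmf (gw_law p n 1)"
  proof (rule measure_eqI)
    fix A assume "A \<in> sets (distr M (count_space UNIV) (Z n))"
    have "emeasure (distr M (count_space UNIV) (Z n)) A = ennreal (prob {\<omega> \<in> space M. Z n \<omega> \<in> A})"
      by (subst emeasure_distr) (auto simp: emeasure_eq_measure intro!: arg_cong[where f=prob])
    then show "emeasure (distr M (count_space UNIV) (Z n)) A = emeasure (measure_pmf (gw_law p n 1)) A"
      unfolding prob_Z_in by (simp add: measure_pmf.emeasure_eq_measure)
  qed simp
  moreover have "expectation (\<lambda>\<omega>. f (Z n \<omega>)) = integral\<^sup>L (distr M (count_space UNIV) (Z n)) f"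
    by (rule integral_distr[symmetric]) auto
  ultimately show ?thesis by simp
qed

end

section \<open>The normalised limit\<close>

text \<open>Equality case of the triangle inequality for integrals: after rotation by the conjugate
  mean, one minus the real part is nonnegative with expectation 0, and a point of the closed disc
  with real part 1 is 1. It serves both \<open>exp (z * W)\<close> and \<open>z ^ k\<close> under
  the offspring law.\<close>

lemma (in prob_space) AE_eq_expectation_if_norm_eq_1:
  fixes X :: "'a \<Rightarrow> complex"
  assumes [measurable]: "X \<in> borel_measurable M" and bd: "AE \<omega> in M. norm (X \<omega>) \<le> 1"
    and 1: "norm (expectation X) = 1"
  shows "AE \<omega> in M. X \<omega> = expectation X"
proof -
  let ?u = "expectation X"
  have int: "integrable M X" using bd by (rule integrable_const_bound) simp
  have uu: "cnj ?u * ?u = 1" using complex_norm_square[of ?u] 1 by (simp add: mult.commute)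
  have "expectation (\<lambda>\<omega>. Re (cnj ?u * X \<omega>)) = Re (expectation (\<lambda>\<omega>. cnj ?u * X \<omega>))"
    using int by (intro integral_Re integrable_mult_right)
  also have "\<dots> = Re (cnj ?u * ?u)" by (subst integral_mult_right_zero) (rule refl)
  finally have E: "expectation (\<lambda>\<omega>. 1 - Re (cnj ?u * X \<omega>)) = 0"
    unfolding uu using int by (subst Bochner_Integration.integral_diff) (auto simp: prob_space)
  have le: "Re (cnj ?u * X \<omega>) \<le> 1" if "norm (X \<omega>) \<le> 1" for \<omega>
    using complex_Re_le_cmod[of "cnj ?u * X \<omega>"] that 1 by (simp add: norm_mult)
  have "AE \<omega> in M. 1 - Re (cnj ?u * X \<omega>) = 0"
  proof (subst integral_nonneg_eq_0_iff_AE[symmetric])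
    show "integrable M (\<lambda>\<omega>. 1 - Re (cnj ?u * X \<omega>))" using int by auto
    show "AE \<omega> in M. 0 \<le> 1 - Re (cnj ?u * X \<omega>)" using bd by eventually_elim (use le in auto)
  qed (rule E)
  with bd show ?thesis
  proof eventually_elim
    fix \<omega> assume *: "norm (X \<omega>) \<le> 1" "1 - Re (cnj ?u * X \<omega>) = 0"
    let ?y = "cnj ?u * X \<omega>"
    have "norm ?y \<le> 1" using * 1 by (simp add: norm_mult)
    then have "(Re ?y)\<^sup>2 + (Im ?y)\<^sup>2 \<le> 1" by (metis cmod_power2 norm_ge_zero one_power2 power_mono)
    then have "?y = 1" using * by (auto simp: complex_eq_iff)
    have "X \<omega> = (cnj ?u * ?u) * X \<omega>" unfolding uu by simp
    also have "\<dots> = ?u * ?y" by (simp only: mult_ac)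
    also have "\<dots> = ?u" unfolding \<open>?y = 1\<close> by simp
    finally show "X \<omega> = ?u" .
  qed
qed

text \<open>On the left half-plane, which is convex, the derivative of the exponential has modulus
  at most 1.\<close>

lemma norm_exp_diff_le:
  fixes u v :: complex
  assumes "Re u \<le> 0" "Re v \<le> 0"
  shows "norm (exp u - exp v) \<le> norm (u - v)"
proof -
  have "norm (exp u - exp v) \<le> 1 * norm (u - v)"
  proof (rule field_differentiable_bound[where S="{z. Re z \<le> 0}" and f'=exp])
    show "convex {z. Re z \<le> 0}" by (rule convex_halfspace_Re_le)
    show "(exp has_field_derivative exp z) (at z within {z. Re z \<le> 0})" for z
      by (rule DERIV_exp[THEN DERIV_subset]) auto
  qed (use assms in auto)
  then show ?thesis by simp
qed

lemma filterlim_power_at_top: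
  assumes "(1::real) < x"
  shows "filterlim (\<lambda>n. x ^ n) at_top sequentially"
  using assms by (intro filterlim_at_infinity_imp_filterlim_at_top filterlim_realpow_sequentially_gt1) auto

locale gw_limit = schroeder_offspring p m + gw_process M p \<xi>
  for M :: "'a measure" and p :: "nat pmf" and m :: real and \<xi> :: "nat \<Rightarrow> nat \<Rightarrow> 'a \<Rightarrow> nat" +
  fixes c :: "nat \<Rightarrow> real" and W :: "'a \<Rightarrow> real" and w :: "real \<Rightarrow> real"
  assumes norming: "admissible_norming p c"
    and W_measurable [measurable]: "W \<in> borel_measurable M"
    and W_lim: "AE \<omega> in M. (\<lambda>n. real (gw_Z \<xi> n \<omega>) / c n) \<longlonglongrightarrow> W \<omega>"
    and w_cont: "continuous_on {0<..} w"
    and w_pos: "\<And>x. x > 0 \<Longrightarrow> w x > 0"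
    and w_density: "\<And>A. A \<in> sets borel \<Longrightarrow> A \<subseteq> {0<..} \<Longrightarrow>
                      emeasure M {\<omega> \<in> space M. W \<omega> \<in> A} = (\<integral>\<^sup>+ x \<in> A. ennreal (w x) \<partial>lborel)"
begin

section \<open>Norming constants and elementary properties of the limit\<close>

lemma c_pos [simp]: "0 < c n" and c_0 [simp]: "c 0 = 1" and c_less_Suc: "c n < c (Suc n)"
  and c_Suc_le: "c (Suc n) \<le> m * c n"
  using norming unfolding admissible_norming_def m_eq by auto

lemma c_nonzero [simp]: "c n \<noteq> 0" by (metis c_pos less_irrefl)

lemma c_mono: "n \<le> n' \<Longrightarrow> c n \<le> c n'"
  by (rule lift_Suc_mono_le[of c]) (use c_less_Suc in \<open>auto intro: less_imp_le\<close>)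

lemma c_ge_1: "1 \<le> c n"
  using c_mono[of 0 n] by simp

lemma c_add_le: "c (n + l) \<le> m ^ l * c n"
proof (induction l)
  case (Suc l)
  have "c (n + Suc l) \<le> m * c (n + l)" using c_Suc_le[of "n + l"] by simp
  also have "\<dots> \<le> m * (m ^ l * c n)" using Suc m_pos by (intro mult_left_mono) auto
  finally show ?case by (simp add: mult_ac)
qed simp

text \<open>Slow variation is used along \<open>m ^ n\<close> with dilation factor
  \<open>m\<close>.\<close>

lemma c_ratio_Suc: "(\<lambda>n. c (Suc n) / c n) \<longlonglongrightarrow> m"
proof -
  obtain L where L: "slowly_varying L" "\<And>n. c n = m ^ n * L (m ^ n)"
    using norming unfolding admissible_norming_def m_eq by auto
  have "filterlim (\<lambda>n. m ^ n) at_top sequentially"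
    using m_gt_1 by (rule filterlim_power_at_top)
  moreover have "((\<lambda>x. L (m * x) / L x) \<longlongrightarrow> 1) at_top"
    using L(1) m_pos unfolding slowly_varying_def by auto
  ultimately have "(\<lambda>n. L (m * m ^ n) / L (m ^ n)) \<longlonglongrightarrow> 1"
    by (rule filterlim_compose[rotated])
  then have "(\<lambda>n. m * (L (m * m ^ n) / L (m ^ n))) \<longlonglongrightarrow> m * 1"
    by (intro tendsto_intros)
  moreover have "c (Suc n) / c n = m * (L (m * m ^ n) / L (m ^ n))" for n
    using m_pos by (simp add: L(2))
  ultimately show ?thesis by simp
qed

lemma c_ratio: "(\<lambda>n. c (N + n) / c n) \<longlonglongrightarrow> m ^ N"
proof (induction N)
  case (Suc N)
  have "(\<lambda>n. c (Suc (n + N)) / c (n + N)) \<longlonglongrightarrow> m"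
    using c_ratio_Suc by (rule LIMSEQ_ignore_initial_segment)
  then have "(\<lambda>n. c (Suc (n + N)) / c (n + N) * (c (N + n) / c n)) \<longlonglongrightarrow> m * m ^ N"
    using Suc by (intro tendsto_intros)
  then show ?case by (simp add: add.commute)
qed simp

text \<open>A rate strictly between 1 and \<open>m\<close> is eventually exceeded by the ratios. The
  finitely many exceptional indices cost the factor \<open>g ^ n0\<close>, which keeps the bound
  uniform in the starting index \<open>b\<close>.\<close>

lemma c_growth:
  obtains g K where "1 < g" "0 < K" "\<And>b l. g ^ l * c b \<le> K * c (b + l)"
proof -
  define g where "g = (1 + m) / 2"
  have g: "1 < g" "g < m" using m_gt_1 by (auto simp: g_def)
  have "\<forall>\<^sub>F n in sequentially. g < c (Suc n) / c n"
    using c_ratio_Suc g(2) by (rule order_tendstoD)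
  then obtain n0 where n0: "\<And>n. n \<ge> n0 \<Longrightarrow> g < c (Suc n) / c n"
    by (auto simp: eventually_sequentially)
  have "g ^ l * c b \<le> g ^ n0 * c (b + l)" for b l
  proof (induction l)
    case 0
    then show ?case using g c_pos[of b] by simp
  next
    case (Suc l)
    show ?case
    proof (cases "b + l \<ge> n0")
      case True
      have "g ^ Suc l * c b \<le> g * (g ^ n0 * c (b + l))" using Suc g by (simp add: mult_ac)
      also have "\<dots> = g ^ n0 * (g * c (b + l))" by simp
      also have "\<dots> \<le> g ^ n0 * c (Suc (b + l))"
        using n0[OF True] g by (intro mult_left_mono) (auto simp: field_simps)
      finally show ?thesis by simp
    next
      case False
      then have "g ^ Suc l * c b \<le> g ^ n0 * c (b + Suc l)"
        using g by (intro mult_mono power_increasing c_mono) (auto intro: less_imp_le)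
      then show ?thesis .
    qed
  qed
  with g show thesis by (intro that[of g "g ^ n0"]) auto
qed

lemma c_at_top: "filterlim c at_top sequentially"
proof -
  obtain g K where g: "1 < g" "0 < K" "\<And>b l. g ^ l * c b \<le> K * c (b + l)" by (rule c_growth) blast
  have "filterlim (\<lambda>n. inverse K * g ^ n) at_top sequentially"
    using g by (intro filterlim_tendsto_pos_mult_at_top[OF tendsto_const] filterlim_power_at_top) auto
  moreover have "inverse K * g ^ n \<le> c n" for n using g(3)[of n 0] g(2) by (simp add: field_simps)
  ultimately show ?thesis by (auto intro: filterlim_at_top_mono)
qed

lemma W_nonneg: "AE \<omega> in M. 0 \<le> W \<omega>"
  using W_lim by eventually_elim (rule LIMSEQ_le_const, auto intro!: exI divide_nonneg_pos)

lemma W_lim_shift: "AE \<omega> in M. (\<lambda>a. real (Z (N + a) \<omega>) / c a) \<longlonglongrightarrow> m ^ N * W \<omega>"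
  using W_lim
proof eventually_elim
  fix \<omega> assume "(\<lambda>n. real (gw_Z \<xi> n \<omega>) / c n) \<longlonglongrightarrow> W \<omega>"
  then have "(\<lambda>a. real (Z (a + N) \<omega>) / c (a + N)) \<longlonglongrightarrow> W \<omega>" by (rule LIMSEQ_ignore_initial_segment)
  then have "(\<lambda>a. c (N + a) / c a * (real (Z (a + N) \<omega>) / c (a + N))) \<longlonglongrightarrow> m ^ N * W \<omega>"
    by (intro tendsto_mult c_ratio)
  then show "(\<lambda>a. real (Z (N + a) \<omega>) / c a) \<longlonglongrightarrow> m ^ N * W \<omega>" by (simp add: add.commute)
qed

lemma prob_W:
  assumes "0 < x" "x \<le> y"
  shows "\<And>C. (\<And>t. x \<le> t \<Longrightarrow> t \<le> y \<Longrightarrow> w t \<le> C) \<Longrightarrow> prob {\<omega> \<in> space M. x \<le> W \<omega> \<and> W \<omega> \<le> y} \<le> C * (y - x)"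
    and "\<And>C. (\<And>t. x \<le> t \<Longrightarrow> t \<le> y \<Longrightarrow> C \<le> w t) \<Longrightarrow> 0 \<le> C \<Longrightarrow> C * (y - x) \<le> prob {\<omega> \<in> space M. x < W \<omega> \<and> W \<omega> \<le> y}"
proof -
  fix C assume C: "\<And>t. x \<le> t \<Longrightarrow> t \<le> y \<Longrightarrow> w t \<le> C"
  have C0: "0 \<le> C" using C[of x] w_pos[of x] assms by auto
  have "emeasure M {\<omega> \<in> space M. W \<omega> \<in> {x..y}} = (\<integral>\<^sup>+ t \<in> {x..y}. ennreal (w t) \<partial>lborel)"
    using assms by (intro w_density) auto
  also have "\<dots> \<le> (\<integral>\<^sup>+ t \<in> {x..y}. ennreal C \<partial>lborel)"
    using C by (intro nn_integral_mono) (auto simp: indicator_def intro!: ennreal_leI)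
  also have "\<dots> = ennreal (C * (y - x))" using assms C0 by (simp add: nn_integral_cmult_indicator ennreal_mult)
  finally have "ennreal (prob {\<omega> \<in> space M. W \<omega> \<in> {x..y}}) \<le> ennreal (C * (y - x))"
    by (simp add: emeasure_eq_measure)
  then show "prob {\<omega> \<in> space M. x \<le> W \<omega> \<and> W \<omega> \<le> y} \<le> C * (y - x)"
    using C0 assms by (simp add: ennreal_le_iff)
next
  fix C assume C: "\<And>t. x \<le> t \<Longrightarrow> t \<le> y \<Longrightarrow> C \<le> w t" "0 \<le> C"
  have "ennreal (C * (y - x)) = (\<integral>\<^sup>+ t \<in> {x<..y}. ennreal C \<partial>lborel)"
    using assms C by (simp add: nn_integral_cmult_indicator ennreal_mult)
  also have "\<dots> \<le> (\<integral>\<^sup>+ t \<in> {x<..y}. ennreal (w t) \<partial>lborel)"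
    using C by (intro nn_integral_mono) (auto simp: indicator_def intro!: ennreal_leI)
  also have "\<dots> = emeasure M {\<omega> \<in> space M. W \<omega> \<in> {x<..y}}"
    using assms by (intro w_density[symmetric]) auto
  finally have "ennreal (C * (y - x)) \<le> ennreal (prob {\<omega> \<in> space M. W \<omega> \<in> {x<..y}})"
    by (simp add: emeasure_eq_measure)
  then show "C * (y - x) \<le> prob {\<omega> \<in> space M. x < W \<omega> \<and> W \<omega> \<le> y}"
    by (simp add: ennreal_le_iff)
qed

lemma w_bounds:
  assumes "0 < x" "x \<le> y"
  obtains C1 C2 where "0 < C1" "0 < C2" "\<And>t. x \<le> t \<Longrightarrow> t \<le> y \<Longrightarrow> C1 \<le> w t \<and> w t \<le> C2"
proof -
  have co: "continuous_on {x..y} w" using w_cont by (rule continuous_on_subset) (use assms in auto)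
  obtain t1 where t1: "t1 \<in> {x..y}" "\<And>t. t \<in> {x..y} \<Longrightarrow> w t1 \<le> w t"
    using continuous_attains_inf[OF _ _ co] assms by auto
  obtain t2 where t2: "t2 \<in> {x..y}" "\<And>t. t \<in> {x..y} \<Longrightarrow> w t \<le> w t2"
    using continuous_attains_sup[OF _ _ co] assms by auto
  show thesis
    by (rule that[of "w t1" "w t2"]) (use t1 t2 assms w_pos in auto)
qed

lemma prob_W_interval_pos:
  assumes "0 < x" "x < y"
  shows "0 < prob {\<omega> \<in> space M. x < W \<omega> \<and> W \<omega> \<le> y}"
proof -
  obtain C1 C2 where "0 < C1" "\<And>t. x \<le> t \<Longrightarrow> t \<le> y \<Longrightarrow> C1 \<le> w t \<and> w t \<le> C2"
    by (rule w_bounds[OF assms(1) less_imp_le[OF assms(2)]]) blast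
  then have "C1 * (y - x) \<le> prob {\<omega> \<in> space M. x < W \<omega> \<and> W \<omega> \<le> y}"
    using assms by (intro prob_W) auto
  moreover have "0 < C1 * (y - x)" using \<open>0 < C1\<close> assms by simp
  ultimately show ?thesis by linarith
qed

lemma prob_W_atom:
  assumes "0 < x"
  shows "prob {\<omega> \<in> space M. W \<omega> = x} = 0"
proof -
  have "prob {\<omega> \<in> space M. x \<le> W \<omega> \<and> W \<omega> \<le> x} \<le> w x * (x - x)"
    using assms by (intro prob_W) (auto simp: order_antisym_conv)
  moreover have "{\<omega> \<in> space M. x \<le> W \<omega> \<and> W \<omega> \<le> x} = {\<omega> \<in> space M. W \<omega> = x}" by auto
  ultimately show ?thesis by (simp add: measure_le_0_iff)
qed

section \<open>Laplace transform of the limit on the closed left half-plane\<close>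

definition laplace_W :: "complex \<Rightarrow> complex" where
  "laplace_W z = expectation (\<lambda>\<omega>. exp (z * of_real (W \<omega>)))"

lemma norm_exp_le_1: "Re z \<le> 0 \<Longrightarrow> 0 \<le> x \<Longrightarrow> norm (exp (z * of_real x)) \<le> 1"
  by (simp add: mult_nonpos_nonneg)

lemma gwf_exp: "gwf p n (exp (z / of_real s)) = expectation (\<lambda>\<omega>. exp (z * of_real (real (Z n \<omega>) / s)))"
  for z :: complex
proof -
  have "gwf p n (exp (z / of_real s)) = expectation (\<lambda>\<omega>. exp (z / of_real s) ^ Z n \<omega>)"
    by (simp add: gwf_def pgf_def expectation_Z[where f="\<lambda>k. exp (z / of_real s) ^ k"])
  then show ?thesis by (simp add: exp_of_nat_mult[symmetric] mult.commute)
qed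

text \<open>Almost sure convergence couples \<open>Z b / c b\<close> with \<open>W\<close> on one
  space. The difference of transforms is thus at most the expectation of \<open>D b\<close>, which
  sees \<open>z\<close> only through \<open>R\<close>.\<close>

lemma laplace_tendsto_uniform:
  assumes "0 < \<epsilon>" 
  obtains b0 where "\<And>b z. b \<ge> b0 \<Longrightarrow> Re z \<le> 0 \<Longrightarrow> norm z \<le> R \<Longrightarrow>
    norm (gwf p b (exp (z / of_real (c b))) - laplace_W z) \<le> \<epsilon>"
proof -
  define D where "D b \<omega> = min 2 (\<bar>R\<bar> * \<bar>real (Z b \<omega>) / c b - W \<omega>\<bar>)" for b \<omega>
  have [measurable]: "D b \<in> borel_measurable M" for b unfolding D_def by measurable
  have intD: "integrable M (D b)" for b
    by (rule integrable_const_bound[where B=2]) (auto simp: D_def)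
  have "(\<lambda>b. expectation (D b)) \<longlonglongrightarrow> expectation (\<lambda>_. 0)"
  proof (rule integral_dominated_convergence[where w="\<lambda>_. 2"])
    show "AE \<omega> in M. (\<lambda>b. D b \<omega>) \<longlonglongrightarrow> 0"
      using W_lim
    proof eventually_elim
      fix \<omega> assume "(\<lambda>n. real (gw_Z \<xi> n \<omega>) / c n) \<longlonglongrightarrow> W \<omega>"
      then have "(\<lambda>b. min 2 (\<bar>R\<bar> * \<bar>real (Z b \<omega>) / c b - W \<omega>\<bar>)) \<longlonglongrightarrow> min 2 (\<bar>R\<bar> * \<bar>W \<omega> - W \<omega>\<bar>)"
        by (intro tendsto_intros)
      then show "(\<lambda>b. D b \<omega>) \<longlonglongrightarrow> 0" by (simp add: D_def)
    qed
  qed (auto simp: D_def)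
  then have "\<forall>\<^sub>F b in sequentially. expectation (D b) < \<epsilon>"
    using assms by (intro order_tendstoD) auto
  then obtain b0 where b0: "\<And>b. b \<ge> b0 \<Longrightarrow> expectation (D b) < \<epsilon>" by (auto simp: eventually_sequentially)
  show thesis
  proof (rule that[of b0])
    fix b and z :: complex assume b: "b \<ge> b0" and z: "Re z \<le> 0" "norm z \<le> R"
    let ?X = "\<lambda>\<omega>. exp (z * of_real (real (Z b \<omega>) / c b))" and ?Y = "\<lambda>\<omega>. exp (z * of_real (W \<omega>))"
    have iX: "integrable M ?X" using z by (intro integrable_const_bound[where B=1] AE_I2 norm_exp_le_1)
      (auto simp: divide_nonneg_pos)
    have iY: "integrable M ?Y"
      by (rule integrable_const_bound[where B=1]) (use W_nonneg in eventually_elim, use z norm_exp_le_1 in auto)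
    have "norm (gwf p b (exp (z / of_real (c b))) - laplace_W z) = norm (expectation (\<lambda>\<omega>. ?X \<omega> - ?Y \<omega>))"
      unfolding gwf_exp laplace_W_def Bochner_Integration.integral_diff[OF iX iY] ..
    also have "\<dots> \<le> expectation (\<lambda>\<omega>. norm (?X \<omega> - ?Y \<omega>))" by simp
    also have "\<dots> \<le> expectation (D b)"
    proof (rule integral_mono_AE)
      show "AE \<omega> in M. norm (?X \<omega> - ?Y \<omega>) \<le> D b \<omega>"
        using W_nonneg
      proof eventually_elim
        fix \<omega> assume W0: "0 \<le> W \<omega>"
        have "norm (?X \<omega>) \<le> 1" "norm (?Y \<omega>) \<le> 1"
          by (intro norm_exp_le_1; use z W0 in \<open>auto simp: divide_nonneg_pos\<close>)+
        then have 1: "norm (?X \<omega> - ?Y \<omega>) \<le> 2" using norm_triangle_ineq4[of "?X \<omega>" "?Y \<omega>"] by linarith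
        have "norm (?X \<omega> - ?Y \<omega>) \<le> norm (z * of_real (real (Z b \<omega>) / c b) - z * of_real (W \<omega>))"
          using z W0 by (intro norm_exp_diff_le) (auto simp: mult_nonpos_nonneg divide_nonpos_pos)
        also have "\<dots> = norm z * \<bar>real (Z b \<omega>) / c b - W \<omega>\<bar>"
          unfolding right_diff_distrib[symmetric] of_real_diff[symmetric] norm_mult norm_of_real ..
        also have "\<dots> \<le> \<bar>R\<bar> * \<bar>real (Z b \<omega>) / c b - W \<omega>\<bar>" using z by (intro mult_right_mono) auto
        finally show "norm (?X \<omega> - ?Y \<omega>) \<le> D b \<omega>" using 1 by (simp add: D_def)
      qed
    qed (use iX iY intD in auto)
    finally show "norm (gwf p b (exp (z / of_real (c b))) - laplace_W z) \<le> \<epsilon>" using b0[OF b] by linarith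
  qed
qed

lemma laplace_tendsto:
  assumes "Re z \<le> 0"
  shows "(\<lambda>b. gwf p b (exp (z / of_real (c b)))) \<longlonglongrightarrow> laplace_W z"
proof (rule LIMSEQ_I)
  fix \<epsilon> :: real assume "0 < \<epsilon>"
  then have "0 < \<epsilon> / 2" by simp
  then obtain b0 where b0: "\<And>b u. b \<ge> b0 \<Longrightarrow> Re u \<le> 0 \<Longrightarrow> norm u \<le> norm z \<Longrightarrow>
    norm (gwf p b (exp (u / of_real (c b))) - laplace_W u) \<le> \<epsilon> / 2"
    by (rule laplace_tendsto_uniform) blast
  show "\<exists>no. \<forall>n\<ge>no. norm (gwf p n (exp (z / of_real (c n))) - laplace_W z) < \<epsilon>"
    using b0[of _ z] assms \<open>0 < \<epsilon>\<close> by (intro exI[of _ b0]) fastforce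
qed

lemma continuous_on_laplace_W: "continuous_on {z. Re z \<le> 0} laplace_W"
  unfolding continuous_on_def
proof (intro ballI, unfold tendsto_at_iff_sequentially, intro allI impI)
  fix z X assume z: "z \<in> {z. Re z \<le> 0}" and X: "\<forall>i. X i \<in> {z. Re z \<le> 0} - {z}" "X \<longlonglongrightarrow> z"
  show "(laplace_W \<circ> X) \<longlonglongrightarrow> laplace_W z"
    unfolding laplace_W_def o_def
  proof (rule integral_dominated_convergence[where w="\<lambda>_. 1"])
    show "AE \<omega> in M. (\<lambda>i. exp (X i * of_real (W \<omega>))) \<longlonglongrightarrow> exp (z * of_real (W \<omega>))"
      using X by (intro AE_I2 tendsto_intros) auto
    show "AE \<omega> in M. norm (exp (X i * of_real (W \<omega>))) \<le> 1" for i
      using W_nonneg by eventually_elim (use X norm_exp_le_1 in auto)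
  qed auto
qed

text \<open>If the modulus were 1, \<open>exp (z * W)\<close> would be almost surely constant.
  Positivity of \<open>w\<close> makes \<open>W\<close> visit every interval of the half-line, in
  particular at two values whose difference is incompatible with that.\<close>

lemma norm_laplace_W_lt_1:
  assumes "Re z \<le> 0" "z \<noteq> 0"
  shows "norm (laplace_W z) < 1"
proof (rule ccontr)
  assume ge: "\<not> ?thesis"
  have bd: "AE \<omega> in M. norm (exp (z * of_real (W \<omega>))) \<le> 1"
    using W_nonneg by eventually_elim (use assms norm_exp_le_1 in auto)
  then have int: "integrable M (\<lambda>\<omega>. exp (z * of_real (W \<omega>)))" by (rule integrable_const_bound) simp
  have "norm (laplace_W z) \<le> expectation (\<lambda>\<omega>. norm (exp (z * of_real (W \<omega>))))"
    unfolding laplace_W_def by (rule integral_norm_bound)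
  also have "\<dots> \<le> expectation (\<lambda>_. 1)" by (rule integral_mono_AE) (use bd in \<open>auto intro!: integrable_norm int simp del: norm_exp_eq_Re\<close>)
  finally have "norm (laplace_W z) \<le> 1" by (simp add: prob_space)
  with ge have "norm (expectation (\<lambda>\<omega>. exp (z * of_real (W \<omega>)))) = 1" by (simp add: laplace_W_def)
  then have AE: "AE \<omega> in M. exp (z * of_real (W \<omega>)) = laplace_W z"
    unfolding laplace_W_def using bd by (intro AE_eq_expectation_if_norm_eq_1) auto
  \<comment> \<open>Frequency scale for choosing the two values. The default 1 is for real
    \<open>z\<close>, where any nonzero difference suffices.\<close>
  define \<tau> where "\<tau> = (if Im z = 0 then 1 else \<bar>Im z\<bar>)"
  have \<tau>: "0 < \<tau>" by (simp add: \<tau>_def)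
  have ex: "\<exists>\<omega>. x < W \<omega> \<and> W \<omega> \<le> y \<and> exp (z * of_real (W \<omega>)) = laplace_W z" if "0 < x" "x < y" for x y
  proof (rule ccontr)
    assume *: "\<not> ?thesis"
    have "AE \<omega> in M. \<omega> \<notin> {\<omega> \<in> space M. x < W \<omega> \<and> W \<omega> \<le> y}"
      using AE by eventually_elim (use * in auto)
    then have "emeasure M {\<omega> \<in> space M. x < W \<omega> \<and> W \<omega> \<le> y} = 0"
      by (subst AE_iff_measurable[symmetric, where P="\<lambda>\<omega>. \<omega> \<notin> {\<omega> \<in> space M. x < W \<omega> \<and> W \<omega> \<le> y}"]) auto
    then show False using prob_W_interval_pos[OF that] by (simp add: emeasure_eq_measure)
  qed
  \<comment> \<open>The two intervals are \<open>1 / (2 * \<tau>)\<close> apart and together span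
    less than \<open>2 / \<tau>\<close>, so the phase difference is nonzero and below
    \<open>2 * pi\<close>.\<close>
  obtain \<omega>1 where 1: "1 / \<tau> < W \<omega>1" "W \<omega>1 \<le> 3 / 2 / \<tau>" "exp (z * of_real (W \<omega>1)) = laplace_W z"
    using ex[of "1 / \<tau>" "3 / 2 / \<tau>"] \<tau> by (auto simp: field_simps)
  obtain \<omega>2 where 2: "2 / \<tau> < W \<omega>2" "W \<omega>2 \<le> 5 / 2 / \<tau>" "exp (z * of_real (W \<omega>2)) = laplace_W z"
    using ex[of "2 / \<tau>" "5 / 2 / \<tau>"] \<tau> by (auto simp: field_simps)
  define x where "x = W \<omega>2 - W \<omega>1"
  have x: "1/2 < \<tau> * x" "\<tau> * x < 2" using 1 2 \<tau> by (auto simp: x_def field_simps)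
  have "exp (z * of_real x) = 1"
    using 1(3) 2(3) exp_not_eq_zero[of "z * of_real (W \<omega>1)"] by (simp add: x_def right_diff_distrib exp_diff)
  then obtain n where n: "Re (z * of_real x) = 0" "Im (z * of_real x) = of_int (2 * n) * pi"
    unfolding exp_eq_1 by auto
  have "x \<noteq> 0" using x \<tau> by auto
  then have "Re z = 0" using n by simp
  then have "Im z \<noteq> 0" using assms(2) by (auto simp: complex_eq_iff)
  then have "\<bar>2 * real_of_int n * pi\<bar> = \<tau> * x" using n(2) x \<tau> 
    by (simp add: \<tau>_def)
  then have "\<bar>real_of_int n\<bar> * (2 * pi) = \<tau> * x" by (simp add: abs_mult mult_ac)
  moreover have "\<bar>real_of_int n\<bar> * (2 * pi) \<ge> 1 * (2 * pi)" if "n \<noteq> 0"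
    using that by (intro mult_right_mono) auto
  ultimately show False using x pi_gt3 by (cases "n = 0") auto
qed

lemma laplace_W_neg_real: "laplace_W (of_real (- t)) = of_real (expectation (\<lambda>\<omega>. exp (- t * W \<omega>)))"
proof -
  have "(\<lambda>\<omega>. exp (of_real (- t) * of_real (W \<omega>))) = (\<lambda>\<omega>. complex_of_real (exp (- t * W \<omega>)))"
    by (auto simp flip: of_real_mult exp_of_real)
  then show ?thesis unfolding laplace_W_def by (simp del: of_real_exp)
qed

lemma laplace_real_tendsto:
  assumes "0 \<le> t"
  shows "(\<lambda>b. gwf p b (exp (- t / c b))) \<longlonglongrightarrow> expectation (\<lambda>\<omega>. exp (- t * W \<omega>))"
proof -
  have "gwf p b (exp (of_real (- t) / of_real (c b))) = complex_of_real (gwf p b (exp (- t / c b)))" for b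
    unfolding gwf_of_real[symmetric] by (simp flip: exp_of_real)
  then have "(\<lambda>b. complex_of_real (gwf p b (exp (- t / c b)))) \<longlonglongrightarrow> of_real (expectation (\<lambda>\<omega>. exp (- t * W \<omega>)))"
    using laplace_tendsto[of "of_real (- t)"] assms laplace_W_neg_real[of t] by simp
  then show ?thesis by (simp only: tendsto_of_real_iff)
qed

section \<open>Extinction and the atom of the limit at zero\<close>

lemma prob_W_0_lt_1: "prob {\<omega> \<in> space M. W \<omega> = 0} < 1"
proof -
  have "prob {\<omega> \<in> space M. W \<omega> = 0} + prob {\<omega> \<in> space M. 1 < W \<omega> \<and> W \<omega> \<le> 2} =
      prob ({\<omega> \<in> space M. W \<omega> = 0} \<union> {\<omega> \<in> space M. 1 < W \<omega> \<and> W \<omega> \<le> 2})"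
    by (rule finite_measure_Union[symmetric]) auto
  also have "\<dots> \<le> 1" by (rule prob_le_1)
  finally show ?thesis using prob_W_interval_pos[of 1 2] by simp
qed

text \<open>Poincare's functional equation. The sequence
  \<open>gwf p (1 + b) (exp (- t / c b))\<close> has two descriptions of its limit: the outermost
  generation by continuity of the generating function, the whole by \<open>c (1 + b) / c b\<close>
  tending to \<open>m\<close>.\<close>

lemma laplace_functional_eq:
  assumes "0 \<le> t"
  shows "expectation (\<lambda>\<omega>. exp (- (m * t) * W \<omega>)) = pgf p (expectation (\<lambda>\<omega>. exp (- t * W \<omega>)))"
proof (rule LIMSEQ_unique)
  have e01: "exp (- t / c b) \<in> {0..1}" for b using assms by (auto simp: divide_nonneg_pos)
  have lim: "(\<lambda>b. gwf p b (exp (- t / c b))) \<longlonglongrightarrow> expectation (\<lambda>\<omega>. exp (- t * W \<omega>))"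
    using assms by (rule laplace_real_tendsto)
  have in01: "gwf p b (exp (- t / c b)) \<in> {0..1}" for b
    using e01[of b] by (auto simp: gwf_def intro: pgf_nonneg pgf_le_1)
  have "expectation (\<lambda>\<omega>. exp (- t * W \<omega>)) \<in> {0..1}"
    by (rule Lim_in_closed_set[OF _ _ _ lim]) (use in01 in auto)
  then have "(\<lambda>b. pgf p (gwf p b (exp (- t / c b)))) \<longlonglongrightarrow> pgf p (expectation (\<lambda>\<omega>. exp (- t * W \<omega>)))"
    by (intro continuous_on_tendsto_compose[OF continuous_on_pgf lim]) (use in01 in auto)
  moreover have "pgf p (gwf p b (exp (- t / c b))) = gwf p (1 + b) (exp (- t / c b))" for b
    using e01[of b] by (simp add: gwf_Suc_real)
  ultimately show "(\<lambda>b. gwf p (1 + b) (exp (- t / c b))) \<longlonglongrightarrow> pgf p (expectation (\<lambda>\<omega>. exp (- t * W \<omega>)))"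
    by simp
  have "(\<lambda>b. expectation (\<lambda>\<omega>. exp (- t * (real (Z (1 + b) \<omega>) / c b)))) \<longlonglongrightarrow> expectation (\<lambda>\<omega>. exp (- t * (m ^ 1 * W \<omega>)))"
  proof (rule integral_dominated_convergence[where w="\<lambda>_. 1"])
    show "AE \<omega> in M. (\<lambda>b. exp (- t * (real (Z (1 + b) \<omega>) / c b))) \<longlonglongrightarrow> exp (- t * (m ^ 1 * W \<omega>))"
      using W_lim_shift[of 1] by eventually_elim (intro tendsto_intros)
  qed (use assms in \<open>auto intro!: AE_I2 divide_nonneg_pos mult_nonneg_nonneg sum_nonneg\<close>)
  moreover have "gwf p (1 + b) (exp (- t / c b)) = expectation (\<lambda>\<omega>. exp (- t * (real (Z (1 + b) \<omega>) / c b)))" for b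
    unfolding gwf_def pgf_def expectation_Z[symmetric, where f="\<lambda>k. exp (- t / c b) ^ k"]
    by (simp add: exp_of_nat_mult[symmetric] mult.commute)
  ultimately show "(\<lambda>b. gwf p (1 + b) (exp (- t / c b))) \<longlonglongrightarrow> expectation (\<lambda>\<omega>. exp (- (m * t) * W \<omega>))"
    by (simp add: mult_ac)
qed

text \<open>The transform at \<open>m ^ i\<close> tends to the mass at 0, and passing from
  \<open>i\<close> to \<open>i + 1\<close> applies \<open>pgf p\<close>. The mass is therefore a
  fixed point, and it is below 1 because \<open>W\<close> charges \<open>(1, 2]\<close>.\<close>

lemma prob_W_0: "prob {\<omega> \<in> space M. W \<omega> = 0} = ext_prob"
proof -
  define \<Phi> where "\<Phi> i = expectation (\<lambda>\<omega>. exp (- (m ^ i) * W \<omega>))" for i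
  have lim: "\<Phi> \<longlonglongrightarrow> expectation (\<lambda>\<omega>. indicator {\<omega> \<in> space M. W \<omega> = 0} \<omega>)"
    unfolding \<Phi>_def
  proof (rule integral_dominated_convergence[where w="\<lambda>_. 1"])
    show "AE \<omega> in M. (\<lambda>i. exp (- (m ^ i) * W \<omega>)) \<longlonglongrightarrow> indicator {\<omega> \<in> space M. W \<omega> = 0} \<omega>"
      using W_nonneg AE_space
    proof eventually_elim
      fix \<omega> assume *: "0 \<le> W \<omega>" "\<omega> \<in> space M"
      show "(\<lambda>i. exp (- (m ^ i) * W \<omega>)) \<longlonglongrightarrow> indicator {\<omega> \<in> space M. W \<omega> = 0} \<omega>"
      proof (cases "W \<omega> = 0")
        case False
        then have "filterlim (\<lambda>i. W \<omega> * m ^ i) at_top sequentially"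
          using * m_gt_1 by (intro filterlim_tendsto_pos_mult_at_top[OF tendsto_const] filterlim_power_at_top) auto
        then have "filterlim (\<lambda>i. - (W \<omega> * m ^ i)) at_bot sequentially" by (simp add: filterlim_uminus_at_bot)
        from filterlim_compose[OF exp_at_bot this] show ?thesis using False by (simp add: mult_ac)
      qed (use * in simp)
    qed
    show "AE \<omega> in M. norm (exp (- (m ^ i) * W \<omega>)) \<le> 1" for i
      using W_nonneg by eventually_elim (use m_pos in simp)
  qed auto
  then have lim: "\<Phi> \<longlonglongrightarrow> prob {\<omega> \<in> space M. W \<omega> = 0}" by simp
  have "\<Phi> i \<in> {0..1}" for i
  proof -
    have "0 \<le> \<Phi> i" unfolding \<Phi>_def by (intro integral_nonneg_AE) auto
    moreover have "\<Phi> i \<le> expectation (\<lambda>_. 1)"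
      unfolding \<Phi>_def
    proof (rule integral_mono_AE)
      have *: "AE \<omega> in M. norm (exp (- (m ^ i) * W \<omega>)) \<le> 1"
        using W_nonneg by eventually_elim (use m_pos in simp)
      then show "AE \<omega> in M. exp (- (m ^ i) * W \<omega>) \<le> 1" by simp
      from * show "integrable M (\<lambda>\<omega>. exp (- (m ^ i) * W \<omega>))" by (rule integrable_const_bound) simp
    qed simp
    ultimately show ?thesis by (simp add: prob_space)
  qed
  then have "(\<lambda>i. pgf p (\<Phi> i)) \<longlonglongrightarrow> pgf p (prob {\<omega> \<in> space M. W \<omega> = 0})"
    by (intro continuous_on_tendsto_compose[OF continuous_on_pgf lim]) auto
  moreover have "pgf p (\<Phi> i) = \<Phi> (Suc i)" for i
    unfolding \<Phi>_def using m_pos by (subst laplace_functional_eq[symmetric]) (simp_all add: mult_ac)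
  ultimately have "(\<lambda>i. \<Phi> (Suc i)) \<longlonglongrightarrow> pgf p (prob {\<omega> \<in> space M. W \<omega> = 0})" by simp
  moreover have "(\<lambda>i. \<Phi> (Suc i)) \<longlonglongrightarrow> prob {\<omega> \<in> space M. W \<omega> = 0}"
    using lim by (rule LIMSEQ_Suc)
  ultimately have "pgf p (prob {\<omega> \<in> space M. W \<omega> = 0}) = prob {\<omega> \<in> space M. W \<omega> = 0}"
    by (rule LIMSEQ_unique)
  then show ?thesis by (intro pgf_fixed_point_unique prob_W_0_lt_1) auto
qed

lemma Z_absorbing: "Z n \<omega> = 0 \<Longrightarrow> Z (n + l) \<omega> = 0"
  by (induction l) auto

lemma AE_W_eq_0_if_extinct: "AE \<omega> in M. \<forall>n. Z n \<omega> = 0 \<longrightarrow> W \<omega> = 0"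
  using W_lim
proof eventually_elim
  fix \<omega> assume lim: "(\<lambda>n. real (gw_Z \<xi> n \<omega>) / c n) \<longlonglongrightarrow> W \<omega>"
  show "\<forall>n. Z n \<omega> = 0 \<longrightarrow> W \<omega> = 0"
  proof (intro allI impI)
    fix n assume "Z n \<omega> = 0"
    then have "(\<lambda>l. real (gw_Z \<xi> (l + n) \<omega>) / c (l + n)) = (\<lambda>l. 0)"
      using Z_absorbing[of n \<omega>] by (auto simp: add.commute)
    moreover have "(\<lambda>l. real (gw_Z \<xi> (l + n) \<omega>) / c (l + n)) \<longlonglongrightarrow> W \<omega>"
      using lim by (rule LIMSEQ_ignore_initial_segment)
    ultimately have "(\<lambda>l::nat. 0) \<longlonglongrightarrow> W \<omega>" by simp
    from LIMSEQ_unique[OF this tendsto_const] show "W \<omega> = 0" .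
  qed
qed

text \<open>Extinction forces \<open>W = 0\<close>, so the probability is exactly the gap
  \<open>ext_prob - gwf p n 0\<close>.\<close>

lemma prob_survive_W_0: "(\<lambda>n. prob {\<omega> \<in> space M. Z n \<omega> > 0 \<and> W \<omega> = 0}) \<longlonglongrightarrow> 0"
proof -
  have "prob {\<omega> \<in> space M. Z n \<omega> > 0 \<and> W \<omega> = 0} = ext_prob - gwf p n 0" for n
  proof -
    have "prob {\<omega> \<in> space M. W \<omega> = 0} = prob {\<omega> \<in> space M. Z n \<omega> > 0 \<and> W \<omega> = 0} + prob {\<omega> \<in> space M. Z n \<omega> = 0 \<and> W \<omega> = 0}"
      by (subst finite_measure_Union[symmetric]) (auto intro!: arg_cong[where f=prob])
    also have "prob {\<omega> \<in> space M. Z n \<omega> = 0 \<and> W \<omega> = 0} = prob {\<omega> \<in> space M. Z n \<omega> = 0}"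
      by (rule finite_measure_eq_AE) (use AE_W_eq_0_if_extinct in \<open>eventually_elim, auto\<close>, measurable)
    also have "\<dots> = gwf p n 0" by (simp only: prob_Z_eq gwf_def pgf_0)
    finally show ?thesis by (simp add: prob_W_0)
  qed
  moreover have "(\<lambda>n. ext_prob - gwf p n 0) \<longlonglongrightarrow> ext_prob - ext_prob"
    by (intro tendsto_intros gwf_0_tendsto)
  ultimately show ?thesis by simp
qed

section \<open>Tightness and growth bounds uniform in the generation\<close>

lemma one_minus_gwf_le:
  assumes "0 \<le> (s::real)" "s \<le> 1"
  shows "1 - gwf p b s \<le> m ^ b * (1 - s)"
proof (induction b)
  case (Suc b)
  have in01: "gwf p b s \<in> {0..1}" using assms by (auto simp: gwf_def intro: pgf_nonneg pgf_le_1)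
  have "pgf_diff_quot p 1 1 = m"
    by (simp add: pgf_diff_quot_diag pgf_deriv_def m_eq offspring_mean_def)
  then have "pgf_diff_quot p (gwf p b s) 1 \<le> m"
    using pgf_diff_quot_mono[of "gwf p b s" 1 1 1] in01 by simp
  then have "(1 - gwf p b s) * pgf_diff_quot p (gwf p b s) 1 \<le> (m ^ b * (1 - s)) * m"
    using Suc in01 m_pos assms by (intro mult_mono pgf_diff_quot_nonneg) auto
  moreover have "1 - pgf p (gwf p b s) = (1 - gwf p b s) * pgf_diff_quot p (gwf p b s) 1"
    using pgf_diff[of "gwf p b s" 1] in01 by (simp add: algebra_simps)
  ultimately show ?case using assms by (simp add: gwf_Suc_real mult_ac)
qed simp

text \<open>Tightness of \<open>Z b / c b\<close> over all \<open>b\<close> in terms of transforms: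
  the limit handles large \<open>b\<close>, the mean bound \<open>m ^ b\<close> the finitely many
  others.\<close>

lemma laplace_tight:
  assumes "0 < \<epsilon>"
  obtains t where "0 < t" "\<And>b s. 0 \<le> s \<Longrightarrow> s \<le> t \<Longrightarrow> 1 - gwf p b (exp (- s / c b)) \<le> \<epsilon>"
proof -
  have "(\<lambda>i. expectation (\<lambda>\<omega>. exp (- inverse (real (Suc i)) * W \<omega>))) \<longlonglongrightarrow> expectation (\<lambda>_. 1)"
  proof (rule integral_dominated_convergence[where w="\<lambda>_. 1"])
    show "AE \<omega> in M. (\<lambda>i. exp (- inverse (real (Suc i)) * W \<omega>)) \<longlonglongrightarrow> 1"
    proof (rule AE_I2)
      fix \<omega>
      have "(\<lambda>i. exp (- inverse (real (Suc i)) * W \<omega>)) \<longlonglongrightarrow> exp (- 0 * W \<omega>)"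
        by (intro tendsto_intros LIMSEQ_inverse_real_of_nat)
      then show "(\<lambda>i. exp (- inverse (real (Suc i)) * W \<omega>)) \<longlonglongrightarrow> 1" by simp
    qed
    show "AE \<omega> in M. norm (exp (- inverse (real (Suc i)) * W \<omega>)) \<le> 1" for i
      using W_nonneg by eventually_elim (simp add: mult_nonneg_nonneg del: of_nat_Suc)
  qed auto
  then have "\<forall>\<^sub>F i in sequentially. 1 - \<epsilon> < expectation (\<lambda>\<omega>. exp (- inverse (real (Suc i)) * W \<omega>))"
    using assms by (intro order_tendstoD) (auto simp: prob_space)
  then obtain i where i: "1 - \<epsilon> < expectation (\<lambda>\<omega>. exp (- inverse (real (Suc i)) * W \<omega>))"
    by (auto simp: eventually_sequentially)
  define t0 where "t0 = inverse (real (Suc i))"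
  have t0: "0 < t0" by (simp add: t0_def)
  have "\<forall>\<^sub>F b in sequentially. 1 - \<epsilon> < gwf p b (exp (- t0 / c b))"
    using laplace_real_tendsto[of t0] t0 i unfolding t0_def by (intro order_tendstoD) auto
  then obtain b0 where b0: "\<And>b. b \<ge> b0 \<Longrightarrow> 1 - \<epsilon> < gwf p b (exp (- t0 / c b))"
    by (auto simp: eventually_sequentially)
  \<comment> \<open>The second term serves the indices below \<open>b0\<close>, where
    \<open>m ^ b0 * t \<le> \<epsilon>\<close> is enough because \<open>c b \<ge> 1\<close>.\<close>
  define t where "t = min t0 (\<epsilon> / m ^ b0)"
  have t: "0 < t" using t0 assms m_pos by (simp add: t_def)
  have le: "1 - gwf p b (exp (- t / c b)) \<le> \<epsilon>" for b
  proof (cases "b \<ge> b0")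
    case True
    have "gwf p b (exp (- t0 / c b)) \<le> gwf p b (exp (- t / c b))"
      using t by (intro gwf_mono) (auto simp: t_def divide_right_mono less_imp_le)
    then show ?thesis using b0[OF True] by linarith
  next
    case False
    have "1 - gwf p b (exp (- t / c b)) \<le> m ^ b * (1 - exp (- t / c b))"
      using t by (intro one_minus_gwf_le) (auto simp: less_imp_le)
    also have "\<dots> \<le> m ^ b0 * t"
    proof (intro mult_mono)
      have "1 - exp (- t / c b) \<le> t / c b" using exp_ge_add_one_self[of "- t / c b"] by simp
      also have "\<dots> \<le> t" using t c_ge_1[of b] by (simp add: divide_le_eq_1_pos field_simps)
      finally show "1 - exp (- t / c b) \<le> t" .
      show "m ^ b \<le> m ^ b0" using False m_gt_1 by (intro power_increasing) auto
    qed (use m_pos t in \<open>auto simp: less_imp_le\<close>)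
    also have "\<dots> \<le> m ^ b0 * (\<epsilon> / m ^ b0)" using m_pos by (intro mult_left_mono) (auto simp: t_def)
    also have "\<dots> = \<epsilon>" using m_pos by simp
    finally show ?thesis .
  qed
  show thesis
  proof (rule that[OF t])
    fix b and s :: real assume s: "0 \<le> s" "s \<le> t"
    have "gwf p b (exp (- t / c b)) \<le> gwf p b (exp (- s / c b))"
      using s by (intro gwf_mono) (auto simp: divide_right_mono less_imp_le)
    then show "1 - gwf p b (exp (- s / c b)) \<le> \<epsilon>" using le[of b] by linarith
  qed
qed

text \<open>Replaces the bound \<open>E Z\<^sub>b = O(c\<^sub>b)\<close>, which may fail without the \<open>x log x\<close> condition.\<close>

lemma slow_growth:
  assumes "0 < \<delta>"
  obtains C where "0 < C" "\<And>b l. c (b + l) * (1 - gwf p b (exp (- 1 / c (b + l)))) \<le> C * c b * (1 + \<delta>) ^ l"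
proof -
  \<comment> \<open>Makes \<open>m - \<epsilon> = m / (1 + \<delta>)\<close>, the guaranteed growth
    factor of \<open>1 - gwf\<close> per generation near 1.\<close>
  define \<epsilon> where "\<epsilon> = m - m / (1 + \<delta>)"
  have \<epsilon>: "0 < \<epsilon>" using m_pos assms by (simp add: \<epsilon>_def field_simps)
  obtain s0 where s0: "0 \<le> s0" "s0 < 1" "\<And>s. s0 \<le> s \<Longrightarrow> s \<le> 1 \<Longrightarrow> m - \<epsilon> < pgf_diff_quot p s 1"
    using pgf_diff_quot_near_1[OF \<epsilon>] by blast
  obtain t where t: "0 < t" "\<And>b s. 0 \<le> s \<Longrightarrow> s \<le> t \<Longrightarrow> 1 - gwf p b (exp (- s / c b)) \<le> 1 - s0"
    using laplace_tight[of "1 - s0"] s0(2) by (metis diff_gt_0_iff_gt)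
  obtain g K where g: "1 < g" "0 < K" "\<And>b l. g ^ l * c b \<le> K * c (b + l)" using c_growth by blast
  \<comment> \<open>From \<open>l0\<close> generations on, \<open>c b / c (b + l)\<close> is below
    the tightness threshold \<open>t\<close>.\<close>
  obtain l0 where l0: "K / t < g ^ l0" using real_arch_pow[OF g(1)] by blast
  have near1: "s0 \<le> gwf p b (exp (- 1 / c (b + l)))" if "l \<ge> l0" for b l
  proof -
    have "K / t * c b \<le> g ^ l * c b"
      using order.trans[OF less_imp_le[OF l0] power_increasing[OF that, of g]] g(1)
      by (intro mult_right_mono) (auto simp: less_imp_le)
    also have "\<dots> \<le> K * c (b + l)" by (rule g(3))
    finally have "c b / c (b + l) \<le> t" using g(2) t(1) by (simp add: field_simps)
    then have "1 - gwf p b (exp (- (c b / c (b + l)) / c b)) \<le> 1 - s0" by (intro t) (auto simp: less_imp_le)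
    then show ?thesis by simp
  qed
  have in01: "gwf p b (exp (- 1 / c a)) \<in> {0..1}" for a b
    by (auto simp: gwf_def less_imp_le intro!: pgf_nonneg pgf_le_1)
  \<comment> \<open>The argument is held fixed while \<open>b\<close> moves up as \<open>l\<close>
    moves down. Each generation multiplies \<open>1 - gwf\<close> by at least
    \<open>m / (1 + \<delta>)\<close>, and the final value is at most 1.\<close>
  have Q: "1 - gwf p b (exp (- 1 / c (b + l0 + l))) \<le> ((1 + \<delta>) / m) ^ l" for b l
  proof (induction l arbitrary: b)
    case 0
    then show ?case using in01[of b "b + l0"] by simp
  next
    case (Suc l)
    let ?r = "exp (- 1 / c (b + l0 + Suc l))"
    let ?s = "gwf p b ?r"
    have s: "s0 \<le> ?s" using near1[of "l0 + Suc l" b] by (simp add: add.assoc)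
    have "(1 - ?s) * (m / (1 + \<delta>)) \<le> (1 - ?s) * pgf_diff_quot p ?s 1"
      using s0(3)[OF s] in01[of b "b + l0 + Suc l"] by (intro mult_left_mono) (auto simp: \<epsilon>_def)
    also have "\<dots> = 1 - pgf p ?s"
      using pgf_diff[of ?s 1] in01[of b "b + l0 + Suc l"] by (simp add: algebra_simps)
    also have "\<dots> = 1 - gwf p (Suc b) ?r" by (simp add: gwf_Suc_real less_imp_le)
    also have "\<dots> \<le> ((1 + \<delta>) / m) ^ l" using Suc.IH[of "Suc b"] by simp
    finally show ?case using assms m_pos by (simp add: field_simps)
  qed
  show thesis
  proof (rule that[of "m ^ l0"])
    fix b l
    show "c (b + l) * (1 - gwf p b (exp (- 1 / c (b + l)))) \<le> m ^ l0 * c b * (1 + \<delta>) ^ l"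
    proof (cases "l \<ge> l0")
      case True
      then obtain l' where l': "l = l0 + l'" by (metis le_Suc_ex)
      have "c (b + l) * (1 - gwf p b (exp (- 1 / c (b + l)))) \<le> (m ^ l * c b) * ((1 + \<delta>) / m) ^ l'"
        using Q[of b l'] c_add_le[of b l] in01[of b "b + l"] m_pos
        by (intro mult_mono) (auto simp: l' add.assoc less_imp_le)
      also have "\<dots> = m ^ l0 * c b * (1 + \<delta>) ^ l'" using m_pos by (simp add: l' power_add power_divide)
      also have "\<dots> \<le> m ^ l0 * c b * (1 + \<delta>) ^ l"
        using assms m_pos by (intro mult_left_mono power_increasing) (auto simp: l' less_imp_le)
      finally show ?thesis .
    next
      case False
      have "c (b + l) * (1 - gwf p b (exp (- 1 / c (b + l)))) \<le> (m ^ l * c b) * 1"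
        using c_add_le[of b l] in01[of b "b + l"] m_pos by (intro mult_mono) (auto simp: less_imp_le)
      also have "\<dots> \<le> m ^ l0 * c b * 1"
        using False m_gt_1 by (simp add: power_increasing)
      also have "\<dots> \<le> m ^ l0 * c b * (1 + \<delta>) ^ l"
        using assms m_pos by (intro mult_left_mono one_le_power) (auto simp: less_imp_le)
      finally show ?thesis .
    qed
  qed (use m_pos in simp)
qed

text \<open>Trades the derivative for \<open>1 - gwf\<close>, to which the growth bound applies.
  Termwise it is \<open>u * exp (- u) \<le> 1 - exp (- u)\<close> with
  \<open>u = k / s\<close>.\<close>

lemma gwf'_exp_le:
  "exp (- 1 / s) * gwf' p b (exp (- 1 / s)) \<le> s * (1 - gwf p b (exp (- 1 / s)))" if "0 < s" for s :: real
proof -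
  let ?r = "exp (- 1 / s)" and ?q = "gw_law p b 1"
  have r: "0 < ?r" "?r < 1" using that by auto
  have "?r * gwf' p b ?r = measure_pmf.expectation ?q (\<lambda>k. ?r * (real k * ?r ^ (k - 1)))"
    by (simp add: gwf'_def pgf_deriv_def)
  also have "\<dots> \<le> measure_pmf.expectation ?q (\<lambda>k. s * (1 - ?r ^ k))"
  proof (intro integral_mono integrable_mult_right Bochner_Integration.integrable_diff integrable_pgf integrable_pgf_deriv)
    fix k
    show "?r * (real k * ?r ^ (k - 1)) \<le> s * (1 - ?r ^ k)"
    proof (cases k)
      case (Suc j)
      have rk: "?r ^ k = exp (- (real k / s))" by (simp add: exp_of_nat_mult[symmetric])
      have "1 + real k / s \<le> exp (real k / s)" by (rule exp_ge_add_one_self)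
      then have "(1 + real k / s) * exp (- (real k / s)) \<le> exp (real k / s) * exp (- (real k / s))"
        by (intro mult_right_mono) auto
      then have "real k / s * ?r ^ k \<le> 1 - ?r ^ k"
        unfolding rk by (simp add: exp_minus algebra_simps)
      then have "s * (real k / s * ?r ^ k) \<le> s * (1 - ?r ^ k)" using that by (intro mult_left_mono) auto
      then show ?thesis using that Suc by (simp add: mult_ac)
    qed simp
  qed (use r in auto)
  also have "\<dots> = s * (1 - gwf p b ?r)"
    using r by (simp add: gwf_def pgf_def integrable_pgf)
  finally show ?thesis .
qed

end

section \<open>Derivative bounds on circles\<close>

locale gw_lattice = gw_limit M p m \<xi> c W w
  for M :: "'a measure" and p m \<xi> c W w +
  fixes d \<mu> :: nat
  assumes type: "of_type p d \<mu>"
begin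

lemma c_nonneg [simp]: "0 \<le> c n"
  by (rule less_imp_le[OF c_pos])

lemma d_ge_1: "1 \<le> d" using type by (simp add: of_type_def)

text \<open>Half of the angular period. Exponents congruent modulo \<open>d\<close> give integrands
  of period \<open>2 * pi / d\<close>, and on this arc \<open>z = 1\<close> is the only point of the
  unit circle with \<open>z ^ d = 1\<close>.\<close>

definition B :: real where "B = pi / real d"

lemma B_pos: "0 < B" and d_B: "real d * B = pi"
  using d_ge_1 by (auto simp: B_def)

section \<open>Arithmetic of the offspring law\<close>

lemma pmf_\<mu>: "pmf p \<mu> > 0"
proof -
  obtain k where "pmf p k > 0" using exists_positive_offspring by auto
  then have "pmf p (LEAST j. pmf p j > 0) > 0" by (rule LeastI)
  then show ?thesis using type by (simp add: of_type_def law_min_def)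
qed

lemma \<mu>_le_1: "\<mu> \<le> 1"
proof -
  have "pmf p 0 > 0 \<or> pmf p 1 > 0"
    using schroeder pmf_nonneg[of p 0] pmf_nonneg[of p 1] unfolding schroeder_type_def by linarith
  then have "(LEAST j. pmf p j > 0) \<le> 1"
    using Least_le[of "\<lambda>j. pmf p j > 0" 0] Least_le[of "\<lambda>j. pmf p j > 0" 1] by auto
  then show ?thesis using type by (simp add: of_type_def law_min_def)
qed

lemma offspring_cong:
  assumes "k \<in> set_pmf p"
  shows "int d dvd int k - int \<mu>"
proof (cases "k = \<mu>")
  case False
  have "pmf p k > 0" using assms by (simp add: pmf_positive)
  then have "nat \<bar>int k - int \<mu>\<bar> \<in> {nat \<bar>int j - int l\<bar> | j l. j \<noteq> l \<and> pmf p j * pmf p l > 0}"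
    using False mult_pos_pos[OF _ pmf_\<mu>, of "pmf p k"] by blast
  then have "d dvd nat \<bar>int k - int \<mu>\<bar>"
    using type unfolding of_type_def law_span_def by (elim conjE) (simp only: Gcd_dvd)
  then have "int d dvd int (nat \<bar>int k - int \<mu>\<bar>)" by (simp only: int_dvd_int_iff)
  then show ?thesis by simp
qed simp

lemma offspring_sum_cong: "k \<in> set_pmf (offspring_sum p j) \<Longrightarrow> int d dvd int k - int j * int \<mu>"
proof (induction j arbitrary: k)
  case (Suc j)
  then obtain x y where xy: "x \<in> set_pmf (offspring_sum p j)" "y \<in> set_pmf p" "k = x + y"
    by (auto simp: conv_pmf_def)
  have "int d dvd (int x - int j * int \<mu>) + (int y - int \<mu>)"
    using Suc.IH[OF xy(1)] offspring_cong[OF xy(2)] by (rule dvd_add)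
  then show ?case using xy(3) by (simp add: algebra_simps)
qed simp

text \<open>One generation multiplies the residue modulo \<open>d\<close> by \<open>\<mu>\<close>.
  The Schroeder type leaves only \<open>\<mu> = 0\<close> or \<open>\<mu> = 1\<close>, so the
  residue is constant from generation 1 on.\<close>

lemma gw_law_cong: "1 \<le> n \<Longrightarrow> k \<in> set_pmf (gw_law p n 1) \<Longrightarrow> int d dvd int k - int \<mu>"
proof (induction n arbitrary: k rule: nat_induct_at_least)
  case base
  then show ?case unfolding One_nat_def gw_law_1_1 by (rule offspring_cong)
next
  case (Suc n)
  then obtain i where i: "i \<in> set_pmf (gw_law p n 1)" "k \<in> set_pmf (offspring_sum p i)" by auto
  have "int d dvd (int i - int \<mu>) * int \<mu>" using Suc.IH[OF i(1)] by (rule dvd_mult2)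
  moreover have "int \<mu> * int \<mu> = int \<mu>" using \<mu>_le_1 by (cases "\<mu> = 0") auto
  ultimately have "int d dvd int i * int \<mu> - int \<mu>" by (simp add: algebra_simps)
  with offspring_sum_cong[OF i(2)] have "int d dvd (int k - int i * int \<mu>) + (int i * int \<mu> - int \<mu>)"
    by (rule dvd_add)
  then show ?case by simp
qed

text \<open>The exponents \<open>n\<close> with \<open>z ^ n = 1\<close> are the multiples of the least positive one, which therefore divides
  all differences of support points.\<close>

lemma power_d_eq_1:
  assumes "z \<noteq> (0::complex)" and eq: "\<And>k. k \<in> set_pmf p \<Longrightarrow> z ^ k = u"
  shows "z ^ d = 1"
proof -
  define S where "S = {nat \<bar>int j - int l\<bar> | j l. j \<noteq> l \<and> pmf p j * pmf p l > 0}"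
  have dS: "d = Gcd S" using type by (simp add: of_type_def law_span_def S_def)
  have S1: "0 < n \<and> z ^ n = 1" if n: "n \<in> S" for n
  proof -
    obtain j l where jl: "n = nat \<bar>int j - int l\<bar>" "j \<noteq> l" "pmf p j * pmf p l > 0" using n by (auto simp: S_def)
    then have "pmf p j \<noteq> 0" "pmf p l \<noteq> 0" by auto
    then have "z ^ j = z ^ l" using eq by (simp add: set_pmf_iff)
    moreover have "l = j + n \<or> j = l + n" using jl(1) by auto
    ultimately have "z ^ n = 1" using assms(1) by (auto simp: power_add)
    then show ?thesis using jl by auto
  qed
  have "S \<noteq> {}" using dS d_ge_1 by auto
  then obtain n0 where "0 < n0 \<and> z ^ n0 = 1" using S1 by auto
  then have h: "0 < (LEAST n. 0 < n \<and> z ^ n = 1) \<and> z ^ (LEAST n. 0 < n \<and> z ^ n = 1) = 1" by (rule LeastI)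
  define h where "h = (LEAST n. 0 < n \<and> z ^ n = 1)"
  have "h dvd n" if "n \<in> S" for n
  proof (rule ccontr)
    assume "\<not> h dvd n"
    then have "0 < n mod h" by (simp add: dvd_eq_mod_eq_0)
    have "1 = z ^ (h * (n div h) + n mod h)" using S1[OF that] by simp
    also have "\<dots> = (z ^ h) ^ (n div h) * z ^ (n mod h)" by (simp only: power_add power_mult)
    also have "\<dots> = z ^ (n mod h)" using h by (simp add: h_def)
    finally have "0 < n mod h \<and> z ^ (n mod h) = 1" using \<open>0 < n mod h\<close> by simp
    then have "h \<le> n mod h" unfolding h_def by (rule Least_le)
    moreover have "n mod h < h" using h by (simp add: h_def)
    ultimately show False by simp
  qed
  then have "h dvd d" unfolding dS by (rule Gcd_greatest)
  then obtain e where "d = h * e" ..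
  then show ?thesis using h by (simp add: power_mult h_def)
qed

text \<open>Modulus 1 would make \<open>z ^ k\<close> constant on the support. A positive exponent
  in the support rules out \<open>z = 0\<close>, and then \<open>z ^ d = 1\<close>.\<close>

lemma norm_pgf_lt_1:
  assumes "norm (z::complex) \<le> 1" "z ^ d \<noteq> 1"
  shows "norm (pgf p z) < 1"
proof (rule ccontr)
  assume "\<not> ?thesis"
  then have 1: "norm (pgf p z) = 1" using pgf_norm_le_1[OF assms(1), of p] by simp
  then have "AE k in measure_pmf p. z ^ k = pgf p z"
    unfolding pgf_def
    by (intro measure_pmf.AE_eq_expectation_if_norm_eq_1) (use pow_norm_le_1[OF assms(1)] in auto)
  then have eq: "z ^ k = pgf p z" if "k \<in> set_pmf p" for k using that by (simp add: AE_measure_pmf_iff)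
  obtain k where k: "1 \<le> k" "pmf p k > 0" using exists_positive_offspring by auto
  then have "z ^ k = pgf p z" by (intro eq) (simp add: set_pmf_iff)
  have "z \<noteq> 0"
  proof
    assume "z = 0"
    then have "pgf p z = 0" using \<open>z ^ k = pgf p z\<close> k(1) by (metis not_one_le_zero power_0_left)
    with 1 show False by simp
  qed
  from power_d_eq_1[OF this eq] assms(2) show False by simp
qed

text \<open>Keeps the inner value of the factorisation off the unit circle with one constant for all
  \<open>b\<close>. For large \<open>b\<close> it is close to \<open>laplace_W\<close>, whose
  modulus on a compact set avoiding 0 stays below 1; the finitely many other \<open>b\<close> are
  handled one by one. The bounds on \<open>Im \<zeta>\<close> describe angles between
  \<open>B / c b\<close> and \<open>B / c (b - 1)\<close>.\<close>

lemma norm_gwf_uniform: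
  obtains \<rho> where "0 < \<rho>" "\<rho> < 1"
    "\<And>b \<zeta>. 1 \<le> b \<Longrightarrow> -1 \<le> Re \<zeta> \<Longrightarrow> Re \<zeta> \<le> 0 \<Longrightarrow> B \<le> \<bar>Im \<zeta>\<bar> \<Longrightarrow> \<bar>Im \<zeta>\<bar> * c (b - 1) \<le> B * c b \<Longrightarrow>
       norm (gwf p b (exp (\<zeta> / of_real (c b)))) \<le> \<rho>"
    "\<And>b. gwf p b (exp (- 1 / c b)) \<le> \<rho>"
proof -
  \<comment> \<open>The extra point -1 carries the second claim, on the real axis, through the same
    argument and makes the set nonempty.\<close>
  define K1 where "K1 T = {\<zeta>. -1 \<le> Re \<zeta> \<and> Re \<zeta> \<le> 0 \<and> B \<le> \<bar>Im \<zeta>\<bar> \<and> \<bar>Im \<zeta>\<bar> \<le> T} \<union> {-1}" for T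
  have comp: "compact (K1 T)" for T
  proof -
    have "closed (K1 T)" unfolding K1_def
      by (intro closed_Un closed_Collect_conj closed_Collect_le continuous_intros)
    moreover have "bounded (K1 T)"
    proof -
      have "norm \<zeta> \<le> 1 + \<bar>T\<bar>" if "\<zeta> \<in> K1 T" for \<zeta>
        using that cmod_le[of \<zeta>] by (auto simp: K1_def)
      then show ?thesis by (auto simp: bounded_iff)
    qed
    ultimately show ?thesis by (simp add: compact_eq_bounded_closed)
  qed
  have ne: "K1 T \<noteq> {}" for T by (auto simp: K1_def)
  have K_neg: "Re \<zeta> \<le> 0" "\<zeta> \<noteq> 0" if "\<zeta> \<in> K1 T" for \<zeta> T
    using that B_pos by (auto simp: K1_def)
  \<comment> \<open>The ratio \<open>c b / c (b - 1) \<le> m\<close> places the strips for all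
    \<open>b\<close> in one compact set.\<close>
  have in_K1: "\<zeta> \<in> K1 (m * B)" if "1 \<le> b" "\<zeta> \<in> K1 (B * c b / c (b - 1))" for \<zeta> b
  proof -
    have "c b \<le> m * c (b - 1)" using c_Suc_le[of "b - 1"] that by simp
    then have "B * c b / c (b - 1) \<le> m * B" using B_pos by (simp add: field_simps)
    then show ?thesis using that by (auto simp: K1_def)
  qed
  have "continuous_on (K1 (m * B)) (\<lambda>\<zeta>. norm (laplace_W \<zeta>))"
    by (intro continuous_on_norm continuous_on_subset[OF continuous_on_laplace_W]) (use K_neg in auto)
  then obtain \<zeta>0 where \<zeta>0: "\<zeta>0 \<in> K1 (m * B)" "\<And>\<zeta>. \<zeta> \<in> K1 (m * B) \<Longrightarrow> norm (laplace_W \<zeta>) \<le> norm (laplace_W \<zeta>0)"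
    using continuous_attains_sup[OF comp ne] by blast
  define \<rho>0 where "\<rho>0 = norm (laplace_W \<zeta>0)"
  have \<rho>0: "\<rho>0 < 1" unfolding \<rho>0_def using K_neg[OF \<zeta>0(1)] by (rule norm_laplace_W_lt_1)
  obtain R where R: "\<And>\<zeta>. \<zeta> \<in> K1 (m * B) \<Longrightarrow> norm \<zeta> \<le> R"
    using compact_imp_bounded[OF comp] unfolding bounded_iff by blast
  obtain b0 where b0: "\<And>b z. b \<ge> b0 \<Longrightarrow> Re z \<le> 0 \<Longrightarrow> norm z \<le> R \<Longrightarrow>
    norm (gwf p b (exp (z / of_real (c b))) - laplace_W z) \<le> (1 - \<rho>0) / 2"
    by (rule laplace_tendsto_uniform[of "(1 - \<rho>0) / 2" R]) (use \<rho>0 in simp, blast)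
  have large: "norm (gwf p b (exp (\<zeta> / of_real (c b)))) \<le> (1 + \<rho>0) / 2" if "b \<ge> b0" "\<zeta> \<in> K1 (m * B)" for b \<zeta>
  proof -
    have "norm (gwf p b (exp (\<zeta> / of_real (c b)))) \<le>
        norm (laplace_W \<zeta>) + norm (gwf p b (exp (\<zeta> / of_real (c b))) - laplace_W \<zeta>)"
      by (rule norm_triangle_sub)
    also have "\<dots> \<le> \<rho>0 + (1 - \<rho>0) / 2"
      using that \<zeta>0(2)[OF that(2)] K_neg(1)[OF that(2)] R[OF that(2)] unfolding \<rho>0_def[symmetric]
      by (intro add_mono b0)
    also have "\<dots> = (1 + \<rho>0) / 2" by (simp add: field_simps)
    finally show ?thesis .
  qed
  have small: "\<exists>\<rho><1. \<forall>\<zeta>\<in>K1 (B * c b / c (b - 1)). norm (gwf p b (exp (\<zeta> / of_real (c b)))) \<le> \<rho>" if "1 \<le> b" for b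
  proof -
    let ?K = "K1 (B * c b / c (b - 1))"
    have n1: "norm (exp (\<zeta> / of_real (c b))) \<le> 1" if "\<zeta> \<in> ?K" for \<zeta>
      using K_neg(1)[OF that] by (simp add: divide_nonpos_pos)
    have "continuous_on ?K (\<lambda>\<zeta>. gwf p b (exp (\<zeta> / of_real (c b))))"
      unfolding gwf_def
      by (rule continuous_on_compose2[OF continuous_on_pgf]) (use n1 in \<open>auto intro!: continuous_intros\<close>)
    then have "continuous_on ?K (\<lambda>\<zeta>. norm (gwf p b (exp (\<zeta> / of_real (c b)))))" by (rule continuous_on_norm)
    then obtain \<zeta>1 where \<zeta>1: "\<zeta>1 \<in> ?K" "\<And>\<zeta>. \<zeta> \<in> ?K \<Longrightarrow>
        norm (gwf p b (exp (\<zeta> / of_real (c b)))) \<le> norm (gwf p b (exp (\<zeta>1 / of_real (c b))))"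
      using continuous_attains_sup[OF comp ne] by blast
    let ?z = "exp (\<zeta>1 / of_real (c b))"
    \<comment> \<open>The angle times \<open>d\<close> is at most \<open>pi\<close> in modulus
      because \<open>c (b - 1) \<ge> 1\<close>. It can be a multiple of \<open>2 * pi\<close> only
      by vanishing.\<close>
    have "?z ^ d \<noteq> 1"
    proof
      assume "?z ^ d = 1"
      then have "exp (of_nat d * (\<zeta>1 / of_real (c b))) = 1" unfolding exp_of_nat_mult .
      then obtain n where n: "Re (of_nat d * (\<zeta>1 / of_real (c b))) = 0"
          "Im (of_nat d * (\<zeta>1 / of_real (c b))) = of_int (2 * n) * pi" unfolding exp_eq_1 by auto
      have "Re \<zeta>1 = 0" using n(1) d_ge_1 by simp
      then have I: "B \<le> \<bar>Im \<zeta>1\<bar>" "\<bar>Im \<zeta>1\<bar> \<le> B * c b / c (b - 1)" using \<zeta>1(1) by (auto simp: K1_def)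
      have "real d * \<bar>Im \<zeta>1\<bar> = \<bar>real_of_int n\<bar> * (2 * pi) * c b"
      proof -
        have "real d * (Im \<zeta>1 / c b) = of_int (2 * n) * pi" using n(2) by simp
        then have "real d * Im \<zeta>1 = (of_int n * (2 * pi)) * c b" by (simp add: field_simps)
        then have "\<bar>real d * Im \<zeta>1\<bar> = \<bar>(of_int n * (2 * pi)) * c b\<bar>" by simp
        then show ?thesis by (simp add: abs_mult abs_of_pos)
      qed
      moreover have "real d * \<bar>Im \<zeta>1\<bar> \<le> real d * (B * c b)"
      proof (intro mult_left_mono)
        have "\<bar>Im \<zeta>1\<bar> * 1 \<le> \<bar>Im \<zeta>1\<bar> * c (b - 1)" using c_ge_1 by (intro mult_left_mono) auto
        also have "\<dots> \<le> B * c b" using I(2) by (simp add: field_simps)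
        finally show "\<bar>Im \<zeta>1\<bar> \<le> B * c b" by simp
      qed simp
      moreover have "real d * (B * c b) = pi * c b" using d_B by (simp add: mult.assoc[symmetric])
      ultimately have "\<bar>real_of_int n\<bar> * (2 * pi) * c b \<le> pi * c b" by linarith
      then have "\<bar>real_of_int n\<bar> * 2 \<le> 1" by simp
      then have "n = 0" by linarith
      then have "real d * \<bar>Im \<zeta>1\<bar> = 0" using \<open>real d * \<bar>Im \<zeta>1\<bar> = \<bar>real_of_int n\<bar> * (2 * pi) * c b\<close> by simp
      then show False using I(1) B_pos d_ge_1 by auto
    qed
    \<comment> \<open>One generation leaves the unit circle, and the remaining \<open>b - 1\<close>
      stay inside.\<close>
    with n1[OF \<zeta>1(1)] have "norm (pgf p ?z) < 1" by (rule norm_pgf_lt_1)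
    then have "norm (gwf p (b - 1) (pgf p ?z)) < 1" by (rule norm_gwf_lt_1)
    moreover have "gwf p b ?z = gwf p (b - 1) (pgf p ?z)"
      using gwf_add[OF n1[OF \<zeta>1(1)], of p "b - 1" 1] that gwf_one[OF n1[OF \<zeta>1(1)], of p] by simp
    ultimately show ?thesis using \<zeta>1(2) by (intro exI[of _ "norm (gwf p b ?z)"]) auto
  qed
  have "\<exists>\<rho><1. \<forall>b\<in>{1..n}. \<forall>\<zeta>\<in>K1 (B * c b / c (b - 1)). norm (gwf p b (exp (\<zeta> / of_real (c b)))) \<le> \<rho>" for n
  proof (induction n)
    case 0
    show ?case by (intro exI[of _ 0]) auto
  next
    case (Suc n)
    then obtain \<rho>1 where 1: "\<rho>1 < 1" "\<forall>b\<in>{1..n}. \<forall>\<zeta>\<in>K1 (B * c b / c (b - 1)). norm (gwf p b (exp (\<zeta> / of_real (c b)))) \<le> \<rho>1" by auto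
    obtain \<rho>2 where 2: "\<rho>2 < 1" "\<forall>\<zeta>\<in>K1 (B * c (Suc n) / c (Suc n - 1)). norm (gwf p (Suc n) (exp (\<zeta> / of_real (c (Suc n))))) \<le> \<rho>2"
      using small[of "Suc n"] by auto
    show ?case
      using 1 2 by (intro exI[of _ "max \<rho>1 \<rho>2"]) (auto simp: le_Suc_eq le_max_iff_disj)
  qed
  then obtain \<rho>1 where \<rho>1: "\<rho>1 < 1" "\<forall>b\<in>{1..b0}. \<forall>\<zeta>\<in>K1 (B * c b / c (b - 1)). norm (gwf p b (exp (\<zeta> / of_real (c b)))) \<le> \<rho>1" by blast
  \<comment> \<open>\<open>exp (-1)\<close> is the value for \<open>b = 0\<close>, where
    \<open>c 0 = 1\<close>; it also makes \<rho> positive.\<close>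
  define \<rho> where "\<rho> = Max {\<rho>1, (1 + \<rho>0) / 2, exp (-1)}"
  have \<rho>: "0 < \<rho>" "\<rho> < 1" using \<rho>0 \<rho>1(1) by (auto simp: \<rho>_def less_max_iff_disj)
  have all: "norm (gwf p b (exp (\<zeta> / of_real (c b)))) \<le> \<rho>" if "1 \<le> b" "\<zeta> \<in> K1 (B * c b / c (b - 1))" for b \<zeta>
  proof (cases "b \<ge> b0")
    case True
    then show ?thesis using large[OF True in_K1[OF that]] by (auto simp: \<rho>_def le_max_iff_disj)
  next
    case False
    then show ?thesis using \<rho>1(2) that by (auto simp: \<rho>_def le_max_iff_disj)
  qed
  show thesis
  proof (rule that[OF \<rho>])
    fix b \<zeta> assume *: "1 \<le> b" "-1 \<le> Re \<zeta>" "Re \<zeta> \<le> 0" "B \<le> \<bar>Im \<zeta>\<bar>" "\<bar>Im \<zeta>\<bar> * c (b - 1) \<le> B * c b"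
    then show "norm (gwf p b (exp (\<zeta> / of_real (c b)))) \<le> \<rho>"
      by (intro all) (auto simp: K1_def field_simps)
  next
    fix b
    show "gwf p b (exp (- 1 / c b)) \<le> \<rho>"
    proof (cases "b = 0")
      case False
      have "gwf p b (exp (- 1 / of_real (c b))) = complex_of_real (gwf p b (exp (- 1 / c b)))"
        unfolding gwf_of_real[symmetric] by (simp flip: exp_of_real)
      then have "\<bar>gwf p b (exp (- 1 / c b))\<bar> = norm (gwf p b (exp (- 1 / of_real (c b) :: complex)))" by simp
      also have "\<dots> \<le> \<rho>" using all[of b "-1"] False by (auto simp: K1_def)
      finally show ?thesis by simp
    qed (simp add: \<rho>_def le_max_iff_disj)
  qed
qed

text \<open>The derivative is split at generation \<open>b\<close>. The outer one, at a point of
  modulus at most \<open>\<rho> < 1\<close>, has order \<open>\<gamma> ^ (N + l)\<close>; the inner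
  one is bounded by its value on the positive axis. The alternative \<open>l = 0\<close> covers the
  central arc: there the radius alone keeps the point away from 1 at the scale
  \<open>c b\<close>.\<close>

lemma derivative_bound:
  obtains C \<kappa> where "0 < C" "0 < \<kappa>" "\<kappa> < 1"
    "\<And>N b l \<theta>. 1 \<le> b \<Longrightarrow> \<bar>\<theta>\<bar> * c (b - 1) \<le> B \<Longrightarrow> B \<le> \<bar>\<theta>\<bar> * c b \<or> l = 0 \<Longrightarrow>
      exp (- 1 / c (b + l)) * norm (gwf' p (N + l + b) (of_real (exp (- 1 / c (b + l))) * cis \<theta>))
        \<le> C * \<gamma> ^ N * \<kappa> ^ l * c b"
proof -
  obtain \<rho> where \<rho>: "0 < \<rho>" "\<rho> < 1"
    "\<And>b \<zeta>. 1 \<le> b \<Longrightarrow> -1 \<le> Re \<zeta> \<Longrightarrow> Re \<zeta> \<le> 0 \<Longrightarrow> B \<le> \<bar>Im \<zeta>\<bar> \<Longrightarrow> \<bar>Im \<zeta>\<bar> * c (b - 1) \<le> B * c b \<Longrightarrow>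
       norm (gwf p b (exp (\<zeta> / of_real (c b)))) \<le> \<rho>"
    "\<And>b. gwf p b (exp (- 1 / c b)) \<le> \<rho>"
    by (rule norm_gwf_uniform) blast
  obtain C1 where C1: "0 < C1" "\<And>n. gwf' p n \<rho> \<le> C1 * \<gamma> ^ n"
    by (rule gwf'_upper[OF less_imp_le[OF \<rho>(1)] \<rho>(2)]) blast
  \<comment> \<open>Half of the decay rate is sacrificed to the growth
    \<open>(1 + \<delta>) ^ l\<close>, with \<delta> such that
    \<open>\<gamma> * (1 + \<delta>) = \<kappa>\<close>.\<close>
  define \<kappa> where "\<kappa> = sqrt \<gamma>"
  have \<kappa>: "0 < \<kappa>" "\<kappa> < 1" "\<kappa> * \<kappa> = \<gamma>" using \<gamma>_pos \<gamma>_lt_1 by (auto simp: \<kappa>_def)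
  define \<delta> where "\<delta> = 1 / \<kappa> - 1"
  have \<delta>: "0 < \<delta>" "\<gamma> * (1 + \<delta>) = \<kappa>" using \<kappa> by (auto simp: \<delta>_def field_simps)
  obtain C2 where C2: "0 < C2" "\<And>b l. c (b + l) * (1 - gwf p b (exp (- 1 / c (b + l)))) \<le> C2 * c b * (1 + \<delta>) ^ l"
    by (rule slow_growth[OF \<delta>(1)]) blast
  show thesis
  proof (rule that[of "C1 * C2" \<kappa>])
    fix N b l :: nat and \<theta> :: real
    assume b: "1 \<le> b" and \<theta>: "\<bar>\<theta>\<bar> * c (b - 1) \<le> B" and or: "B \<le> \<bar>\<theta>\<bar> * c b \<or> l = 0"
    let ?r = "exp (- 1 / c (b + l))"
    let ?z = "of_real ?r * cis \<theta>"
    have r: "0 < ?r" "?r < 1" by auto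
    have nz: "norm ?z = ?r" by (simp add: norm_mult)
    have fb: "norm (gwf p b ?z) \<le> \<rho>"
    proof (cases "B \<le> \<bar>\<theta>\<bar> * c b")
      case True
      \<comment> \<open>Seen at scale \<open>c b\<close>, the circle of radius
        \<open>exp (- 1 / c (b + l))\<close> has real part \<open>- c b / c (b + l)\<close>, which
        lies in \<open>[-1, 0]\<close>.\<close>
      define \<zeta> where "\<zeta> = Complex (- c b / c (b + l)) (\<theta> * c b)"
      have "\<zeta> / of_real (c b) = Complex (- 1 / c (b + l)) \<theta>"
        by (simp add: \<zeta>_def complex_eq_iff)
      then have "exp (\<zeta> / of_real (c b)) = ?z"
        by (simp add: exp_eq_polar)
      moreover have "norm (gwf p b (exp (\<zeta> / of_real (c b)))) \<le> \<rho>"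
      proof (rule \<rho>(3)[OF b])
        show "-1 \<le> Re \<zeta>" using c_mono[of b "b + l"] by (simp add: \<zeta>_def)
        show "Re \<zeta> \<le> 0" by (simp add: \<zeta>_def less_imp_le)
        show "B \<le> \<bar>Im \<zeta>\<bar>" using True by (simp add: \<zeta>_def abs_mult abs_of_pos)
        have "\<bar>\<theta>\<bar> * c (b - 1) * c b \<le> B * c b" using \<theta> by (intro mult_right_mono) (auto simp: less_imp_le)
        then show "\<bar>Im \<zeta>\<bar> * c (b - 1) \<le> B * c b" by (simp add: \<zeta>_def abs_mult abs_of_pos mult_ac)
      qed
      ultimately show ?thesis by simp
    next
      case False
      then have l: "l = 0" using or by auto
      have "norm (gwf p b ?z) \<le> gwf p b ?r" unfolding gwf_def by (rule norm_pgf_le) (use nz r in auto)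
      also have "\<dots> \<le> \<rho>" using \<rho>(4)[of b] l by simp
      finally show ?thesis .
    qed
    have "norm (gwf' p (N + l + b) ?z) = norm (gwf' p (N + l) (gwf p b ?z)) * norm (gwf' p b ?z)"
      using nz r by (subst gwf'_add) (auto simp: norm_mult)
    also have "\<dots> \<le> (C1 * \<gamma> ^ (N + l)) * gwf' p b ?r"
    proof (rule mult_mono)
      have "norm (gwf' p (N + l) (gwf p b ?z)) \<le> gwf' p (N + l) \<rho>"
        unfolding gwf'_def using fb \<rho>(2) by (rule norm_pgf_deriv_le)
      also have "\<dots> \<le> C1 * \<gamma> ^ (N + l)" by (rule C1(2))
      finally show "norm (gwf' p (N + l) (gwf p b ?z)) \<le> C1 * \<gamma> ^ (N + l)" .
      show "norm (gwf' p b ?z) \<le> gwf' p b ?r"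
        unfolding gwf'_def by (rule norm_pgf_deriv_le) (use nz r in auto)
    qed (use C1(1) \<gamma>_pos in auto)
    finally have 1: "norm (gwf' p (N + l + b) ?z) \<le> C1 * \<gamma> ^ (N + l) * gwf' p b ?r" .
    have "?r * gwf' p b ?r \<le> c (b + l) * (1 - gwf p b ?r)"
      by (rule gwf'_exp_le) simp
    also have "\<dots> \<le> C2 * c b * (1 + \<delta>) ^ l" by (rule C2(2))
    finally have 2: "?r * gwf' p b ?r \<le> C2 * c b * (1 + \<delta>) ^ l" .
    have "?r * norm (gwf' p (N + l + b) ?z) \<le> ?r * (C1 * \<gamma> ^ (N + l) * gwf' p b ?r)"
      using 1 r by (intro mult_left_mono) auto
    also have "\<dots> = C1 * \<gamma> ^ (N + l) * (?r * gwf' p b ?r)" by simp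
    also have "\<dots> \<le> C1 * \<gamma> ^ (N + l) * (C2 * c b * (1 + \<delta>) ^ l)"
      using 2 C1(1) \<gamma>_pos by (intro mult_left_mono) auto
    also have "\<dots> = C1 * C2 * \<gamma> ^ N * (\<gamma> * (1 + \<delta>)) ^ l * c b"
      by (simp add: power_add power_mult_distrib mult_ac)
    also have "\<dots> = C1 * C2 * \<gamma> ^ N * \<kappa> ^ l * c b" unfolding \<delta>(2) ..
    finally show "?r * norm (gwf' p (N + l + b) ?z) \<le> C1 * C2 * \<gamma> ^ N * \<kappa> ^ l * c b" .
  qed (use C1 C2 \<kappa> in auto)
qed

end

section \<open>Fourier estimate of the tilted point probabilities\<close>

lemma norm_cis_diff_le: "norm (cis x - cis y) \<le> \<bar>x - y\<bar>"
proof -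
  have "norm (exp (\<i> * of_real x) - exp (\<i> * of_real y)) \<le> norm (\<i> * of_real x - \<i> * of_real y)"
    by (rule norm_exp_diff_le) auto
  also have "\<dots> = norm (\<i> * of_real (x - y))" by (simp only: right_diff_distrib of_real_diff)
  also have "\<dots> = \<bar>x - y\<bar>" by (simp add: norm_mult del: of_real_diff)
  finally show ?thesis by (simp add: cis_conv_exp)
qed

text \<open>Interpolation between the trivial bound 2 and a Lipschitz bound; the Hoelder exponent
  originates here.\<close>

lemma min_2_le_powr:
  assumes "0 \<le> x" "0 \<le> \<sigma>" "\<sigma> \<le> (1::real)" "y \<le> 2" "y \<le> x"
  shows "y \<le> 2 * x powr \<sigma>"
proof (cases "x \<le> 1")
  case True
  have "x \<le> x powr \<sigma>"
    using True assms powr_mono'[of \<sigma> 1 x] by (cases "x = 0") auto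
  moreover have "0 \<le> x powr \<sigma>" by simp
  ultimately show ?thesis using assms by linarith
next
  case False
  then have "1 \<le> x powr \<sigma>" using assms by (intro ge_one_powr_ge_zero) auto
  then show ?thesis using assms by linarith
qed

lemma integral_cis:
  fixes n :: int
  assumes "0 < d" "int d dvd n"
  shows "(LINT \<theta>|lborel. indicator {- (pi / real d)..pi / real d} \<theta> *\<^sub>R cis (of_int n * \<theta>)) =
         (if n = 0 then of_real (2 * (pi / real d)) else 0)"
proof (cases "n = 0")
  case True
  have "(LINT \<theta>|lborel. indicator {- (pi / real d)..pi / real d} \<theta> *\<^sub>R (1::complex)) =
     measure lborel {- (pi / real d)..pi / real d} *\<^sub>R 1"
    by (subst Bochner_Integration.integral_scaleR_left) auto
  then show ?thesis using True assms by (simp add: scaleR_conv_of_real)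
next
  case False
  let ?B = "pi / real d"
  let ?F = "\<lambda>\<theta>. cis (of_int n * \<theta>) / (\<i> * of_int n)"
  have "(LINT \<theta>|lborel. indicator {- ?B..?B} \<theta> *\<^sub>R cis (of_int n * \<theta>)) = ?F ?B - ?F (- ?B)"
  proof (rule integral_FTC_Icc)
    show "(?F has_vector_derivative cis (of_int n * \<theta>)) (at \<theta> within {- ?B..?B})" for \<theta>
      unfolding cis_conv_exp
      by (auto intro!: derivative_eq_intros has_vector_derivative_real_field simp: False field_simps)
    show "continuous_on {- ?B..?B} (\<lambda>\<theta>. cis (of_int n * \<theta>))"
      by (intro continuous_intros)
  qed simp
  also have "\<dots> = 0"
  proof -
    obtain e where e: "n = int d * e" using assms(2) ..
    have "of_int n * ?B = of_int e * pi" using assms(1) by (simp add: e)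
    then have "cis (of_int n * ?B) = cis (of_int e * pi)" "cis (of_int n * (- ?B)) = cis (- (of_int e * pi))"
      by (simp_all only: mult_minus_right)
    moreover have "cis (of_int e * pi) = cis (- (of_int e * pi))"
      using sin_zero_iff_int2[of "of_int e * pi"] by (auto simp: complex_eq_iff)
    ultimately show ?thesis by simp
  qed
  finally show ?thesis using False by simp
qed

text \<open>All frequencies \<open>j - k\<close> are multiples of \<open>d\<close>, so orthogonality
  already holds on one period of length \<open>2 * pi / d\<close>. A radius below 1 makes the series
  absolutely summable and permits termwise integration.\<close>

lemma coefficient_integral:
  assumes d: "0 < d" and cong: "\<And>k. k \<in> set_pmf q \<Longrightarrow> int d dvd int k - int \<mu>"
    and k: "int d dvd int k - int \<mu>" and r: "0 < r" "r < (1::real)"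
  shows "integrable lborel (\<lambda>\<theta>. indicator {- (pi / real d)..pi / real d} \<theta> *\<^sub>R
            (of_real r * cis \<theta> * pgf_deriv q (of_real r * cis \<theta>) * cis (- (real k * \<theta>))))" (is ?int)
    and "(LINT \<theta>|lborel. indicator {- (pi / real d)..pi / real d} \<theta> *\<^sub>R
            (of_real r * cis \<theta> * pgf_deriv q (of_real r * cis \<theta>) * cis (- (real k * \<theta>)))) =
         of_real (2 * (pi / real d) * (real k * pmf q k * r ^ k))" (is ?eq)
proof -
  let ?B = "pi / real d"
  define a where "a j = pmf q j * (real j * r ^ j)" for j
  have a0: "0 \<le> a j" for j using r by (simp add: a_def)
  have summ: "summable a"
  proof -
    have "integrable (measure_pmf q) (\<lambda>k. r * (of_nat k * r ^ (k - 1)))"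
      using r by (intro integrable_mult_right integrable_pgf_deriv) auto
    from sums_summable[OF sums_pmf_expectation[OF this]]
    have "summable (\<lambda>k. pmf q k *\<^sub>R (r * (real k * r ^ (k - 1))))" .
    moreover have eq: "pmf q k *\<^sub>R (r * (real k * r ^ (k - 1))) = a k" for k
      by (cases k) (auto simp: a_def)
    ultimately show ?thesis by (simp only: eq)
  qed
  define h where "h j \<theta> = indicator {- ?B..?B} \<theta> *\<^sub>R (of_real (a j) * cis (of_int (int j - int k) * \<theta>))" for j \<theta>
  have inth: "integrable lborel (h j)" for j
    unfolding h_def by (intro borel_integrable_compact continuous_intros) auto
  have normh: "norm (h j \<theta>) = indicator {- ?B..?B} \<theta> * a j" for j \<theta>
    using a0 by (simp add: h_def norm_mult)
  have int_norm: "(LINT \<theta>|lborel. norm (h j \<theta>)) = 2 * ?B * a j" for j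
    unfolding normh using d by simp
  have S: "(\<lambda>j. h j \<theta>) sums (indicator {- ?B..?B} \<theta> *\<^sub>R
      (of_real r * cis \<theta> * pgf_deriv q (of_real r * cis \<theta>) * cis (- (real k * \<theta>))))" for \<theta>
  proof -
    let ?z = "of_real r * cis \<theta> :: complex"
    have "norm ?z < 1" using r by (simp add: norm_mult)
    then have "(\<lambda>j. pmf q j *\<^sub>R (of_nat j * ?z ^ (j - 1))) sums pgf_deriv q ?z"
      unfolding pgf_deriv_def by (intro sums_pmf_expectation integrable_pgf_deriv)
    then have "(\<lambda>j. indicator {- ?B..?B} \<theta> *\<^sub>R (?z * (pmf q j *\<^sub>R (of_nat j * ?z ^ (j - 1))) * cis (- (real k * \<theta>)))) sums
      (indicator {- ?B..?B} \<theta> *\<^sub>R (?z * pgf_deriv q ?z * cis (- (real k * \<theta>))))"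
      by (intro sums_scaleR_right sums_mult2 sums_mult)
    moreover have "?z * (pmf q j *\<^sub>R (of_nat j * ?z ^ (j - 1))) * cis (- (real k * \<theta>)) = of_real (a j) * cis (of_int (int j - int k) * \<theta>)" for j
    proof -
      have "?z * (pmf q j *\<^sub>R (of_nat j * ?z ^ (j - 1))) = of_real (pmf q j * real j) * ?z ^ j"
        by (cases j) (auto simp: scaleR_conv_of_real)
      also have "?z ^ j = of_real (r ^ j) * cis (real j * \<theta>)" by (simp add: power_mult_distrib Complex.DeMoivre)
      finally have "?z * (pmf q j *\<^sub>R (of_nat j * ?z ^ (j - 1))) * cis (- (real k * \<theta>)) =
         of_real (a j) * (cis (real j * \<theta>) * cis (- (real k * \<theta>)))" by (simp add: a_def mult_ac)
      also have "cis (real j * \<theta>) * cis (- (real k * \<theta>)) = cis (of_int (int j - int k) * \<theta>)"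
        by (simp add: cis_mult algebra_simps)
      finally show ?thesis .
    qed
    ultimately show ?thesis unfolding h_def by (simp only:)
  qed
  have fun_eq: "(\<lambda>\<theta>. \<Sum>j. h j \<theta>) = (\<lambda>\<theta>. indicator {- ?B..?B} \<theta> *\<^sub>R
      (of_real r * cis \<theta> * pgf_deriv q (of_real r * cis \<theta>) * cis (- (real k * \<theta>))))"
    using S by (simp add: sums_iff)
  have AEs: "AE \<theta> in lborel. summable (\<lambda>j. norm (h j \<theta>))"
    unfolding normh using summ by (intro AE_I2 summable_mult)
  have sum2: "summable (\<lambda>j. LINT \<theta>|lborel. norm (h j \<theta>))"
    unfolding int_norm using summ by (rule summable_mult)
  show ?int using integrable_suminf[OF inth AEs sum2] unfolding fun_eq .
  have "(\<lambda>j. LINT \<theta>|lborel. h j \<theta>) sums (LINT \<theta>|lborel. (\<Sum>j. h j \<theta>))"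
    by (rule sums_integral[OF inth AEs sum2])
  moreover have "(LINT \<theta>|lborel. h j \<theta>) = (if j = k then of_real (2 * ?B * a k) else 0)" for j
  proof (cases "j \<in> set_pmf q")
    case False
    then have "a j = 0" by (simp add: a_def set_pmf_iff)
    then show ?thesis by (auto simp: h_def)
  next
    case True
    have "int d dvd (int j - int \<mu>) - (int k - int \<mu>)" using cong[OF True] k by (rule dvd_diff)
    then have dv: "int d dvd int j - int k" by simp
    have "(LINT \<theta>|lborel. h j \<theta>) = of_real (a j) * (LINT \<theta>|lborel. indicator {- ?B..?B} \<theta> *\<^sub>R cis (of_int (int j - int k) * \<theta>))"
      unfolding h_def integral_mult_right_zero[symmetric] by (intro Bochner_Integration.integral_cong) auto
    also have "\<dots> = of_real (a j) * (if int j - int k = 0 then of_real (2 * ?B) else 0)"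
      by (subst integral_cis[OF d dv]) (rule refl)
    finally show ?thesis by (auto simp: mult_ac)
  qed
  ultimately have "(\<lambda>j. if j = k then complex_of_real (2 * ?B * a k) else 0) sums (LINT \<theta>|lborel. (\<Sum>j. h j \<theta>))"
    by simp
  moreover have "(\<lambda>j. if j = k then complex_of_real (2 * ?B * a k) else 0) sums of_real (2 * ?B * a k)"
    by (rule sums_single)
  ultimately have "(LINT \<theta>|lborel. (\<Sum>j. h j \<theta>)) = of_real (2 * ?B * a k)" by (rule sums_unique2)
  then show ?eq unfolding fun_eq by (simp add: a_def mult_ac)
qed

context gw_lattice
begin

text \<open>The factor \<open>k\<close> replaces the generating function by its derivative, whose Fourier integral converges
  absolutely; the exponential tilt makes this possible without the condition \<open>E Z log Z < \<infinity>\<close>.\<close>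

definition tilted :: "nat \<Rightarrow> nat \<Rightarrow> nat \<Rightarrow> real" where
  "tilted N a k = real k * pmf (gw_law p (N + a) 1) k * exp (- (real k / c a))"

text \<open>The Fourier integral is cut at the angles \<open>B / c b\<close>. On the piece with
  \<open>l = a - b\<close> the integrand has order \<open>\<gamma> ^ N * \<kappa> ^ l * c b\<close>
  and the length has order \<open>1 / c (b - 1)\<close>, so the pieces sum geometrically. A
  difference of two characters costs a further \<open>(m powr \<sigma>) ^ l\<close>, which
  \<open>\<kappa> ^ l\<close> still absorbs.\<close>

lemma tilted_holder:
  obtains C \<sigma> where "0 < C" "0 < \<sigma>"
    "\<And>N a k. 1 \<le> a \<Longrightarrow> int d dvd int k - int \<mu> \<Longrightarrow> tilted N a k \<le> C * \<gamma> ^ N"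
    "\<And>N a k k'. 1 \<le> a \<Longrightarrow> int d dvd int k - int \<mu> \<Longrightarrow> int d dvd int k' - int \<mu> \<Longrightarrow>
       \<bar>tilted N a k - tilted N a k'\<bar> \<le> C * \<gamma> ^ N * (\<bar>real k - real k'\<bar> / c a) powr \<sigma>"
proof -
  obtain C1 \<kappa> where C1: "0 < C1" "0 < \<kappa>" "\<kappa> < 1"
    "\<And>N b l \<theta>. 1 \<le> b \<Longrightarrow> \<bar>\<theta>\<bar> * c (b - 1) \<le> B \<Longrightarrow> B \<le> \<bar>\<theta>\<bar> * c b \<or> l = 0 \<Longrightarrow>
      exp (- 1 / c (b + l)) * norm (gwf' p (N + l + b) (of_real (exp (- 1 / c (b + l))) * cis \<theta>))
        \<le> C1 * \<gamma> ^ N * \<kappa> ^ l * c b"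
    by (rule derivative_bound) blast
  \<comment> \<open>Half of the exponent at which \<open>\<kappa> * m powr \<sigma>\<close> would
    reach 1; the cap at 1 is for the interpolation.\<close>
  define \<sigma> where "\<sigma> = min 1 (- ln \<kappa> / (2 * ln m))"
  have \<sigma>: "0 < \<sigma>" "\<sigma> \<le> 1" using C1 m_gt_1 by (auto simp: \<sigma>_def divide_neg_pos)
  have "m powr \<sigma> \<le> m powr (- ln \<kappa> / (2 * ln m))" using m_gt_1 by (intro powr_mono) (auto simp: \<sigma>_def)
  also have "\<dots> = exp (- ln \<kappa> / 2)" using m_gt_1 by (simp add: powr_def)
  finally have "\<kappa> * m powr \<sigma> \<le> \<kappa> * exp (- ln \<kappa> / 2)" using C1 by (intro mult_left_mono) auto
  also have "\<dots> = exp (ln \<kappa>) * exp (- ln \<kappa> / 2)" using C1 by simp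
  also have "\<dots> = exp (ln \<kappa> / 2)" unfolding exp_add[symmetric] by simp
  also have "\<dots> < 1" using C1 by simp
  finally have \<kappa>\<sigma>: "\<kappa> * m powr \<sigma> < 1" .
  have \<kappa>\<sigma>0: "0 \<le> \<kappa> * m powr \<sigma>" using C1 by simp
  define x where "x = \<kappa> * m powr \<sigma>"
  have x: "0 \<le> x" "x < 1" using \<kappa>\<sigma> \<kappa>\<sigma>0 by (auto simp: x_def)

  \<comment> \<open>Each angle is assigned to the largest admissible \<open>b\<close>. Maximality
    supplies \<open>B \<le> \<bar>\<theta>\<bar> * c b\<close>, except possibly at
    \<open>b = a\<close>, where \<open>l = 0\<close>.\<close>
  have cover: "exp (- 1 / c a) * norm (gwf' p (N + a) (of_real (exp (- 1 / c a)) * cis \<theta>))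
      \<le> C1 * \<gamma> ^ N * \<kappa> ^ l * c (a - l) \<and> \<bar>\<theta>\<bar> \<le> B / c (a - l - 1) \<and> l < a"
    if "l = a - Max {b \<in> {1..a}. \<bar>\<theta>\<bar> * c (b - 1) \<le> B}" "1 \<le> a" "\<bar>\<theta>\<bar> \<le> B" for a N l \<theta>
  proof -
    let ?S = "{b \<in> {1..a}. \<bar>\<theta>\<bar> * c (b - 1) \<le> B}"
    define b where "b = Max ?S"
    have ne: "1 \<in> ?S" using that by auto
    have b: "b \<in> ?S" unfolding b_def by (rule Max_in) (simp, use ne in blast)
    have "B \<le> \<bar>\<theta>\<bar> * c b \<or> a - b = 0"
    proof (rule ccontr)
      assume *: "\<not> ?thesis"
      then have "Suc b \<in> ?S" using b by auto
      then have "Suc b \<le> b" unfolding b_def by (intro Max_ge) auto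
      then show False by simp
    qed
    then have "exp (- 1 / c (b + (a - b))) * norm (gwf' p (N + (a - b) + b) (of_real (exp (- 1 / c (b + (a - b)))) * cis \<theta>))
        \<le> C1 * \<gamma> ^ N * \<kappa> ^ (a - b) * c b"
      using b by (intro C1(4)) auto
    moreover have "a - l = b" "l = a - b" "N + (a - b) + b = N + a" "b + (a - b) = a" "l < a"
      using b unfolding that(1) b_def[symmetric] by auto
    moreover have "\<bar>\<theta>\<bar> \<le> B / c (b - 1)" using b by (simp add: field_simps)
    ultimately show ?thesis by simp
  qed

  \<comment> \<open>One estimate for an arbitrary multiplier \<open>D\<close>, applied to a single
    character and to a difference of two.\<close>
  have main: "norm (LINT \<theta>|lborel. indicator {- B..B} \<theta> *\<^sub>R
       (of_real r * cis \<theta> * gwf' p (N + a) (of_real r * cis \<theta>) * D \<theta>)) \<le> 2 * B * (C1 * m * \<gamma> ^ N * (\<Sum>l<a. \<kappa> ^ l * V l))"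
    if r: "r = exp (- 1 / c a)" and a: "1 \<le> a" and V: "\<And>l. 0 \<le> V l"
      and DV: "\<And>l \<theta>. l < a \<Longrightarrow> \<bar>\<theta>\<bar> \<le> B / c (a - l - 1) \<Longrightarrow> norm (D \<theta>) \<le> V l"
    for N a r and V :: "nat \<Rightarrow> real" and D :: "real \<Rightarrow> complex"
  proof -
    let ?f = "\<lambda>\<theta>. indicator {- B..B} \<theta> *\<^sub>R (of_real r * cis \<theta> * gwf' p (N + a) (of_real r * cis \<theta>) * D \<theta>)"
    define A where "A l = C1 * \<gamma> ^ N * \<kappa> ^ l * c (a - l)" for l
    define T where "T l = B / c (a - l - 1)" for l
    have T0: "0 \<le> T l" for l using B_pos by (simp add: T_def)
    have A0: "0 \<le> A l" for l using C1 \<gamma>_pos by (simp add: A_def)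
    \<comment> \<open>Nested intervals replace disjoint arcs: the term of the piece containing
      \<theta> already dominates, and overlaps only add nonnegative terms.\<close>
    define G where "G \<theta> = (\<Sum>l<a. A l * V l * indicator {- T l..T l} \<theta>)" for \<theta>
    have intG: "integrable lborel G" unfolding G_def
      by (intro Bochner_Integration.integrable_sum integrable_mult_right integrable_real_indicator) (auto simp: emeasure_lborel_Icc_eq)
    have pt: "norm (?f \<theta>) \<le> G \<theta>" for \<theta>
    proof (cases "\<bar>\<theta>\<bar> \<le> B")
      case True
      define l where "l = a - Max {b \<in> {1..a}. \<bar>\<theta>\<bar> * c (b - 1) \<le> B}"
      note cv = cover[OF l_def a True, of N]
      have "norm (?f \<theta>) = (r * norm (gwf' p (N + a) (of_real r * cis \<theta>))) * norm (D \<theta>)"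
        using True by (simp add: norm_mult r abs_le_iff indicator_def)
      also have "\<dots> \<le> A l * V l"
        using cv A0 DV[of l \<theta>] by (intro mult_mono) (auto simp: A_def r)
      also have "\<dots> = A l * V l * indicator {- T l..T l} \<theta>"
        using cv by (simp add: T_def abs_le_iff indicator_def)
      also have "\<dots> \<le> G \<theta>"
        unfolding G_def using cv A0 V
        by (intro member_le_sum[of l "{..<a}" "\<lambda>l. A l * V l * indicator {- T l..T l} \<theta>"]) auto
      finally show ?thesis .
    next
      case False
      then have "?f \<theta> = 0" by (auto simp: indicator_def)
      then show ?thesis using A0 V by (auto simp: G_def intro!: sum_nonneg)
    qed
    have "norm (integral\<^sup>L lborel ?f) \<le> integral\<^sup>L lborel G"
    proof (cases "integrable lborel ?f")
      case True
      have "norm (integral\<^sup>L lborel ?f) \<le> (LINT \<theta>|lborel. norm (?f \<theta>))" by (rule integral_norm_bound)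
      also have "\<dots> \<le> integral\<^sup>L lborel G" using True intG pt by (intro integral_mono integrable_norm)
      finally show ?thesis .
    next
      \<comment> \<open>A non-integrable integrand has integral 0 by convention.\<close>
      case False
      have "0 \<le> G \<theta>" for \<theta> using pt[of \<theta>] norm_ge_zero order_trans by blast
      then have "0 \<le> integral\<^sup>L lborel G" by (intro integral_nonneg_AE) auto
      then show ?thesis using False by (simp add: not_integrable_integral_eq)
    qed
    also have "\<dots> = (\<Sum>l<a. A l * V l * (2 * T l))"
      unfolding G_def using T0
      by (subst Bochner_Integration.integral_sum)
         (auto intro!: integrable_mult_right integrable_real_indicator simp: emeasure_lborel_Icc_eq)
    also have "\<dots> \<le> (\<Sum>l<a. 2 * B * (C1 * m * \<gamma> ^ N * (\<kappa> ^ l * V l)))"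
    proof (rule sum_mono)
      fix l assume "l \<in> {..<a}"
      then have "c (a - l) \<le> m * c (a - l - 1)" using c_Suc_le[of "a - l - 1"] by (simp add: Suc_diff_Suc)
      then have "c (a - l) / c (a - l - 1) \<le> m" by (simp add: field_simps)
      then have "(2 * B * (C1 * \<gamma> ^ N * (\<kappa> ^ l * V l))) * (c (a - l) / c (a - l - 1)) \<le> (2 * B * (C1 * \<gamma> ^ N * (\<kappa> ^ l * V l))) * m"
        using B_pos C1 \<gamma>_pos V by (intro mult_left_mono) auto
      then show "A l * V l * (2 * T l) \<le> 2 * B * (C1 * m * \<gamma> ^ N * (\<kappa> ^ l * V l))"
        by (simp add: A_def T_def mult_ac)
    qed
    also have "\<dots> = 2 * B * (C1 * m * \<gamma> ^ N * (\<Sum>l<a. \<kappa> ^ l * V l))"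
      by (simp add: sum_distrib_left)
    finally show ?thesis .
  qed

  have coef: "integrable lborel (\<lambda>\<theta>. indicator {- B..B} \<theta> *\<^sub>R
       (of_real r * cis \<theta> * gwf' p (N + a) (of_real r * cis \<theta>) * cis (- (real k * \<theta>))))"
     "(LINT \<theta>|lborel. indicator {- B..B} \<theta> *\<^sub>R
       (of_real r * cis \<theta> * gwf' p (N + a) (of_real r * cis \<theta>) * cis (- (real k * \<theta>)))) = complex_of_real (2 * B * tilted N a k)"
    if r: "r = exp (- 1 / c a)" and a: "1 \<le> a" and k: "int d dvd int k - int \<mu>" for r N a k
  proof -
    have r1: "0 < r" "r < 1" by (auto simp: r)
    have cong: "\<And>k. k \<in> set_pmf (gw_law p (N + a) 1) \<Longrightarrow> int d dvd int k - int \<mu>"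
      by (rule gw_law_cong[of "N + a"]) (use a in auto)
    have d0: "0 < d" using d_ge_1 by simp
    have "r ^ k = exp (- (real k / c a))" by (simp add: r exp_of_nat_mult[symmetric])
    then have "2 * B * (real k * pmf (gw_law p (N + a) 1) k * r ^ k) = 2 * B * tilted N a k"
      by (simp add: tilted_def)
    with coefficient_integral[OF d0 cong k r1]
    show "integrable lborel (\<lambda>\<theta>. indicator {- B..B} \<theta> *\<^sub>R
       (of_real r * cis \<theta> * gwf' p (N + a) (of_real r * cis \<theta>) * cis (- (real k * \<theta>))))"
     "(LINT \<theta>|lborel. indicator {- B..B} \<theta> *\<^sub>R
       (of_real r * cis \<theta> * gwf' p (N + a) (of_real r * cis \<theta>) * cis (- (real k * \<theta>)))) = complex_of_real (2 * B * tilted N a k)"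
      unfolding B_def[symmetric] gwf'_def by (simp_all only:)
  qed

  have tilted0: "0 \<le> tilted N a k" for N a k by (simp add: tilted_def)
  define Ca where "Ca = C1 * m / (1 - \<kappa>)"
  define Cb where "Cb = 2 * C1 * m * (B * m) powr \<sigma> / (1 - x)"
  have Cab: "0 < Ca" "0 < Cb" using C1 m_pos B_pos x by (auto simp: Ca_def Cb_def)

  have bd1: "tilted N a k \<le> Ca * \<gamma> ^ N" if "1 \<le> a" "int d dvd int k - int \<mu>" for N a k
  proof -
    have "2 * B * tilted N a k = norm (complex_of_real (2 * B * tilted N a k))"
      using tilted0 B_pos by (simp add: norm_mult)
    also have "\<dots> \<le> 2 * B * (C1 * m * \<gamma> ^ N * (\<Sum>l<a. \<kappa> ^ l * 1))"
      unfolding coef(2)[OF refl that, symmetric] by (rule main[OF refl that(1)]) auto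
    finally have "tilted N a k \<le> C1 * m * \<gamma> ^ N * (\<Sum>l<a. \<kappa> ^ l)" using B_pos by simp
    also have "\<dots> \<le> C1 * m * \<gamma> ^ N * (1 / (1 - \<kappa>))"
      using C1 m_pos \<gamma>_pos by (intro mult_left_mono geometric_sum_le) auto
    finally show ?thesis by (simp add: Ca_def mult_ac)
  qed

  have bd2: "\<bar>tilted N a k - tilted N a k'\<bar> \<le> Cb * \<gamma> ^ N * (\<bar>real k - real k'\<bar> / c a) powr \<sigma>"
    if a: "1 \<le> a" and k: "int d dvd int k - int \<mu>" and k': "int d dvd int k' - int \<mu>" for N a k k'
  proof -
    define r where "r = exp (- 1 / c a)"
    define y where "y = (\<bar>real k - real k'\<bar> / c a) powr \<sigma>"
    \<comment> \<open>The \<open>l\<close>-th piece reaches angles of order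
      \<open>m ^ l / c a\<close>, which the interpolated bound turns into a power of
      \<open>m powr \<sigma>\<close>.\<close>
    define V where "V l = 2 * y * (B * m) powr \<sigma> * (m powr \<sigma>) ^ l" for l :: nat
    define D where "D \<theta> = cis (- (real k * \<theta>)) - cis (- (real k' * \<theta>))" for \<theta>
    have "complex_of_real (2 * B * tilted N a k) - complex_of_real (2 * B * tilted N a k') =
       (LINT \<theta>|lborel. indicator {- B..B} \<theta> *\<^sub>R
       (of_real r * cis \<theta> * gwf' p (N + a) (of_real r * cis \<theta>) * D \<theta>))"
      unfolding coef(2)[OF r_def a k, symmetric] coef(2)[OF r_def a k', symmetric]
      unfolding Bochner_Integration.integral_diff[OF coef(1)[OF r_def a k] coef(1)[OF r_def a k'], symmetric]
      by (intro Bochner_Integration.integral_cong) (auto simp: D_def algebra_simps)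
    also have "norm \<dots> \<le> 2 * B * (C1 * m * \<gamma> ^ N * (\<Sum>l<a. \<kappa> ^ l * V l))"
    proof (rule main[OF r_def a])
      show "0 \<le> V l" for l by (simp add: V_def y_def)
      fix l \<theta> assume l: "l < a" and \<theta>: "\<bar>\<theta>\<bar> \<le> B / c (a - l - 1)"
      define e where "e = \<bar>real k - real k'\<bar> * (B / c (a - l - 1))"
      have e0: "0 \<le> e" using B_pos by (simp add: e_def)
      have "norm (D \<theta>) \<le> 2 * e powr \<sigma>"
      proof (rule min_2_le_powr)
        show "norm (D \<theta>) \<le> 2" unfolding D_def using norm_triangle_ineq4[of "cis (- (real k * \<theta>))" "cis (- (real k' * \<theta>))"] by simp
        have "norm (D \<theta>) \<le> \<bar>(- (real k * \<theta>)) - (- (real k' * \<theta>))\<bar>" unfolding D_def by (rule norm_cis_diff_le)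
        also have "\<dots> = \<bar>(real k' - real k) * \<theta>\<bar>" by (simp add: algebra_simps)
        also have "\<dots> \<le> e" unfolding e_def abs_mult using \<theta> by (intro mult_mono) auto
        finally show "norm (D \<theta>) \<le> e" .
      qed (use e0 \<sigma> in auto)
      also have "2 * e powr \<sigma> \<le> V l"
      proof -
        have "c a \<le> m ^ Suc l * c (a - l - 1)" using c_add_le[of "a - l - 1" "Suc l"] l by simp
        then have "B / c (a - l - 1) \<le> B * m ^ Suc l / c a" using B_pos by (simp add: field_simps)
        then have "e \<le> \<bar>real k - real k'\<bar> * (B * m ^ Suc l / c a)" unfolding e_def by (intro mult_left_mono) auto
        also have "\<dots> = (\<bar>real k - real k'\<bar> / c a) * (B * m) * m ^ l" by simp
        finally have "e powr \<sigma> \<le> ((\<bar>real k - real k'\<bar> / c a) * (B * m) * m ^ l) powr \<sigma>"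
          using e0 \<sigma> by (intro powr_mono2) auto
        also have "\<dots> = y * (B * m) powr \<sigma> * (m ^ l) powr \<sigma>"
          unfolding y_def powr_mult[of "(\<bar>real k - real k'\<bar> / c a) * (B * m)"] powr_mult[of "\<bar>real k - real k'\<bar> / c a"] ..
        also have "(m ^ l) powr \<sigma> = (m powr \<sigma>) ^ l"
          using m_pos by (simp add: powr_powr mult.commute flip: powr_realpow)
        finally show ?thesis by (simp add: V_def)
      qed
      finally show "norm (D \<theta>) \<le> V l" .
    qed
    finally have "norm (complex_of_real (2 * B * (tilted N a k - tilted N a k'))) \<le> 2 * B * (C1 * m * \<gamma> ^ N * (\<Sum>l<a. \<kappa> ^ l * V l))"
      by (simp add: right_diff_distrib)
    then have "2 * B * \<bar>tilted N a k - tilted N a k'\<bar> \<le> 2 * B * (C1 * m * \<gamma> ^ N * (\<Sum>l<a. \<kappa> ^ l * V l))"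
      unfolding norm_of_real abs_mult using B_pos by simp
    then have "\<bar>tilted N a k - tilted N a k'\<bar> \<le> C1 * m * \<gamma> ^ N * (\<Sum>l<a. \<kappa> ^ l * V l)" using B_pos by simp
    also have "(\<Sum>l<a. \<kappa> ^ l * V l) = 2 * y * (B * m) powr \<sigma> * (\<Sum>l<a. x ^ l)"
      by (simp add: V_def x_def power_mult_distrib sum_distrib_left mult_ac)
    also have "C1 * m * \<gamma> ^ N * (2 * y * (B * m) powr \<sigma> * (\<Sum>l<a. x ^ l)) \<le> C1 * m * \<gamma> ^ N * (2 * y * (B * m) powr \<sigma> * (1 / (1 - x)))"
      using C1 m_pos \<gamma>_pos x by (intro mult_left_mono geometric_sum_le) (auto simp: y_def)
    finally show ?thesis by (simp add: Cb_def y_def mult_ac)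
  qed

  show thesis
  proof (rule that[of "Ca + Cb" \<sigma>])
    fix N a k :: nat assume *: "1 \<le> a" "int d dvd int k - int \<mu>"
    have "tilted N a k \<le> Ca * \<gamma> ^ N" using * by (rule bd1)
    also have "\<dots> \<le> (Ca + Cb) * \<gamma> ^ N" using Cab \<gamma>_pos by (intro mult_right_mono) auto
    finally show "tilted N a k \<le> (Ca + Cb) * \<gamma> ^ N" .
  next
    fix N a k k' :: nat assume *: "1 \<le> a" "int d dvd int k - int \<mu>" "int d dvd int k' - int \<mu>"
    have "\<bar>tilted N a k - tilted N a k'\<bar> \<le> Cb * \<gamma> ^ N * (\<bar>real k - real k'\<bar> / c a) powr \<sigma>" using * by (rule bd2)
    also have "\<dots> \<le> (Ca + Cb) * \<gamma> ^ N * (\<bar>real k - real k'\<bar> / c a) powr \<sigma>"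
      using Cab \<gamma>_pos by (intro mult_right_mono) auto
    finally show "\<bar>tilted N a k - tilted N a k'\<bar> \<le> (Ca + Cb) * \<gamma> ^ N * (\<bar>real k - real k'\<bar> / c a) powr \<sigma>" .
  qed (use Cab \<sigma> in auto)
qed

end

section \<open>The integral limit theorem\<close>

lemma conv_pmf_alt: "conv_pmf q r = bind_pmf q (\<lambda>x. bind_pmf r (\<lambda>y. return_pmf (x + y)))"
  by (simp add: conv_pmf_def map_pmf_def)

lemma conv_pmf_assoc: "conv_pmf (conv_pmf q r) s = conv_pmf q (conv_pmf r s)"
  by (simp add: conv_pmf_alt bind_assoc_pmf bind_return_pmf add.assoc)

lemma conv_pmf_0 [simp]: "conv_pmf q (return_pmf 0) = q" "conv_pmf (return_pmf 0) q = q"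
  by (simp_all add: conv_pmf_alt bind_return_pmf bind_return_pmf')

lemma offspring_sum_add: "offspring_sum p (i + j) = conv_pmf (offspring_sum p i) (offspring_sum p j)"
  by (induction j) (simp_all add: conv_pmf_assoc)

lemma gw_law_add: "gw_law p n (i + j) = conv_pmf (gw_law p n i) (gw_law p n j)"
proof (induction n)
  case 0
  then show ?case by (simp add: conv_pmf_alt bind_return_pmf)
next
  case (Suc n)
  have "gw_law p (Suc n) (i + j) =
    bind_pmf (gw_law p n i) (\<lambda>x. bind_pmf (gw_law p n j) (\<lambda>y. bind_pmf (offspring_sum p x) (\<lambda>u. bind_pmf (offspring_sum p y) (\<lambda>v. return_pmf (u + v)))))"
    by (simp add: Suc conv_pmf_alt bind_assoc_pmf bind_return_pmf offspring_sum_add)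
  also have "\<dots> = conv_pmf (gw_law p (Suc n) i) (gw_law p (Suc n) j)"
    by (simp add: conv_pmf_alt bind_assoc_pmf bind_commute_pmf[of "gw_law p n j" "offspring_sum p _"])
  finally show ?case .
qed

text \<open>Keeps only the outcomes in which one summand vanishes; \<open>0 \<notin> J\<close> makes
  the two cases disjoint.\<close>

lemma measure_conv_pmf_ge:
  assumes "0 \<notin> J"
  shows "measure (conv_pmf q r) J \<ge> pmf q 0 * measure r J + measure q J * pmf r 0"
proof -
  have "measure (conv_pmf q r) J = measure_pmf.expectation (conv_pmf q r) (indicator J)" by simp
  also have "\<dots> = measure_pmf.expectation q (\<lambda>x. measure_pmf.expectation (map_pmf ((+) x) r) (indicator J))"
    unfolding conv_pmf_def by (rule pmf_expectation_bind[where C=1]) (auto simp: indicator_def)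
  also have "\<dots> = measure_pmf.expectation q (\<lambda>x. measure r ((+) x -` J))"
    by simp
  also have "\<dots> \<ge> measure_pmf.expectation q (\<lambda>x. indicator {0} x * measure r J + indicator J x * pmf r 0)"
  proof (rule integral_mono)
    fix x
    have "pmf r 0 \<le> measure r ((+) x -` J)" if "x \<in> J"
      using that unfolding pmf.rep_eq by (intro measure_pmf.finite_measure_mono) auto
    moreover have "measure r ((+) 0 -` J) = measure r J" by (rule arg_cong[where f="measure r"]) auto
    ultimately show "indicator {0} x * measure r J + indicator J x * pmf r 0 \<le> measure r ((+) x -` J)"
      using assms by (auto simp: indicator_def)
  next
    show "integrable (measure_pmf q) (\<lambda>x. indicator {0} x * measure r J + indicator J x * pmf r 0)"
      by (intro Bochner_Integration.integrable_add integrable_mult_left integrable_pmf_bounded[where C=1])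
         (auto simp: indicator_def)
    show "integrable (measure_pmf q) (\<lambda>x. measure r ((+) x -` J))"
      by (rule integrable_pmf_bounded[where C=1]) simp
  qed
  also have "measure_pmf.expectation q (\<lambda>x. indicator {0} x * measure r J + indicator J x * pmf r 0) =
      pmf q 0 * measure r J + measure q J * pmf r 0"
    by (subst Bochner_Integration.integral_add)
       (auto simp: pmf.rep_eq intro!: integrable_pmf_bounded[where C=1] split: split_indicator)
  finally show ?thesis .
qed

text \<open>Counts the outcomes in which exactly one of the \<open>j\<close> families is alive after
  \<open>a\<close> generations and lands in \<open>J\<close>; each of the others has died with
  probability \<open>gwf p a 0\<close>.\<close>

lemma gw_law_ge_single_family:
  assumes "0 \<notin> J"
  shows "measure (gw_law p a j) J \<ge> real j * gwf p a 0 ^ (j - 1) * measure (gw_law p a 1) J"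
proof (induction j)
  case (Suc j)
  let ?h = "measure (gw_law p a 1) J" and ?q = "gwf p a (0::real)"
  have q0: "0 \<le> ?q" by (simp add: gwf_def pgf_nonneg)
  have pmf0: "pmf (gw_law p a j) 0 = ?q ^ j" for j
    using pgf_gw_law[of 0 p a j] by (simp add: pgf_0)
  have "real (Suc j) * ?q ^ (Suc j - 1) * ?h = ?q ^ j * ?h + (real j * ?q ^ (j - 1) * ?h) * ?q"
    by (cases j) (simp_all add: algebra_simps)
  also have "\<dots> \<le> ?q ^ j * ?h + measure (gw_law p a j) J * ?q"
    using Suc q0 by (intro add_left_mono mult_right_mono)
  also have "\<dots> \<le> measure (conv_pmf (gw_law p a j) (gw_law p a 1)) J"
    using measure_conv_pmf_ge[OF assms, of "gw_law p a j" "gw_law p a 1"] pmf0[of j] pmf0[of 1] by simp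
  also have "conv_pmf (gw_law p a j) (gw_law p a 1) = gw_law p a (Suc j)"
    using gw_law_add[of p a j 1] by simp
  finally show ?case .
qed simp

lemma subset_Un_if_eq_off: "(\<And>x. x \<notin> U \<Longrightarrow> x \<in> A \<longleftrightarrow> x \<in> A') \<Longrightarrow> A \<subseteq> A' \<union> U"
  by blast

lemma (in gw_process) gw_law_split_sums:
  "(\<lambda>j. pmf (gw_law p N 1) j * measure (gw_law p a j) A) sums measure (gw_law p (N + a) 1) A"
proof -
  have "(\<lambda>j. prob {\<omega> \<in> space M. Z (N + a) \<omega> \<in> A \<and> Z N \<omega> = j}) sums prob {\<omega> \<in> space M. Z (N + a) \<omega> \<in> A}"
    by (rule prob_sums) measurable
  moreover have "prob {\<omega> \<in> space M. Z (N + a) \<omega> \<in> A \<and> Z N \<omega> = j} = pmf (gw_law p N 1) j * measure (gw_law p a j) A" for j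
    using prob_joint[of N j a A] by (simp add: prob_Z_eq conj_commute)
  ultimately show ?thesis by (simp add: prob_Z_in)
qed

text \<open>Averaged over \<open>j\<close>, the coefficients \<open>j * q ^ (j - 1)\<close> with
  \<open>q = gwf p a 0\<close> reassemble into the derivative of the generating function at
  \<open>q\<close>. This is the source of all lower bounds of order
  \<open>\<gamma> ^ N\<close>.\<close>

lemma (in gw_process) gw_law_split_ge:
  assumes "0 \<notin> J" "gwf p a 0 < (1::real)"
  shows "measure (gw_law p (N + a) 1) J \<ge> gwf' p N (gwf p a 0) * measure (gw_law p a 1) J"
proof (rule sums_le[OF _ _ gw_law_split_sums])
  have q0: "0 \<le> gwf p a (0::real)" by (simp add: gwf_def pgf_nonneg)
  have "(\<lambda>j. pmf (gw_law p N 1) j *\<^sub>R (of_nat j * gwf p a 0 ^ (j - 1))) sums gwf' p N (gwf p a (0::real))"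
    unfolding gwf'_def pgf_deriv_def
    by (intro sums_pmf_expectation integrable_pgf_deriv) (use q0 assms in auto)
  from sums_mult2[OF this]
  show "(\<lambda>j. pmf (gw_law p N 1) j *\<^sub>R (of_nat j * gwf p a 0 ^ (j - 1)) * measure (gw_law p a 1) J) sums
      (gwf' p N (gwf p a 0) * measure (gw_law p a 1) J)" .
  fix j
  show "pmf (gw_law p N 1) j *\<^sub>R (of_nat j * gwf p a 0 ^ (j - 1)) * measure (gw_law p a 1) J
      \<le> pmf (gw_law p N 1) j * measure (gw_law p a j) J"
    using mult_left_mono[OF gw_law_ge_single_family[OF assms(1), of j p a], of "pmf (gw_law p N 1) j"]
    by (simp add: mult_ac)
qed

context gw_lattice
begin

lemma prob_scaled_difference:
  assumes "0 < \<delta>"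
  shows "(\<lambda>a. prob {\<omega> \<in> space M. \<delta> < \<bar>real (Z (N + a) \<omega>) / c a - m ^ N * W \<omega>\<bar>}) \<longlonglongrightarrow> 0"
proof -
  let ?A = "\<lambda>a. {\<omega> \<in> space M. \<delta> < \<bar>real (Z (N + a) \<omega>) / c a - m ^ N * W \<omega>\<bar>}"
  have "(\<lambda>a. expectation (\<lambda>\<omega>. indicator (?A a) \<omega> :: real)) \<longlonglongrightarrow> expectation (\<lambda>_. 0)"
  proof (rule integral_dominated_convergence[where w="\<lambda>_. 1"])
    show "AE \<omega> in M. (\<lambda>a. indicator (?A a) \<omega> :: real) \<longlonglongrightarrow> 0"
      using W_lim_shift[of N]
    proof eventually_elim
      fix \<omega> assume "(\<lambda>a. real (Z (N + a) \<omega>) / c a) \<longlonglongrightarrow> m ^ N * W \<omega>"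
      from tendstoD[OF this assms] show "(\<lambda>a. indicator (?A a) \<omega> :: real) \<longlonglongrightarrow> 0"
        by (intro tendsto_eventually) (auto elim!: eventually_mono simp: dist_real_def indicator_def)
    qed
  qed (auto simp: indicator_def)
  then show ?thesis by simp
qed

text \<open>Up to null sets extinction implies \<open>W = 0\<close>, so the only possible mismatch
  is survival with \<open>W = 0\<close>.\<close>

lemma prob_survival_mismatch:
  "(\<lambda>a. prob {\<omega> \<in> space M. (0 < Z (N + a) \<omega>) \<noteq> (0 < W \<omega>)}) \<longlonglongrightarrow> 0"
proof -
  have "prob {\<omega> \<in> space M. (0 < Z n \<omega>) \<noteq> (0 < W \<omega>)} = prob {\<omega> \<in> space M. Z n \<omega> > 0 \<and> W \<omega> = 0}" for n
  proof (rule finite_measure_eq_AE)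
    show "AE \<omega> in M. (\<omega> \<in> {\<omega> \<in> space M. (0 < Z n \<omega>) \<noteq> (0 < W \<omega>)}) = (\<omega> \<in> {\<omega> \<in> space M. Z n \<omega> > 0 \<and> W \<omega> = 0})"
      using AE_W_eq_0_if_extinct W_nonneg by eventually_elim force
  qed measurable
  moreover have "(\<lambda>a. prob {\<omega> \<in> space M. Z (a + N) \<omega> > 0 \<and> W \<omega> = 0}) \<longlonglongrightarrow> 0"
    using prob_survive_W_0 by (rule LIMSEQ_ignore_initial_segment)
  ultimately show ?thesis by (simp add: add.commute)
qed

text \<open>The two events agree off three exceptional sets: the survival mismatch, a deviation from
  the limit by more than \<delta>, and \<open>m ^ N * W\<close> within \<delta> of \<open>y\<close>.
  None of them involves \<open>P\<close>, whence uniformity over side conditions such as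
  \<open>Z N = j\<close>.\<close>

lemma event_convergence_uniform:
  assumes "0 < y1" "y1 \<le> y2" "0 < \<epsilon>"
  obtains a0 where "\<And>a y P. a \<ge> a0 \<Longrightarrow> y1 \<le> y \<Longrightarrow> y \<le> y2 \<Longrightarrow> Measurable.pred M P \<Longrightarrow>
    \<bar>prob {\<omega> \<in> space M. P \<omega> \<and> 0 < Z (N + a) \<omega> \<and> real (Z (N + a) \<omega>) \<le> y * c a} -
     prob {\<omega> \<in> space M. P \<omega> \<and> 0 < W \<omega> \<and> m ^ N * W \<omega> \<le> y}\<bar> \<le> \<epsilon>"
proof -
  have mN: "0 < m ^ N" using m_pos by simp
  have "0 < y1 / 2 / m ^ N" "y1 / 2 / m ^ N \<le> (2 * y2) / m ^ N" using assms mN by (auto simp: field_simps)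
  then obtain C1 C where C: "0 < C" "\<And>t. y1 / 2 / m ^ N \<le> t \<Longrightarrow> t \<le> (2 * y2) / m ^ N \<Longrightarrow> C1 \<le> w t \<and> w t \<le> C"
    by (rule w_bounds) blast
  \<comment> \<open>The first bound keeps the window around \<open>y\<close> inside the range where
    \<open>w \<le> C\<close>; the second gives that window mass at most
    \<open>\<epsilon> / 3\<close>.\<close>
  define \<delta> where "\<delta> = min (y1 / 2) (\<epsilon> * m ^ N / (6 * C))"
  have \<delta>: "0 < \<delta>" "\<delta> \<le> y1 / 2" "C * (2 * \<delta> / m ^ N) \<le> \<epsilon> / 3"
  proof -
    show "0 < \<delta>" "\<delta> \<le> y1 / 2" using assms C mN by (auto simp: \<delta>_def)
    have "\<delta> \<le> \<epsilon> * m ^ N / (6 * C)" by (simp add: \<delta>_def)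
    then show "C * (2 * \<delta> / m ^ N) \<le> \<epsilon> / 3" using C mN by (simp add: field_simps)
  qed
  let ?N0 = "\<lambda>a. {\<omega> \<in> space M. (0 < Z (N + a) \<omega>) \<noteq> (0 < W \<omega>)}"
  let ?D = "\<lambda>a. {\<omega> \<in> space M. \<delta> < \<bar>real (Z (N + a) \<omega>) / c a - m ^ N * W \<omega>\<bar>}"
  let ?S = "\<lambda>y. {\<omega> \<in> space M. (y - \<delta>) / m ^ N \<le> W \<omega> \<and> W \<omega> \<le> (y + \<delta>) / m ^ N}"
  have "\<forall>\<^sub>F a in sequentially. prob (?N0 a) < \<epsilon> / 3 \<and> prob (?D a) < \<epsilon> / 3"
    using assms by (intro eventually_conj order_tendstoD(2)[OF prob_survival_mismatch] order_tendstoD(2)[OF prob_scaled_difference[OF \<delta>(1)]]) auto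
  then obtain a0 where a0: "\<And>a. a \<ge> a0 \<Longrightarrow> prob (?N0 a) < \<epsilon> / 3 \<and> prob (?D a) < \<epsilon> / 3"
    by (auto simp: eventually_sequentially)
  show thesis
  proof (rule that[of a0])
    fix a y P assume a: "a \<ge> a0" and y: "y1 \<le> y" "y \<le> y2" and [measurable]: "Measurable.pred M P"
    let ?A = "{\<omega> \<in> space M. P \<omega> \<and> 0 < Z (N + a) \<omega> \<and> real (Z (N + a) \<omega>) \<le> y * c a}"
    let ?A' = "{\<omega> \<in> space M. P \<omega> \<and> 0 < W \<omega> \<and> m ^ N * W \<omega> \<le> y}"
    let ?U = "?N0 a \<union> ?D a \<union> ?S y"
    have S: "prob (?S y) \<le> \<epsilon> / 3"
    proof -
      have "prob (?S y) \<le> C * ((y + \<delta>) / m ^ N - (y - \<delta>) / m ^ N)"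
      proof (rule prob_W)
        show "0 < (y - \<delta>) / m ^ N" "(y - \<delta>) / m ^ N \<le> (y + \<delta>) / m ^ N"
          using y \<delta> assms mN by (auto simp: field_simps)
        fix t assume t: "(y - \<delta>) / m ^ N \<le> t" "t \<le> (y + \<delta>) / m ^ N"
        have "y1 / 2 / m ^ N \<le> (y - \<delta>) / m ^ N" "(y + \<delta>) / m ^ N \<le> 2 * y2 / m ^ N"
          using y \<delta> assms mN by (intro divide_right_mono; linarith)+
        with t show "w t \<le> C" using C(2)[of t] by linarith
      qed
      also have "(y + \<delta>) / m ^ N - (y - \<delta>) / m ^ N = 2 * \<delta> / m ^ N" by (simp add: diff_divide_distrib[symmetric])
      finally show ?thesis using \<delta>(3) by linarith
    qed
    have U: "prob ?U \<le> \<epsilon>"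
    proof -
      have "prob ?U \<le> prob (?N0 a \<union> ?D a) + prob (?S y)" by (rule measure_Un_le) measurable
      also have "prob (?N0 a \<union> ?D a) \<le> prob (?N0 a) + prob (?D a)" by (rule measure_Un_le) measurable
      finally show ?thesis using S a0[OF a] by linarith
    qed
    have same: "\<omega> \<in> ?A \<longleftrightarrow> \<omega> \<in> ?A'" if "\<omega> \<notin> ?U" for \<omega>
    proof (cases "\<omega> \<in> space M")
      case True
      have 1: "(0 < Z (N + a) \<omega>) = (0 < W \<omega>)" "\<bar>real (Z (N + a) \<omega>) / c a - m ^ N * W \<omega>\<bar> \<le> \<delta>"
         "W \<omega> < (y - \<delta>) / m ^ N \<or> (y + \<delta>) / m ^ N < W \<omega>"
        using that True by auto
      have 2: "m ^ N * W \<omega> < y - \<delta> \<or> y + \<delta> < m ^ N * W \<omega>" using 1(3) mN by (simp add: field_simps)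
      have 3: "real (Z (N + a) \<omega>) \<le> y * c a \<longleftrightarrow> real (Z (N + a) \<omega>) / c a \<le> y" by (simp add: field_simps)
      have "real (Z (N + a) \<omega>) / c a \<le> y \<longleftrightarrow> m ^ N * W \<omega> \<le> y"
        using 1(2) 2 \<delta>(1) by linarith
      with 1(1) 3 show ?thesis by auto
    qed auto
    have "prob ?A \<le> prob (?A' \<union> ?U)"
      by (rule finite_measure_mono[OF subset_Un_if_eq_off[OF same]]) measurable
    also have "\<dots> \<le> prob ?A' + prob ?U" by (rule measure_Un_le) measurable
    finally have up: "prob ?A \<le> prob ?A' + prob ?U" .
    have "prob ?A' \<le> prob (?A \<union> ?U)"
      by (rule finite_measure_mono[OF subset_Un_if_eq_off[OF same[symmetric]]]) measurable
    also have "\<dots> \<le> prob ?A + prob ?U" by (rule measure_Un_le) measurable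
    finally show "\<bar>prob ?A - prob ?A'\<bar> \<le> \<epsilon>" using up U by linarith
  qed
qed

section \<open>Families with a fixed number of ancestors\<close>

definition law_cdf :: "nat \<Rightarrow> nat \<Rightarrow> real \<Rightarrow> real" where
  "law_cdf a j y = measure (gw_law p a j) {k. 0 < k \<and> real k \<le> y * c a}"

lemma law_cdf_0: "law_cdf a 0 y = 0"
proof -
  have "pmf (gw_law p a 0) 0 = 1" using pgf_gw_law[of 0 p a 0] by (simp add: pgf_0)
  then have "measure (gw_law p a 0) {0} = 1" by (simp add: pmf.rep_eq)
  then have "measure (gw_law p a 0) (- {0}) = 0"
    using measure_pmf.prob_compl[of "{0}" "gw_law p a 0"] by (simp add: Compl_eq_Diff_UNIV)
  moreover have "law_cdf a 0 y \<le> measure (gw_law p a 0) (- {0})"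
    unfolding law_cdf_def by (intro measure_pmf.finite_measure_mono) auto
  ultimately show ?thesis by (simp add: law_cdf_def measure_le_0_iff)
qed

text \<open>Exponential Chebyshev bound with tilt \<open>1 / c a\<close>; independence of the
  families turns it into geometric decay in \<open>j\<close>.\<close>

lemma law_cdf_le:
  assumes "gwf p a (exp (- 1 / c a)) \<le> \<rho>"
  shows "law_cdf a j y \<le> exp y * \<rho> ^ j"
proof -
  let ?r = "exp (- 1 / c a)"
  have "law_cdf a j y = measure_pmf.expectation (gw_law p a j) (indicator {k. 0 < k \<and> real k \<le> y * c a})"
    by (simp add: law_cdf_def)
  also have "\<dots> \<le> measure_pmf.expectation (gw_law p a j) (\<lambda>k. exp y * ?r ^ k)"
  proof (intro integral_mono integrable_mult_right integrable_pgf)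
    fix k
    have "?r ^ k = exp (- (real k / c a))" by (simp add: exp_of_nat_mult[symmetric])
    then have "exp y * ?r ^ k = exp (y - real k / c a)" by (simp add: exp_add[symmetric])
    moreover have "1 \<le> exp (y - real k / c a)" if "real k \<le> y * c a" using that by (simp add: field_simps)
    ultimately show "indicator {k. 0 < k \<and> real k \<le> y * c a} k \<le> exp y * ?r ^ k"
      by (auto simp: indicator_def)
  qed (auto intro!: integrable_pmf_bounded[where C=1] simp: indicator_def)
  also have "\<dots> = exp y * pgf (gw_law p a j) ?r" by (simp add: pgf_def)
  also have "\<dots> = exp y * gwf p a ?r ^ j" by (simp add: pgf_gw_law)
  also have "\<dots> \<le> exp y * \<rho> ^ j"
    using assms by (intro mult_left_mono power_mono) (auto simp: gwf_def intro: pgf_nonneg)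
  finally show ?thesis .
qed

lemma prob_law_cdf:
  "prob {\<omega> \<in> space M. Z N \<omega> = j \<and> 0 < Z (N + a) \<omega> \<and> real (Z (N + a) \<omega>) \<le> y * c a} = pmf (gw_law p N 1) j * law_cdf a j y"
  using prob_joint[of N j a "{k. 0 < k \<and> real k \<le> y * c a}"] by (simp add: law_cdf_def prob_Z_eq)

text \<open>The limit exists for every \<open>j\<close> that some generation attains with positive probability; for other \<open>j\<close>
  the value is arbitrary.\<close>

definition law_cdf_lim :: "nat \<Rightarrow> real \<Rightarrow> real" where
  "law_cdf_lim j y = lim (\<lambda>a. law_cdf a j y)"

text \<open>The joint probability with \<open>Z N = j\<close> converges, and division by the weight
  of \<open>j\<close> isolates a limit depending on \<open>j\<close> but not on the generation
  \<open>N\<close>.\<close>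

lemma law_cdf_limit:
  assumes "0 < y" "pmf (gw_law p N 1) j > 0"
  shows "(\<lambda>a. law_cdf a j y) \<longlonglongrightarrow> law_cdf_lim j y"
    and "prob {\<omega> \<in> space M. Z N \<omega> = j \<and> 0 < W \<omega> \<and> m ^ N * W \<omega> \<le> y} = pmf (gw_law p N 1) j * law_cdf_lim j y"
proof -
  let ?P = "prob {\<omega> \<in> space M. Z N \<omega> = j \<and> 0 < W \<omega> \<and> m ^ N * W \<omega> \<le> y}"
  have "(\<lambda>a. pmf (gw_law p N 1) j * law_cdf a j y) \<longlonglongrightarrow> ?P"
  proof (rule LIMSEQ_I)
    fix \<epsilon> :: real assume "0 < \<epsilon>"
    then have e2: "0 < \<epsilon> / 2" by simp
    obtain a0 where a0: "\<And>a y' P. a \<ge> a0 \<Longrightarrow> y \<le> y' \<Longrightarrow> y' \<le> y \<Longrightarrow> Measurable.pred M P \<Longrightarrow>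
      \<bar>prob {\<omega> \<in> space M. P \<omega> \<and> 0 < Z (N + a) \<omega> \<and> real (Z (N + a) \<omega>) \<le> y' * c a} -
       prob {\<omega> \<in> space M. P \<omega> \<and> 0 < W \<omega> \<and> m ^ N * W \<omega> \<le> y'}\<bar> \<le> \<epsilon> / 2"
      by (rule event_convergence_uniform[OF assms(1) order_refl e2, of N]) blast
    have "\<bar>pmf (gw_law p N 1) j * law_cdf a j y - ?P\<bar> \<le> \<epsilon> / 2" if "a \<ge> a0" for a
      using a0[OF that order_refl order_refl, of "\<lambda>\<omega>. Z N \<omega> = j"] by (simp add: prob_law_cdf)
    then show "\<exists>no. \<forall>a\<ge>no. norm (pmf (gw_law p N 1) j * law_cdf a j y - ?P) < \<epsilon>"
      using \<open>0 < \<epsilon>\<close> by (intro exI[of _ a0]) fastforce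
  qed
  from tendsto_divide[OF this tendsto_const[of "pmf (gw_law p N 1) j"]]
  have L: "(\<lambda>a. law_cdf a j y) \<longlonglongrightarrow> ?P / pmf (gw_law p N 1) j" using assms(2) by simp
  then have "law_cdf_lim j y = ?P / pmf (gw_law p N 1) j" unfolding law_cdf_lim_def by (rule limI)
  with L assms(2) show "(\<lambda>a. law_cdf a j y) \<longlonglongrightarrow> law_cdf_lim j y" "?P = pmf (gw_law p N 1) j * law_cdf_lim j y"
    by simp_all
qed

lemma law_cdf_uniform:
  assumes "0 < y1" "y1 \<le> y2" "0 < \<epsilon>" and j: "pmf (gw_law p N0 1) j > 0"
  shows "\<exists>a0. \<forall>a\<ge>a0. \<forall>y\<in>{y1..y2}. \<bar>law_cdf a j y - law_cdf_lim j y\<bar> \<le> \<epsilon>"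
proof -
  let ?pj = "pmf (gw_law p N0 1) j"
  have e: "0 < \<epsilon> * ?pj" using assms by simp
  obtain a0 where a0: "\<And>a y P. a \<ge> a0 \<Longrightarrow> y1 \<le> y \<Longrightarrow> y \<le> y2 \<Longrightarrow> Measurable.pred M P \<Longrightarrow>
    \<bar>prob {\<omega> \<in> space M. P \<omega> \<and> 0 < Z (N0 + a) \<omega> \<and> real (Z (N0 + a) \<omega>) \<le> y * c a} -
     prob {\<omega> \<in> space M. P \<omega> \<and> 0 < W \<omega> \<and> m ^ N0 * W \<omega> \<le> y}\<bar> \<le> \<epsilon> * ?pj"
    by (rule event_convergence_uniform[OF assms(1,2) e, of N0]) blast
  have "\<bar>law_cdf a j y - law_cdf_lim j y\<bar> \<le> \<epsilon>" if "a \<ge> a0" "y \<in> {y1..y2}" for a y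
  proof -
    have y0: "0 < y" using that assms by auto
    have "\<bar>?pj * law_cdf a j y - ?pj * law_cdf_lim j y\<bar> \<le> \<epsilon> * ?pj"
      using a0[OF that(1), of y "\<lambda>\<omega>. Z N0 \<omega> = j"] that(2) by (simp add: prob_law_cdf law_cdf_limit(2)[OF y0 j])
    then have "?pj * \<bar>law_cdf a j y - law_cdf_lim j y\<bar> \<le> ?pj * \<epsilon>"
      unfolding right_diff_distrib[symmetric] abs_mult by (simp add: mult.commute)
    then show ?thesis using j by (simp only: mult_le_cancel_left_pos)
  qed
  then show ?thesis by blast
qed

text \<open>The weight \<open>j * \<rho> ^ (j - 1)\<close> is chosen for its average over
  \<open>Z N\<close>, which is \<open>gwf' p N \<rho>\<close>, of order \<open>\<gamma> ^ N\<close>.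
  Large \<open>j\<close> are settled by geometric decay for every \<open>a\<close> at once, the
  finitely many small ones by convergence.\<close>

lemma law_cdf_weighted_uniform:
  assumes y: "0 < y1" "y1 \<le> y2"
  obtains \<rho> where "0 < \<rho>" "\<rho> < 1"
    "\<And>\<epsilon>. 0 < \<epsilon> \<Longrightarrow> \<exists>a0. \<forall>a\<ge>a0. \<forall>j\<ge>1. \<forall>y\<in>{y1..y2}. (\<exists>N. pmf (gw_law p N 1) j > 0) \<longrightarrow>
       \<bar>law_cdf a j y - law_cdf_lim j y\<bar> \<le> \<epsilon> * (real j * \<rho> ^ (j - 1))"
proof -
  obtain \<rho>0 where \<rho>0: "0 < \<rho>0" "\<rho>0 < 1" "\<And>b. gwf p b (exp (- 1 / c b)) \<le> \<rho>0"
    by (rule norm_gwf_uniform) blast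
  \<comment> \<open>The gap above \<open>\<rho>0\<close> supplies the factor
    \<open>(\<rho>0 / \<rho>) ^ j\<close>, which falls below any given bound.\<close>
  define \<rho> where "\<rho> = (1 + \<rho>0) / 2"
  have \<rho>: "0 < \<rho>" "\<rho> < 1" "\<rho>0 < \<rho>" using \<rho>0 by (auto simp: \<rho>_def)
  show thesis
  proof (rule that[OF \<rho>(1,2)])
    fix \<epsilon> :: real assume \<epsilon>: "0 < \<epsilon>"
    have "(\<lambda>j. exp y2 * (\<rho>0 / \<rho>) ^ j) \<longlonglongrightarrow> exp y2 * 0"
      using \<rho>0 \<rho> by (intro tendsto_intros LIMSEQ_power_zero) auto
    then have "\<forall>\<^sub>F j in sequentially. exp y2 * (\<rho>0 / \<rho>) ^ j < \<epsilon>"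
      using \<epsilon> by (intro order_tendstoD) auto
    then obtain J where J: "\<And>j. j \<ge> J \<Longrightarrow> exp y2 * (\<rho>0 / \<rho>) ^ j < \<epsilon>" by (auto simp: eventually_sequentially)
    have large: "\<bar>law_cdf a j y - law_cdf_lim j y\<bar> \<le> \<epsilon> * (real j * \<rho> ^ (j - 1))"
      if j: "j \<ge> J" "j \<ge> 1" "y \<in> {y1..y2}" "pmf (gw_law p N 1) j > 0" for a j y N
    proof -
      have "exp y * \<rho>0 ^ j \<le> exp y2 * \<rho>0 ^ j" using j \<rho>0(1) by (intro mult_right_mono) auto
      then have b: "law_cdf a j y \<le> exp y2 * \<rho>0 ^ j" for a
        by (rule order_trans[OF law_cdf_le[OF \<rho>0(3)]])
      have y0: "0 < y" using j y by auto
      have nn: "0 \<le> law_cdf a j y" for a by (simp add: law_cdf_def)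
      have "law_cdf_lim j y \<in> {0..exp y2 * \<rho>0 ^ j}"
        by (rule Lim_in_closed_set[OF _ _ _ law_cdf_limit(1)[OF y0 j(4)]]) (use b nn in auto)
      then have "\<bar>law_cdf a j y - law_cdf_lim j y\<bar> \<le> exp y2 * \<rho>0 ^ j" using b[of a] nn[of a] by auto
      also have "\<dots> = exp y2 * (\<rho>0 / \<rho>) ^ j * \<rho> ^ j" using \<rho> by (simp add: power_divide)
      also have "\<dots> \<le> \<epsilon> * \<rho> ^ j" using J[OF j(1)] \<rho> by (intro mult_right_mono) auto
      also have "\<dots> \<le> \<epsilon> * (real j * \<rho> ^ (j - 1))"
      proof (intro mult_left_mono)
        have "\<rho> ^ j \<le> 1 * \<rho> ^ (j - 1)" using \<rho> by (simp add: power_decreasing)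
        also have "\<dots> \<le> real j * \<rho> ^ (j - 1)" using j(2) \<rho> by (intro mult_right_mono) auto
        finally show "\<rho> ^ j \<le> real j * \<rho> ^ (j - 1)" .
      qed (use \<epsilon> in simp)
      finally show ?thesis .
    qed
    have "\<forall>\<^sub>F a in sequentially. \<forall>j\<in>{1..<J}. (\<exists>N. pmf (gw_law p N 1) j > 0) \<longrightarrow> (\<forall>y\<in>{y1..y2}.
       \<bar>law_cdf a j y - law_cdf_lim j y\<bar> \<le> \<epsilon> * (real j * \<rho> ^ (j - 1)))"
    proof (rule eventually_ball_finite)
      show "\<forall>j\<in>{1..<J}. \<forall>\<^sub>F a in sequentially. (\<exists>N. pmf (gw_law p N 1) j > 0) \<longrightarrow> (\<forall>y\<in>{y1..y2}.
       \<bar>law_cdf a j y - law_cdf_lim j y\<bar> \<le> \<epsilon> * (real j * \<rho> ^ (j - 1)))"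
      proof
        fix j assume j: "j \<in> {1..<J}"
        show "\<forall>\<^sub>F a in sequentially. (\<exists>N. pmf (gw_law p N 1) j > 0) \<longrightarrow> (\<forall>y\<in>{y1..y2}.
          \<bar>law_cdf a j y - law_cdf_lim j y\<bar> \<le> \<epsilon> * (real j * \<rho> ^ (j - 1)))"
        proof (cases "\<exists>N. pmf (gw_law p N 1) j > 0")
          case True
          then obtain N where N: "pmf (gw_law p N 1) j > 0" by blast
          have "0 < \<epsilon> * (real j * \<rho> ^ (j - 1))" using j \<epsilon> \<rho> by simp
          from law_cdf_uniform[OF y this N] show ?thesis unfolding eventually_sequentially by blast
        qed simp
      qed
    qed simp
    then obtain a0 where a0: "\<And>a j y. a \<ge> a0 \<Longrightarrow> j \<in> {1..<J} \<Longrightarrow> \<exists>N. pmf (gw_law p N 1) j > 0 \<Longrightarrow> y \<in> {y1..y2} \<Longrightarrow>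
       \<bar>law_cdf a j y - law_cdf_lim j y\<bar> \<le> \<epsilon> * (real j * \<rho> ^ (j - 1))"
      unfolding eventually_sequentially by blast
    show "\<exists>a0. \<forall>a\<ge>a0. \<forall>j\<ge>1. \<forall>y\<in>{y1..y2}. (\<exists>N. pmf (gw_law p N 1) j > 0) \<longrightarrow>
       \<bar>law_cdf a j y - law_cdf_lim j y\<bar> \<le> \<epsilon> * (real j * \<rho> ^ (j - 1))"
    proof (intro exI[of _ a0] allI impI ballI)
      fix a j y assume *: "a \<ge> a0" "1 \<le> j" "y \<in> {y1..y2}" "\<exists>N. pmf (gw_law p N 1) j > 0"
      show "\<bar>law_cdf a j y - law_cdf_lim j y\<bar> \<le> \<epsilon> * (real j * \<rho> ^ (j - 1))"
      proof (cases "j < J")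
        case True
        show ?thesis by (rule a0[OF *(1) _ *(4,3)]) (use True *(2) in simp)
      next
        case False
        from *(4) obtain N where "pmf (gw_law p N 1) j > 0" by blast
        then show ?thesis using False by (intro large[OF _ *(2,3)]) auto
      qed
    qed
  qed
qed

section \<open>Comparison of distribution functions, uniform in the first \<open>N\<close>
  generations\<close>

definition Zcdf :: "nat \<Rightarrow> nat \<Rightarrow> real \<Rightarrow> real" where
  "Zcdf N a y = prob {\<omega> \<in> space M. 0 < Z (N + a) \<omega> \<and> real (Z (N + a) \<omega>) \<le> y * c a}"

definition Wcdf :: "nat \<Rightarrow> real \<Rightarrow> real" where
  "Wcdf N y = prob {\<omega> \<in> space M. 0 < W \<omega> \<and> m ^ N * W \<omega> \<le> y}"

text \<open>Errors are summed over the population at generation \<open>N\<close>. Their weights add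
  up to \<open>gwf' p N \<rho>\<close>, at most a constant times \<open>\<gamma> ^ N\<close>, so
  \<open>a0\<close> serves all \<open>N\<close>.\<close>

lemma Zcdf_Wcdf_uniform:
  assumes y: "0 < y1" "y1 \<le> y2" and \<epsilon>: "0 < \<epsilon>"
  obtains a0 where "\<And>a N y. a \<ge> a0 \<Longrightarrow> y1 \<le> y \<Longrightarrow> y \<le> y2 \<Longrightarrow> \<bar>Zcdf N a y - Wcdf N y\<bar> \<le> \<epsilon> * \<gamma> ^ N"
proof -
  obtain \<rho> where \<rho>: "0 < \<rho>" "\<rho> < 1" and uni:
    "\<And>\<epsilon>. 0 < \<epsilon> \<Longrightarrow> \<exists>a0. \<forall>a\<ge>a0. \<forall>j\<ge>1. \<forall>y\<in>{y1..y2}. (\<exists>N. pmf (gw_law p N 1) j > 0) \<longrightarrow>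
       \<bar>law_cdf a j y - law_cdf_lim j y\<bar> \<le> \<epsilon> * (real j * \<rho> ^ (j - 1))"
    by (rule law_cdf_weighted_uniform[OF y]) blast
  obtain C where C: "C > 0" "\<And>n. gwf' p n \<rho> \<le> C * \<gamma> ^ n"
    by (rule gwf'_upper[OF less_imp_le[OF \<rho>(1)] \<rho>(2)]) blast
  have "0 < \<epsilon> / C" using \<epsilon> C by simp
  from uni[OF this] obtain a0 where a0: "\<And>a j y. a \<ge> a0 \<Longrightarrow> j \<ge> 1 \<Longrightarrow> y \<in> {y1..y2} \<Longrightarrow> (\<exists>N. pmf (gw_law p N 1) j > 0) \<Longrightarrow>
       \<bar>law_cdf a j y - law_cdf_lim j y\<bar> \<le> \<epsilon> / C * (real j * \<rho> ^ (j - 1))" by blast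
  show thesis
  proof (rule that[of a0])
    fix a N y assume a: "a \<ge> a0" and y12: "y1 \<le> y" "y \<le> y2"
    have y0: "0 < y" using y y12 by simp
    let ?pj = "\<lambda>j. pmf (gw_law p N 1) j"
    define P where "P j = prob {\<omega> \<in> space M. (0 < Z (N + a) \<omega> \<and> real (Z (N + a) \<omega>) \<le> y * c a) \<and> Z N \<omega> = j}" for j
    define P' where "P' j = prob {\<omega> \<in> space M. (0 < W \<omega> \<and> m ^ N * W \<omega> \<le> y) \<and> Z N \<omega> = j}" for j
    have sums: "P sums Zcdf N a y" "P' sums Wcdf N y"
      unfolding P_def P'_def Zcdf_def Wcdf_def by (rule prob_sums; measurable)+
    have PP: "P j = ?pj j * law_cdf a j y" for j
      unfolding P_def using prob_law_cdf[of N j a y] by (simp add: conj_ac)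
    have bd: "\<bar>P j - P' j\<bar> \<le> \<epsilon> / C * (?pj j *\<^sub>R (of_nat j * \<rho> ^ (j - 1)))" for j
    proof (cases "?pj j > 0 \<and> j \<ge> 1")
      case True
      then have "P' j = ?pj j * law_cdf_lim j y"
        unfolding P'_def using law_cdf_limit(2)[OF y0, of N j] by (simp add: conj_ac)
      then have "\<bar>P j - P' j\<bar> = ?pj j * \<bar>law_cdf a j y - law_cdf_lim j y\<bar>"
        by (simp add: PP abs_mult flip: right_diff_distrib)
      also have "\<dots> \<le> ?pj j * (\<epsilon> / C * (real j * \<rho> ^ (j - 1)))"
        using True a y12 by (intro mult_left_mono a0) auto
      finally show ?thesis by (simp add: mult_ac)
    next
      \<comment> \<open>Either generation \<open>N\<close> is extinct, and both terms vanish, or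
        \<open>j\<close> is a value of probability 0.\<close>
      case False
      have z: "?pj j = 0" if "j \<noteq> 0"
        using that False pmf_nonneg[of "gw_law p N 1" j] by (metis One_nat_def Suc_leI gr0I less_eq_real_def)
      have "P j = 0" using z law_cdf_0 by (cases "j = 0") (auto simp: PP)
      moreover have "P' j = 0"
      proof (cases "j = 0")
        case True
        have "P' j = prob {}" unfolding P'_def
          by (rule finite_measure_eq_AE) (use AE_W_eq_0_if_extinct in \<open>eventually_elim, auto simp: True\<close>, measurable)
        then show ?thesis by simp
      next
        case F: False
        then have "?pj j = 0" by (rule z)
        moreover have "P' j \<le> prob {\<omega> \<in> space M. Z N \<omega> = j}" unfolding P'_def by (intro finite_measure_mono) auto
        ultimately show ?thesis by (simp add: prob_Z_eq P'_def measure_le_0_iff)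
      qed
      ultimately show ?thesis using \<epsilon> C \<rho> by simp
    qed
    have "(\<lambda>j. ?pj j *\<^sub>R (of_nat j * \<rho> ^ (j - 1))) sums gwf' p N \<rho>"
      unfolding gwf'_def pgf_deriv_def using \<rho> by (intro sums_pmf_expectation integrable_pgf_deriv) auto
    then have S: "(\<lambda>j. \<epsilon> / C * (?pj j *\<^sub>R (of_nat j * \<rho> ^ (j - 1)))) sums (\<epsilon> / C * gwf' p N \<rho>)"
      by (rule sums_mult)
    have D: "(\<lambda>j. P j - P' j) sums (Zcdf N a y - Wcdf N y)" using sums by (rule sums_diff)
    have "Zcdf N a y - Wcdf N y \<le> \<epsilon> / C * gwf' p N \<rho>"
      by (rule sums_le[OF _ D S]) (use bd in \<open>auto simp: abs_le_iff simp del: real_scaleR_def\<close>)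
    moreover have "- (Zcdf N a y - Wcdf N y) \<le> \<epsilon> / C * gwf' p N \<rho>"
      by (rule sums_le[OF _ sums_minus[OF D] S]) (use bd in \<open>auto simp: abs_le_iff simp del: real_scaleR_def\<close>)
    ultimately have "\<bar>Zcdf N a y - Wcdf N y\<bar> \<le> \<epsilon> / C * gwf' p N \<rho>" by linarith
    also have "\<dots> \<le> \<epsilon> / C * (C * \<gamma> ^ N)" using C \<epsilon> by (intro mult_left_mono) auto
    also have "\<dots> = \<epsilon> * \<gamma> ^ N" using C by simp
    finally show "\<bar>Zcdf N a y - Wcdf N y\<bar> \<le> \<epsilon> * \<gamma> ^ N" .
  qed
qed

lemma Zcdf_tendsto:
  assumes "0 < y"
  shows "(\<lambda>a. Zcdf N a y) \<longlonglongrightarrow> Wcdf N y"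
proof (rule LIMSEQ_I)
  fix \<epsilon> :: real assume \<epsilon>: "0 < \<epsilon>"
  define e where "e = \<epsilon> / (2 * \<gamma> ^ N)"
  have e: "0 < e" "e * \<gamma> ^ N < \<epsilon>" using \<epsilon> \<gamma>_pos by (auto simp: e_def)
  obtain a0 where a0: "\<And>a N y'. a \<ge> a0 \<Longrightarrow> y \<le> y' \<Longrightarrow> y' \<le> y \<Longrightarrow> \<bar>Zcdf N a y' - Wcdf N y'\<bar> \<le> e * \<gamma> ^ N"
    by (rule Zcdf_Wcdf_uniform[OF assms order_refl e(1)]) blast
  then show "\<exists>no. \<forall>a\<ge>no. norm (Zcdf N a y - Wcdf N y) < \<epsilon>"
  proof (intro exI[of _ a0] allI impI)
    fix a assume "a0 \<le> a"
    from a0[OF this order_refl order_refl, of N] e(2) show "norm (Zcdf N a y - Wcdf N y) < \<epsilon>" by simp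
  qed
qed

lemma Wcdf_diff: "x \<le> y \<Longrightarrow> Wcdf N y - Wcdf N x = prob {\<omega> \<in> space M. 0 < W \<omega> \<and> x < m ^ N * W \<omega> \<and> m ^ N * W \<omega> \<le> y}"
  unfolding Wcdf_def
  by (subst finite_measure_Diff[symmetric]) (auto intro!: arg_cong[where f=prob])

lemma Zcdf_diff:
  assumes "0 < x" "x \<le> y"
  shows "Zcdf N a y - Zcdf N a x = measure (gw_law p (N + a) 1) {k. x * c a < real k \<and> real k \<le> y * c a}"
proof -
  have le: "x * c a \<le> y * c a" using assms by (simp add: mult_right_mono)
  have pos: "0 < x * c a" using assms by simp
  have "Zcdf N a y - Zcdf N a x = prob ({\<omega> \<in> space M. 0 < Z (N + a) \<omega> \<and> real (Z (N + a) \<omega>) \<le> y * c a} - {\<omega> \<in> space M. 0 < Z (N + a) \<omega> \<and> real (Z (N + a) \<omega>) \<le> x * c a})"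
    unfolding Zcdf_def
  proof (rule finite_measure_Diff[symmetric])
    show "{\<omega> \<in> space M. 0 < Z (N + a) \<omega> \<and> real (Z (N + a) \<omega>) \<le> x * c a} \<subseteq>
          {\<omega> \<in> space M. 0 < Z (N + a) \<omega> \<and> real (Z (N + a) \<omega>) \<le> y * c a}"
      using order_trans[OF _ le] by (intro Collect_mono impI) (elim conjE, intro conjI)
  qed measurable
  also have "\<dots> = prob {\<omega> \<in> space M. Z (N + a) \<omega> \<in> {k. x * c a < real k \<and> real k \<le> y * c a}}"
    using pos by (intro arg_cong[where f=prob]) auto
  finally show ?thesis by (simp only: prob_Z_in)
qed

text \<open>The single-family bound, with derivative factor at least
  \<open>\<gamma> ^ N / 2\<close>, passes to the limit in \<open>a\<close>.\<close>

lemma Wcdf_lower: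
  assumes "0 < x" "x \<le> y"
  shows "\<gamma> ^ N / 2 * (Wcdf 0 y - Wcdf 0 x) \<le> Wcdf N y - Wcdf N x"
proof (rule LIMSEQ_le)
  have y0: "0 < y" using assms by simp
  show "(\<lambda>a. \<gamma> ^ N / 2 * (Zcdf 0 a y - Zcdf 0 a x)) \<longlonglongrightarrow> \<gamma> ^ N / 2 * (Wcdf 0 y - Wcdf 0 x)"
    by (intro tendsto_intros Zcdf_tendsto assms y0)
  show "(\<lambda>a. Zcdf N a y - Zcdf N a x) \<longlonglongrightarrow> Wcdf N y - Wcdf N x"
    by (intro tendsto_intros Zcdf_tendsto assms y0)
  obtain a0 where a0: "\<And>a N. a \<ge> a0 \<Longrightarrow> gwf' p N (gwf p a 0) \<ge> \<gamma> ^ N / 2" by (rule gwf'_lower) blast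
  show "\<exists>a0. \<forall>a\<ge>a0. \<gamma> ^ N / 2 * (Zcdf 0 a y - Zcdf 0 a x) \<le> Zcdf N a y - Zcdf N a x"
  proof (intro exI[of _ a0] allI impI)
    fix a assume a: "a0 \<le> a"
    let ?J = "{k. x * c a < real k \<and> real k \<le> y * c a}"
    have "0 < x * c a" using assms by simp
    then have J: "0 \<notin> ?J" by (auto simp: not_less)
    have "\<gamma> ^ N / 2 * (Zcdf 0 a y - Zcdf 0 a x) = \<gamma> ^ N / 2 * measure (gw_law p a 1) ?J"
      using Zcdf_diff[OF assms, of 0 a] by simp
    also have "\<dots> \<le> gwf' p N (gwf p a 0) * measure (gw_law p a 1) ?J"
      using a0[OF a] by (intro mult_right_mono) auto
    also have "\<dots> \<le> measure (gw_law p (N + a) 1) ?J"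
      using gwf_bounds[of 0 a] by (intro gw_law_split_ge J) auto
    also have "\<dots> = Zcdf N a y - Zcdf N a x" using Zcdf_diff[OF assms] by simp
    finally show "\<gamma> ^ N / 2 * (Zcdf 0 a y - Zcdf 0 a x) \<le> Zcdf N a y - Zcdf N a x" .
  qed
qed

section \<open>The local limit theorem\<close>

text \<open>The density of \<open>m ^ N * W\<close> on the positive half-line.\<close>

definition scaled_density :: "nat \<Rightarrow> real \<Rightarrow> real" where
  "scaled_density N y = w (y / m ^ N) / m ^ N"

lemma Wcdf_increment:
  assumes "0 < x" "x < y" and w: "\<And>t. x / m ^ N \<le> t \<Longrightarrow> t \<le> y / m ^ N \<Longrightarrow> C1 \<le> w t \<and> w t \<le> C2" and "0 \<le> C1"
  shows "C1 / m ^ N \<le> (Wcdf N y - Wcdf N x) / (y - x)" "(Wcdf N y - Wcdf N x) / (y - x) \<le> C2 / m ^ N"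
proof -
  have mN: "0 < m ^ N" using m_pos by simp
  have x0: "0 < x / m ^ N" "x / m ^ N \<le> y / m ^ N" using assms mN by (auto simp: divide_right_mono)
  have eq: "Wcdf N y - Wcdf N x = prob {\<omega> \<in> space M. x / m ^ N < W \<omega> \<and> W \<omega> \<le> y / m ^ N}"
  proof -
    have "0 < W \<omega> \<and> x < m ^ N * W \<omega> \<and> m ^ N * W \<omega> \<le> y \<longleftrightarrow> x / m ^ N < W \<omega> \<and> W \<omega> \<le> y / m ^ N" for \<omega>
      using mN x0 by (auto simp: field_simps intro: less_trans[of 0 "x / m ^ N"] dest: less_trans[OF x0(1)])
    then show ?thesis using Wcdf_diff[of x y N] assms by simp
  qed
  have len: "y / m ^ N - x / m ^ N = (y - x) / m ^ N" by (simp add: diff_divide_distrib)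
  have "C1 * (y / m ^ N - x / m ^ N) \<le> prob {\<omega> \<in> space M. x / m ^ N < W \<omega> \<and> W \<omega> \<le> y / m ^ N}"
    using w assms(4) x0 by (intro prob_W) auto
  then show "C1 / m ^ N \<le> (Wcdf N y - Wcdf N x) / (y - x)"
    using assms(2) mN unfolding eq len by (simp add: field_simps)
  have "prob {\<omega> \<in> space M. x / m ^ N < W \<omega> \<and> W \<omega> \<le> y / m ^ N} \<le> prob {\<omega> \<in> space M. x / m ^ N \<le> W \<omega> \<and> W \<omega> \<le> y / m ^ N}"
    by (intro finite_measure_mono) auto
  also have "\<dots> \<le> C2 * (y / m ^ N - x / m ^ N)"
    using w x0 by (intro prob_W) auto
  finally show "(Wcdf N y - Wcdf N x) / (y - x) \<le> C2 / m ^ N"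
    using assms(2) mN unfolding eq len by (simp add: field_simps)
qed

lemma DERIV_Wcdf:
  assumes y: "0 < y"
  shows "(Wcdf N has_real_derivative scaled_density N y) (at y)"
  unfolding has_field_derivative_iff
proof (rule LIM_I)
  fix r :: real assume r: "0 < r"
  have mN: "0 < m ^ N" using m_pos by simp
  let ?y = "y / m ^ N"
  have y0: "0 < ?y" using y mN by simp
  \<comment> \<open>Besides controlling the error, \<open>e\<close> must not exceed
    \<open>w ?y\<close>: the lower density bound \<open>w ?y - e\<close> has to be
    nonnegative.\<close>
  define e where "e = min (w ?y) (r * m ^ N / 2)"
  have e: "0 < e" "e \<le> w ?y" "e / m ^ N < r" using w_pos[OF y0] r mN by (auto simp: e_def min_def field_simps)
  have "isCont w ?y" using w_cont y0 by (simp add: continuous_on_eq_continuous_at)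
  then obtain s where s: "0 < s" "\<And>t. \<bar>t - ?y\<bar> < s \<Longrightarrow> \<bar>w t - w ?y\<bar> < e"
    using e(1) unfolding continuous_at_eps_delta dist_real_def by metis
  show "\<exists>s>0. \<forall>z. z \<noteq> y \<and> norm (z - y) < s \<longrightarrow> norm ((Wcdf N z - Wcdf N y) / (z - y) - scaled_density N y) < r"
  proof (intro exI[of _ "min y (s * m ^ N)"] conjI allI impI)
    fix z assume z: "z \<noteq> y \<and> norm (z - y) < min y (s * m ^ N)"
    have z0: "0 < z" using z by auto
    have in_s: "w ?y - e \<le> w t \<and> w t \<le> w ?y + e" if "min z y / m ^ N \<le> t" "t \<le> max z y / m ^ N" for t
    proof -
      have "min z y \<le> t * m ^ N" "t * m ^ N \<le> max z y" using that mN by (auto simp: field_simps)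
      then have "\<bar>t * m ^ N - y\<bar> \<le> \<bar>z - y\<bar>" by (auto simp: min_def max_def split: if_splits)
      also have "\<dots> < s * m ^ N" using z by simp
      finally have "\<bar>t * m ^ N - y\<bar> < s * m ^ N" .
      moreover have "t * m ^ N - y = (t - ?y) * m ^ N" using m_pos by (simp add: left_diff_distrib)
      ultimately have "\<bar>t - ?y\<bar> < s" using mN by (simp add: abs_mult)
      from s(2)[OF this] show ?thesis by (auto simp: abs_less_iff)
    qed
    have "0 < min z y" "min z y < max z y" "0 \<le> w ?y - e" using z z0 y e by auto
    note Wcdf_increment[where N=N, OF this(1,2) in_s this(3)]
    moreover have "(Wcdf N (max z y) - Wcdf N (min z y)) / (max z y - min z y) = (Wcdf N z - Wcdf N y) / (z - y)"
      using z by (cases "z \<le> y") (auto simp: min_def max_def field_simps)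
    ultimately have "\<bar>(Wcdf N z - Wcdf N y) / (z - y) - scaled_density N y\<bar> \<le> e / m ^ N"
      by (simp add: scaled_density_def add_divide_distrib diff_divide_distrib abs_le_iff)
    then show "norm ((Wcdf N z - Wcdf N y) / (z - y) - scaled_density N y) < r" using e(3) by simp
  qed (use y s mN in auto)
qed

lemma isCont_Wcdf: "0 < y \<Longrightarrow> isCont (Wcdf N) y"
  using DERIV_Wcdf by (rule DERIV_isCont)

lemma Wcdf_quotient_tendsto:
  assumes "0 < y"
  shows "(\<lambda>i. (Wcdf N (y + inverse (real (Suc i))) - Wcdf N y) / inverse (real (Suc i))) \<longlonglongrightarrow> scaled_density N y"
proof -
  have "((\<lambda>h. (Wcdf N (y + h) - Wcdf N y) / h) \<longlongrightarrow> scaled_density N y) (at 0)"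
    using DERIV_Wcdf[OF assms, of N] by (simp add: DERIV_def)
  moreover have "filterlim (\<lambda>i. inverse (real (Suc i))) (at 0) sequentially"
    using LIMSEQ_inverse_real_of_nat by (rule filterlim_atI) (auto intro!: always_eventually simp del: of_nat_Suc)
  ultimately show ?thesis by (rule filterlim_compose)
qed

text \<open>Limit of difference quotients in \<open>Wcdf_lower\<close>. It later turns absolute
  errors of order \<open>\<gamma> ^ N\<close> into relative ones.\<close>

lemma scaled_density_lower:
  assumes "0 < y"
  shows "\<gamma> ^ N / 2 * w y \<le> scaled_density N y"
proof (rule LIMSEQ_le)
  show "(\<lambda>i. \<gamma> ^ N / 2 * ((Wcdf 0 (y + inverse (real (Suc i))) - Wcdf 0 y) / inverse (real (Suc i)))) \<longlonglongrightarrow> \<gamma> ^ N / 2 * w y"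
    using Wcdf_quotient_tendsto[OF assms, of 0] by (intro tendsto_mult tendsto_const) (simp add: scaled_density_def)
  show "(\<lambda>i. (Wcdf N (y + inverse (real (Suc i))) - Wcdf N y) / inverse (real (Suc i))) \<longlonglongrightarrow> scaled_density N y"
    by (rule Wcdf_quotient_tendsto[OF assms])
  have "\<gamma> ^ N / 2 * ((Wcdf 0 (y + inverse (real (Suc i))) - Wcdf 0 y) / inverse (real (Suc i)))
     \<le> (Wcdf N (y + inverse (real (Suc i))) - Wcdf N y) / inverse (real (Suc i))" for i
    using Wcdf_lower[of y "y + inverse (real (Suc i))" N] assms
    unfolding times_divide_eq_right by (intro divide_right_mono) (auto simp del: of_nat_Suc)
  then show "\<exists>n. \<forall>i\<ge>n. \<gamma> ^ N / 2 * ((Wcdf 0 (y + inverse (real (Suc i))) - Wcdf 0 y) / inverse (real (Suc i)))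
     \<le> (Wcdf N (y + inverse (real (Suc i))) - Wcdf N y) / inverse (real (Suc i))" by blast
qed

section \<open>Equicontinuity and window averages of the lattice probabilities\<close>

definition scaled_pmf :: "nat \<Rightarrow> nat \<Rightarrow> nat \<Rightarrow> real" where
  "scaled_pmf N a k = c a * pmf (gw_law p (N + a) 1) k"

lemma scaled_pmf_eq:
  assumes "0 < k"
  shows "scaled_pmf N a k = tilted N a k * (exp (real k / c a) / (real k / c a))"
  using assms by (simp add: scaled_pmf_def tilted_def exp_minus field_simps)

text \<open>On a compact range of \<open>k / c a\<close> the tilt is undone by the bounded,
  uniformly continuous factor \<open>exp x / x\<close>, so the estimates for \<open>tilted\<close>
  survive.\<close>

lemma scaled_pmf_equicontinuous:
  assumes x: "0 < x1" "x1 \<le> x2"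
  obtains C where "0 < C" "\<And>N a k. 1 \<le> a \<Longrightarrow> int d dvd int k - int \<mu> \<Longrightarrow> real k / c a \<in> {x1..x2} \<Longrightarrow> scaled_pmf N a k \<le> C * \<gamma> ^ N"
    "\<And>\<epsilon>. 0 < \<epsilon> \<Longrightarrow> \<exists>\<eta>>0. \<forall>N a k k'. 1 \<le> a \<longrightarrow> int d dvd int k - int \<mu> \<longrightarrow> int d dvd int k' - int \<mu> \<longrightarrow>
       real k / c a \<in> {x1..x2} \<longrightarrow> real k' / c a \<in> {x1..x2} \<longrightarrow> \<bar>real k - real k'\<bar> \<le> \<eta> * c a \<longrightarrow>
       \<bar>scaled_pmf N a k - scaled_pmf N a k'\<bar> \<le> \<epsilon> * \<gamma> ^ N"
proof -
  obtain C0 \<sigma> where C0: "0 < C0" "0 < \<sigma>"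
    "\<And>N a k. 1 \<le> a \<Longrightarrow> int d dvd int k - int \<mu> \<Longrightarrow> tilted N a k \<le> C0 * \<gamma> ^ N"
    "\<And>N a k k'. 1 \<le> a \<Longrightarrow> int d dvd int k - int \<mu> \<Longrightarrow> int d dvd int k' - int \<mu> \<Longrightarrow>
       \<bar>tilted N a k - tilted N a k'\<bar> \<le> C0 * \<gamma> ^ N * (\<bar>real k - real k'\<bar> / c a) powr \<sigma>"
    by (rule tilted_holder) blast
  define h where "h x = exp x / x" for x :: real
  define H where "H = exp x2 / x1"
  have H: "0 < H" using x by (simp add: H_def)
  have h: "0 \<le> h t \<and> h t \<le> H" if "t \<in> {x1..x2}" for t
    using that x unfolding h_def H_def by (auto intro!: frac_le divide_nonneg_pos)
  have k0: "0 < k" if "real k / c a \<in> {x1..x2}" for k a using that x by (cases "k = 0") auto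
  have tilted0: "0 \<le> tilted N a k" for N a k by (simp add: tilted_def)
  show thesis
  proof (rule that[of "C0 * H"])
    fix N a k :: nat assume *: "1 \<le> a" "int d dvd int k - int \<mu>" "real k / c a \<in> {x1..x2}"
    have "scaled_pmf N a k = tilted N a k * h (real k / c a)" using scaled_pmf_eq[OF k0[OF *(3)]] by (simp add: h_def)
    also have "\<dots> \<le> (C0 * \<gamma> ^ N) * H"
      using h[OF *(3)] C0(1) \<gamma>_pos by (intro mult_mono C0(3) *) auto
    finally show "scaled_pmf N a k \<le> C0 * H * \<gamma> ^ N" by (simp add: mult_ac)
  next
    fix \<epsilon> :: real assume \<epsilon>: "0 < \<epsilon>"
    have "uniformly_continuous_on {x1..x2} h"
      unfolding h_def by (intro compact_uniformly_continuous continuous_intros) (use x in auto)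
    moreover have "0 < \<epsilon> / (2 * C0)" using \<epsilon> C0 by simp
    ultimately obtain \<delta> where \<delta>: "0 < \<delta>" "\<And>t t'. t \<in> {x1..x2} \<Longrightarrow> t' \<in> {x1..x2} \<Longrightarrow> \<bar>t' - t\<bar> < \<delta> \<Longrightarrow> \<bar>h t' - h t\<bar> < \<epsilon> / (2 * C0)"
      unfolding uniformly_continuous_on_def dist_real_def by metis
    \<comment> \<open>The second bound solves
      \<open>C0 * H * \<eta> powr \<sigma> = \<epsilon> / 2\<close>; the first controls the
      variation of \<open>h\<close>.\<close>
    define \<eta> where "\<eta> = min (\<delta> / 2) ((\<epsilon> / (2 * C0 * H)) powr (1 / \<sigma>))"
    have \<eta>: "0 < \<eta>" "\<eta> < \<delta>" using \<delta>(1) \<epsilon> C0 H by (auto simp: \<eta>_def min_def)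
    have "\<eta> powr \<sigma> \<le> ((\<epsilon> / (2 * C0 * H)) powr (1 / \<sigma>)) powr \<sigma>"
      using \<eta> C0 by (intro powr_mono2) (auto simp: \<eta>_def)
    also have "\<dots> = \<epsilon> / (2 * C0 * H)" using \<epsilon> C0 H by (simp add: powr_powr)
    finally have \<eta>\<sigma>: "\<eta> powr \<sigma> \<le> \<epsilon> / (2 * C0 * H)" .
    show "\<exists>\<eta>>0. \<forall>N a k k'. 1 \<le> a \<longrightarrow> int d dvd int k - int \<mu> \<longrightarrow> int d dvd int k' - int \<mu> \<longrightarrow>
       real k / c a \<in> {x1..x2} \<longrightarrow> real k' / c a \<in> {x1..x2} \<longrightarrow> \<bar>real k - real k'\<bar> \<le> \<eta> * c a \<longrightarrow>
       \<bar>scaled_pmf N a k - scaled_pmf N a k'\<bar> \<le> \<epsilon> * \<gamma> ^ N"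
    proof (intro exI[of _ \<eta>] conjI allI impI)
      fix N a k k' assume *: "1 \<le> a" "int d dvd int k - int \<mu>" "int d dvd int k' - int \<mu>"
        "real k / c a \<in> {x1..x2}" "real k' / c a \<in> {x1..x2}" "\<bar>real k - real k'\<bar> \<le> \<eta> * c a"
      let ?t = "real k / c a" and ?t' = "real k' / c a"
      have dist: "\<bar>real k - real k'\<bar> / c a \<le> \<eta>" using *(6) by (simp add: field_simps)
      have "\<bar>?t - ?t'\<bar> = \<bar>real k - real k'\<bar> / c a" by (simp add: abs_divide abs_of_pos flip: diff_divide_distrib)
      then have hh: "\<bar>h ?t - h ?t'\<bar> \<le> \<epsilon> / (2 * C0)" using dist \<eta> \<delta>(2)[OF *(5,4)] by simp
      have pow: "(\<bar>real k - real k'\<bar> / c a) powr \<sigma> \<le> \<epsilon> / (2 * C0 * H)"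
        using powr_mono2[OF _ _ dist, of \<sigma>] C0 \<eta>\<sigma> by simp
      have "scaled_pmf N a k - scaled_pmf N a k' = (tilted N a k - tilted N a k') * h ?t + tilted N a k' * (h ?t - h ?t')"
        unfolding scaled_pmf_eq[OF k0[OF *(4)]] scaled_pmf_eq[OF k0[OF *(5)]] h_def by (simp only: algebra_simps)
      also have "\<bar>\<dots>\<bar> \<le> \<bar>(tilted N a k - tilted N a k') * h ?t\<bar> + \<bar>tilted N a k' * (h ?t - h ?t')\<bar>"
        by (rule abs_triangle_ineq)
      also have "\<dots> = \<bar>tilted N a k - tilted N a k'\<bar> * h ?t + tilted N a k' * \<bar>h ?t - h ?t'\<bar>"
        using h[OF *(4)] tilted0 by (simp add: abs_mult)
      also have "\<dots> \<le> (C0 * \<gamma> ^ N * (\<epsilon> / (2 * C0 * H))) * H + (C0 * \<gamma> ^ N) * (\<epsilon> / (2 * C0))"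
      proof (intro add_mono mult_mono C0(3) *)
        have "\<bar>tilted N a k - tilted N a k'\<bar> \<le> C0 * \<gamma> ^ N * (\<bar>real k - real k'\<bar> / c a) powr \<sigma>" by (intro C0(4) *)
        also have "\<dots> \<le> C0 * \<gamma> ^ N * (\<epsilon> / (2 * C0 * H))" using pow C0 \<gamma>_pos by (intro mult_left_mono) auto
        finally show "\<bar>tilted N a k - tilted N a k'\<bar> \<le> C0 * \<gamma> ^ N * (\<epsilon> / (2 * C0 * H))" .
      qed (use h[OF *(4)] C0 H \<epsilon> \<gamma>_pos hh in auto)
      also have "\<dots> = \<epsilon> * \<gamma> ^ N" using C0 H by (simp add: field_simps)
      finally show "\<bar>scaled_pmf N a k - scaled_pmf N a k'\<bar> \<le> \<epsilon> * \<gamma> ^ N" .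
    qed (rule \<eta>(1))
  qed (use C0 H in simp)
qed

text \<open>Within the window only the points \<open>k + d * i\<close> can carry mass, so the
  increment of the distribution function is a sum of \<open>L\<close> point probabilities.\<close>

lemma window_sum:
  assumes k: "int d dvd int k - int \<mu>" "0 < k" and \<eta>: "0 < \<eta>" and a: "1 \<le> a" and L: "L = nat \<lfloor>\<eta> * c a / real d\<rfloor>"
  shows "c a * (Zcdf N a (real k / c a + \<eta>) - Zcdf N a (real k / c a)) = (\<Sum>i=1..L. scaled_pmf N a (k + d * i))"
proof -
  let ?q = "gw_law p (N + a) 1"
  have d0: "0 < d" using d_ge_1 by simp
  let ?J = "{j. real k / c a * c a < real j \<and> real j \<le> (real k / c a + \<eta>) * c a}"
  have J: "?J = {j. real k < real j \<and> real j \<le> real k + \<eta> * c a}" by (simp add: distrib_right)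
  have L': "i \<le> L \<longleftrightarrow> real d * real i \<le> \<eta> * c a" for i
  proof -
    have "i \<le> L \<longleftrightarrow> int i \<le> \<lfloor>\<eta> * c a / real d\<rfloor>" using \<eta> unfolding L by (simp add: le_nat_iff)
    also have "\<dots> \<longleftrightarrow> real i \<le> \<eta> * c a / real d" by (simp add: le_floor_iff)
    also have "\<dots> \<longleftrightarrow> real d * real i \<le> \<eta> * c a" using d0 by (simp add: field_simps)
    finally show ?thesis .
  qed
  have eqJ: "?J \<inter> set_pmf ?q = (\<lambda>i. k + d * i) ` {1..L} \<inter> set_pmf ?q"
  proof (intro equalityI subsetI)
    fix j assume j: "j \<in> ?J \<inter> set_pmf ?q"
    then have kj: "k < j" "real j \<le> real k + \<eta> * c a" unfolding J by auto
    have "int d dvd int j - int \<mu>" using gw_law_cong[of "N + a" j] j a by auto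
    from dvd_diff[OF this k(1)] have "int d dvd int (j - k)" using kj by (simp add: of_nat_diff)
    then have "d dvd j - k" by (simp only: int_dvd_int_iff)
    then obtain i where i: "j - k = d * i" ..
    then have ji: "j = k + d * i" using kj by simp
    have "real d * real i \<le> \<eta> * c a" using kj(2) unfolding ji by simp
    then have "i \<le> L" using L' by simp
    moreover have "1 \<le> i" using kj(1) ji by (cases i) auto
    ultimately show "j \<in> (\<lambda>i. k + d * i) ` {1..L} \<inter> set_pmf ?q" using ji j by auto
  next
    fix j assume "j \<in> (\<lambda>i. k + d * i) ` {1..L} \<inter> set_pmf ?q"
    then obtain i where i: "j = k + d * i" "i \<in> {1..L}" "j \<in> set_pmf ?q" by blast
    have "real d * real i \<le> \<eta> * c a" using i L' by simp
    then show "j \<in> ?J \<inter> set_pmf ?q" unfolding J using i d0 by simp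
  qed
  have "Zcdf N a (real k / c a + \<eta>) - Zcdf N a (real k / c a) = measure ?q ?J"
    using k \<eta> by (intro Zcdf_diff) auto
  also have "\<dots> = measure ?q (?J \<inter> set_pmf ?q)" by (simp add: measure_Int_set_pmf)
  also have "\<dots> = measure ?q ((\<lambda>i. k + d * i) ` {1..L})" unfolding eqJ by (simp add: measure_Int_set_pmf)
  also have "\<dots> = (\<Sum>j\<in>(\<lambda>i. k + d * i) ` {1..L}. pmf ?q j)" by (rule measure_measure_pmf_finite) simp
  also have "\<dots> = (\<Sum>i=1..L. pmf ?q (k + d * i))" by (rule sum.reindex_cong[OF _ refl refl]) (use d0 in \<open>auto simp: inj_on_def\<close>)
  finally show ?thesis by (simp add: scaled_pmf_def sum_distrib_left)
qed

text \<open>Equicontinuity replaces each point probability in a window by the one at its left end,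
  and the sum over the window is an increment known from \<open>Zcdf_Wcdf_uniform\<close>. Only
  \<open>a0\<close> depends on the window length.\<close>

lemma scaled_pmf_window:
  assumes x: "0 < x1" "x1 \<le> x2" and \<epsilon>: "0 < \<epsilon>"
  obtains \<eta>0 where "0 < \<eta>0" "\<And>\<eta>. 0 < \<eta> \<Longrightarrow> \<eta> \<le> \<eta>0 \<Longrightarrow> \<exists>a0\<ge>1. \<forall>a\<ge>a0. \<forall>N k. int d dvd int k - int \<mu> \<longrightarrow> real k / c a \<in> {x1..x2} \<longrightarrow>
     \<bar>\<eta> * scaled_pmf N a k - real d * (Wcdf N (real k / c a + \<eta>) - Wcdf N (real k / c a))\<bar> \<le> \<eta> * \<epsilon> * \<gamma> ^ N"
proof -
  \<comment> \<open>Windows start in \<open>[x1, x2]\<close> and have length at most 1.\<close>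
  have x': "0 < x1" "x1 \<le> x2 + 1" using x by auto
  obtain C where C: "0 < C" "\<And>N a k. 1 \<le> a \<Longrightarrow> int d dvd int k - int \<mu> \<Longrightarrow> real k / c a \<in> {x1..x2+1} \<Longrightarrow> scaled_pmf N a k \<le> C * \<gamma> ^ N"
    and equi: "\<And>\<epsilon>. 0 < \<epsilon> \<Longrightarrow> \<exists>\<eta>>0. \<forall>N a k k'. 1 \<le> a \<longrightarrow> int d dvd int k - int \<mu> \<longrightarrow> int d dvd int k' - int \<mu> \<longrightarrow>
       real k / c a \<in> {x1..x2+1} \<longrightarrow> real k' / c a \<in> {x1..x2+1} \<longrightarrow> \<bar>real k - real k'\<bar> \<le> \<eta> * c a \<longrightarrow>
       \<bar>scaled_pmf N a k - scaled_pmf N a k'\<bar> \<le> \<epsilon> * \<gamma> ^ N"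
    by (rule scaled_pmf_equicontinuous[OF x']) blast
  have e3: "0 < \<epsilon> / 3" using \<epsilon> by simp
  from equi[OF this] obtain \<eta>1 where \<eta>1: "0 < \<eta>1"
    "\<And>N a k k'. 1 \<le> a \<Longrightarrow> int d dvd int k - int \<mu> \<Longrightarrow> int d dvd int k' - int \<mu> \<Longrightarrow>
       real k / c a \<in> {x1..x2+1} \<Longrightarrow> real k' / c a \<in> {x1..x2+1} \<Longrightarrow> \<bar>real k - real k'\<bar> \<le> \<eta>1 * c a \<Longrightarrow>
       \<bar>scaled_pmf N a k - scaled_pmf N a k'\<bar> \<le> \<epsilon> / 3 * \<gamma> ^ N" by blast
  have d0: "0 < real d" using d_ge_1 by simp
  show thesis
  proof (rule that[of "min 1 \<eta>1"])
    fix \<eta> assume \<eta>: "0 < \<eta>" "\<eta> \<le> min 1 \<eta>1"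
    \<comment> \<open>Two comparisons per window, multiplied by \<open>d\<close>, make up one third
      of the final error.\<close>
    have "0 < \<eta> * \<epsilon> / (6 * real d)" using \<eta> \<epsilon> d0 by simp
    then obtain a1 where a1: "\<And>a N y. a \<ge> a1 \<Longrightarrow> x1 \<le> y \<Longrightarrow> y \<le> x2 + 1 \<Longrightarrow> \<bar>Zcdf N a y - Wcdf N y\<bar> \<le> \<eta> * \<epsilon> / (6 * real d) * \<gamma> ^ N"
      by (rule Zcdf_Wcdf_uniform[OF x']) blast
    have "\<forall>\<^sub>F a in sequentially. 3 * real d * C / (\<eta> * \<epsilon>) \<le> c a"
      using c_at_top by (simp add: filterlim_at_top)
    then obtain a2 where a2: "\<And>a. a \<ge> a2 \<Longrightarrow> 3 * real d * C / (\<eta> * \<epsilon>) \<le> c a" by (auto simp: eventually_sequentially)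
    show "\<exists>a0\<ge>1. \<forall>a\<ge>a0. \<forall>N k. int d dvd int k - int \<mu> \<longrightarrow> real k / c a \<in> {x1..x2} \<longrightarrow>
     \<bar>\<eta> * scaled_pmf N a k - real d * (Wcdf N (real k / c a + \<eta>) - Wcdf N (real k / c a))\<bar> \<le> \<eta> * \<epsilon> * \<gamma> ^ N"
    proof (intro exI[of _ "max 1 (max a1 a2)"] conjI allI impI)
      fix a N k assume a: "max 1 (max a1 a2) \<le> a" and k: "int d dvd int k - int \<mu>" "real k / c a \<in> {x1..x2}"
      let ?R = "scaled_pmf N a k" and ?y = "real k / c a"
      have k0: "0 < k" using k(2) x by (cases "k = 0") auto
      define L where "L = nat \<lfloor>\<eta> * c a / real d\<rfloor>"
      \<comment> \<open>Length covered by \<open>L\<close> lattice steps; it falls short of \<eta>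
        by at most \<open>d / c a\<close>.\<close>
      define fr where "fr = real L * real d / c a"
      have fl: "real L \<le> \<eta> * c a / real d" "\<eta> * c a / real d < real L + 1"
        using \<eta> d0 unfolding L_def by (auto simp: of_nat_nat)
      have fr: "fr \<le> \<eta>" "\<eta> - fr \<le> real d / c a" "0 \<le> fr"
      proof -
        show "fr \<le> \<eta>" using fl(1) d0 by (simp add: fr_def field_simps)
        have "\<eta> * c a \<le> real L * real d + real d" using fl(2) d0 by (simp add: field_simps)
        then have "(\<eta> * c a) / c a \<le> (real L * real d + real d) / c a" by (intro divide_right_mono) auto
        then show "\<eta> - fr \<le> real d / c a" by (simp add: fr_def add_divide_distrib)
      qed (simp add: fr_def)
      have Rb: "0 \<le> ?R" by (simp add: scaled_pmf_def)
      have Rb2: "?R \<le> C * \<gamma> ^ N" by (rule C(2)) (use k a in auto)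
      let ?\<Delta>Z = "Zcdf N a (?y + \<eta>) - Zcdf N a ?y" and ?\<Delta>W = "Wcdf N (?y + \<eta>) - Wcdf N ?y"
      have "\<bar>c a * ?\<Delta>Z - real L * ?R\<bar> = \<bar>\<Sum>i=1..L. (scaled_pmf N a (k + d * i) - ?R)\<bar>"
        using window_sum[OF k(1) k0 \<eta>(1) _ L_def, of N] a by (simp add: sum_subtractf)
      also have "\<dots> \<le> (\<Sum>i=1..L. \<bar>scaled_pmf N a (k + d * i) - ?R\<bar>)" by (rule sum_abs)
      also have "\<dots> \<le> (\<Sum>i=1..L. \<epsilon> / 3 * \<gamma> ^ N)"
      proof (rule sum_mono)
        fix i assume i: "i \<in> {1..L}"
        have "real i \<le> \<eta> * c a / real d" using i fl(1) by simp
        then have di: "real d * real i \<le> \<eta> * c a" using d0 by (simp add: field_simps)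
        then have di2: "real d * real i / c a \<le> \<eta>" by (simp add: field_simps)
        have dist: "\<bar>real (k + d * i) - real k\<bar> \<le> \<eta>1 * c a"
        proof -
          have "\<eta> * c a \<le> \<eta>1 * c a" using \<eta> by (intro mult_right_mono) auto
          from order_trans[OF di this] show ?thesis by simp
        qed
        have in1: "real (k + d * i) / c a \<in> {x1..x2+1}"
        proof -
          have "real (k + d * i) / c a = ?y + real d * real i / c a" by (simp add: add_divide_distrib)
          moreover have "0 \<le> real d * real i / c a" by simp
          ultimately show ?thesis using k(2) di2 \<eta> unfolding atLeastAtMost_iff by linarith
        qed
        have "int d dvd (int k - int \<mu>) + int d * int i" using k(1) by (intro dvd_add) auto
        then have "int d dvd int (k + d * i) - int \<mu>" by (simp add: algebra_simps)
        then show "\<bar>scaled_pmf N a (k + d * i) - ?R\<bar> \<le> \<epsilon> / 3 * \<gamma> ^ N"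
          by (rule \<eta>1(2)[rotated]) (use a k in1 dist in auto)
      qed
      also have "\<dots> = real L * (\<epsilon> / 3 * \<gamma> ^ N)" by simp
      finally have f1: "real d / c a * \<bar>c a * ?\<Delta>Z - real L * ?R\<bar> \<le> real d / c a * (real L * (\<epsilon> / 3 * \<gamma> ^ N))"
        using d0 by (intro mult_left_mono) auto
      have f2: "real d / c a * \<bar>c a * ?\<Delta>Z - real L * ?R\<bar> = \<bar>real d / c a * (c a * ?\<Delta>Z - real L * ?R)\<bar>"
        unfolding abs_mult using d0 by (simp add: abs_of_pos)
      have f3: "real d / c a * (c a * ?\<Delta>Z - real L * ?R) = real d * ?\<Delta>Z - fr * ?R"
        by (simp add: fr_def field_simps)
      have f4: "real d / c a * (real L * (\<epsilon> / 3 * \<gamma> ^ N)) = fr * (\<epsilon> / 3 * \<gamma> ^ N)" by (simp add: fr_def)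
      have "\<bar>real d * ?\<Delta>Z - fr * ?R\<bar> \<le> fr * (\<epsilon> / 3 * \<gamma> ^ N)"
        using f1 unfolding f2 f3 f4 .
      also have "\<dots> \<le> \<eta> * (\<epsilon> / 3 * \<gamma> ^ N)" using fr \<epsilon> \<gamma>_pos by (intro mult_right_mono) auto
      finally have 1: "\<bar>real d * ?\<Delta>Z - fr * ?R\<bar> \<le> \<eta> * (\<epsilon> / 3 * \<gamma> ^ N)" .
      have "\<bar>fr * ?R - \<eta> * ?R\<bar> = (\<eta> - fr) * ?R"
        using fr Rb by (simp add: abs_mult flip: left_diff_distrib)
      also have "\<dots> \<le> real d / c a * (C * \<gamma> ^ N)" using fr Rb Rb2 by (intro mult_mono) auto
      also have "\<dots> = (real d * C / c a) * \<gamma> ^ N" by simp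
      also have "\<dots> \<le> (\<eta> * \<epsilon> / 3) * \<gamma> ^ N"
        using a2[of a] a \<eta> \<epsilon> \<gamma>_pos by (intro mult_right_mono) (auto simp: field_simps)
      finally have 2: "\<bar>fr * ?R - \<eta> * ?R\<bar> \<le> \<eta> * (\<epsilon> / 3 * \<gamma> ^ N)" by simp
      have "\<bar>?\<Delta>Z - ?\<Delta>W\<bar> \<le> \<bar>Zcdf N a (?y + \<eta>) - Wcdf N (?y + \<eta>)\<bar> + \<bar>Zcdf N a ?y - Wcdf N ?y\<bar>" by linarith
      also have "\<dots> \<le> \<eta> * \<epsilon> / (6 * real d) * \<gamma> ^ N + \<eta> * \<epsilon> / (6 * real d) * \<gamma> ^ N"
        using a k(2) \<eta> by (intro add_mono a1) auto
      finally have "real d * \<bar>?\<Delta>Z - ?\<Delta>W\<bar> \<le> real d * (\<eta> * \<epsilon> / (6 * real d) * \<gamma> ^ N + \<eta> * \<epsilon> / (6 * real d) * \<gamma> ^ N)"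
        using d0 by (intro mult_left_mono) auto
      also have "\<dots> = \<eta> * (\<epsilon> / 3 * \<gamma> ^ N)" using d0 by (simp add: field_simps)
      finally have 3: "\<bar>real d * ?\<Delta>Z - real d * ?\<Delta>W\<bar> \<le> \<eta> * (\<epsilon> / 3 * \<gamma> ^ N)"
        using d0 by (simp add: abs_mult flip: right_diff_distrib)
      have "\<bar>\<eta> * ?R - real d * ?\<Delta>W\<bar> \<le> 3 * (\<eta> * (\<epsilon> / 3 * \<gamma> ^ N))" using 1 2 3 by linarith
      then show "\<bar>\<eta> * ?R - real d * ?\<Delta>W\<bar> \<le> \<eta> * \<epsilon> * \<gamma> ^ N" by simp
    qed auto
  qed (use \<eta>1 in auto)
qed

text \<open>Rounding \<open>y * c a\<close> down to a multiple of \<open>d\<close> and adding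
  \<open>\<mu>\<close> costs a bounded error, while \<open>c a\<close> grows.\<close>

lemma lattice_approx:
  assumes "0 < y"
  obtains k where "\<And>a. int d dvd int (k a) - int \<mu>" "(\<lambda>a. real (k a) / c a) \<longlonglongrightarrow> y"
proof -
  have d0: "0 < real d" using d_ge_1 by simp
  define k where "k a = \<mu> + d * nat \<lfloor>y * c a / real d\<rfloor>" for a
  have lo: "y - real d / c a \<le> real (k a) / c a" and hi: "real (k a) / c a \<le> y + real \<mu> / c a" for a
  proof -
    define L where "L = nat \<lfloor>y * c a / real d\<rfloor>"
    have fl: "real L \<le> y * c a / real d" "y * c a / real d < real L + 1"
      using assms d0 unfolding L_def by (auto simp: of_nat_nat)
    have "real d * real L \<le> y * c a" "y * c a \<le> real d * real L + real d"
      using fl d0 by (simp_all add: field_simps)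
    moreover have "real (k a) = real \<mu> + real d * real L" by (simp add: k_def L_def)
    ultimately have b: "y * c a - real d \<le> real (k a)" "real (k a) \<le> y * c a + real \<mu>" by linarith+
    show "y - real d / c a \<le> real (k a) / c a"
      using divide_right_mono[OF b(1) c_nonneg[of a]] by (simp add: diff_divide_distrib)
    show "real (k a) / c a \<le> y + real \<mu> / c a"
      using divide_right_mono[OF b(2) c_nonneg[of a]] by (simp add: add_divide_distrib)
  qed
  have inv: "(\<lambda>a. t / c a) \<longlonglongrightarrow> 0" for t
    by (rule real_tendsto_divide_at_top[OF tendsto_const c_at_top])
  have "(\<lambda>a. y - real d / c a) \<longlonglongrightarrow> y - 0" "(\<lambda>a. y + real \<mu> / c a) \<longlonglongrightarrow> y + 0"
    by (rule tendsto_diff[OF tendsto_const inv], rule tendsto_add[OF tendsto_const inv])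
  then have lims: "(\<lambda>a. y - real d / c a) \<longlonglongrightarrow> y" "(\<lambda>a. y + real \<mu> / c a) \<longlonglongrightarrow> y" by simp_all
  have lim: "(\<lambda>a. real (k a) / c a) \<longlonglongrightarrow> y"
    by (rule real_tendsto_sandwich[OF _ _ lims]) (simp_all add: lo hi)
  have "int d dvd int (k a) - int \<mu>" for a by (simp add: k_def)
  from that[of k, OF this lim] show thesis .
qed

text \<open>The window averages of the density inherit their closeness from those of the lattice probabilities,
  so no Fourier inversion of the density is needed.\<close>

lemma density_window:
  assumes x: "0 < x1" "x1 \<le> x2" and \<epsilon>: "0 < \<epsilon>"
  obtains \<eta>0 where "0 < \<eta>0" "\<And>\<eta> N y. 0 < \<eta> \<Longrightarrow> \<eta> \<le> \<eta>0 \<Longrightarrow> y \<in> {x1..x2} \<Longrightarrow>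
     \<bar>real d * ((Wcdf N (y + \<eta>) - Wcdf N y) / \<eta>) - real d * scaled_density N y\<bar> \<le> \<epsilon> * \<gamma> ^ N"
proof -
  have x': "0 < x1 / 2" "x1 / 2 \<le> x2 + 1" "0 < \<epsilon> / 2" using x \<epsilon> by auto
  obtain \<eta>0 where \<eta>0: "0 < \<eta>0" "\<And>\<eta>. 0 < \<eta> \<Longrightarrow> \<eta> \<le> \<eta>0 \<Longrightarrow> \<exists>a0\<ge>1. \<forall>a\<ge>a0. \<forall>N k. int d dvd int k - int \<mu> \<longrightarrow> real k / c a \<in> {x1/2..x2+1} \<longrightarrow>
     \<bar>\<eta> * scaled_pmf N a k - real d * (Wcdf N (real k / c a + \<eta>) - Wcdf N (real k / c a))\<bar> \<le> \<eta> * (\<epsilon> / 2) * \<gamma> ^ N"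
    by (rule scaled_pmf_window[OF x']) blast
  show thesis
  proof (rule that[OF \<eta>0(1)])
    fix \<eta> y :: real and N :: nat assume \<eta>: "0 < \<eta>" "\<eta> \<le> \<eta>0" and y: "y \<in> {x1..x2}"
    have y0: "0 < y" using y x by auto
    obtain k where k: "\<And>a. int d dvd int (k a) - int \<mu>" "(\<lambda>a. real (k a) / c a) \<longlonglongrightarrow> y"
      by (rule lattice_approx[OF y0]) blast
    define A where "A \<eta> y = real d * ((Wcdf N (y + \<eta>) - Wcdf N y) / \<eta>)" for \<eta> y
    have "\<forall>\<^sub>F a in sequentially. x1 / 2 < real (k a) / c a" "\<forall>\<^sub>F a in sequentially. real (k a) / c a < x2 + 1"
      using y x by (intro order_tendstoD[OF k(2)]; simp)+
    then have in_range: "\<forall>\<^sub>F a in sequentially. real (k a) / c a \<in> {x1/2..x2+1}"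
      by eventually_elim auto
    \<comment> \<open>One lattice probability near \<open>y\<close> serves as common reference for
      windows of different lengths.\<close>
    have near: "\<forall>\<^sub>F a in sequentially. \<bar>scaled_pmf N a (k a) - A h (real (k a) / c a)\<bar> \<le> \<epsilon> / 2 * \<gamma> ^ N"
      if h: "0 < h" "h \<le> \<eta>0" for h
    proof -
      from \<eta>0(2)[OF h] obtain a0 where a0: "\<And>a N k. a \<ge> a0 \<Longrightarrow> int d dvd int k - int \<mu> \<Longrightarrow> real k / c a \<in> {x1/2..x2+1} \<Longrightarrow>
        \<bar>h * scaled_pmf N a k - real d * (Wcdf N (real k / c a + h) - Wcdf N (real k / c a))\<bar> \<le> h * (\<epsilon> / 2) * \<gamma> ^ N" by blast
      show ?thesis
        using in_range eventually_ge_at_top[of a0]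
      proof eventually_elim
        case (elim a)
        have "h * \<bar>scaled_pmf N a (k a) - A h (real (k a) / c a)\<bar> = \<bar>h * (scaled_pmf N a (k a) - A h (real (k a) / c a))\<bar>"
          using h by (simp add: abs_mult)
        also have "h * (scaled_pmf N a (k a) - A h (real (k a) / c a)) =
           h * scaled_pmf N a (k a) - real d * (Wcdf N (real (k a) / c a + h) - Wcdf N (real (k a) / c a))"
        proof -
          have "h * A h (real (k a) / c a) = real d * (Wcdf N (real (k a) / c a + h) - Wcdf N (real (k a) / c a))"
            using h by (simp add: A_def)
          then show ?thesis by (simp only: right_diff_distrib[of h])
        qed
        also have "\<bar>\<dots>\<bar> \<le> h * (\<epsilon> / 2 * \<gamma> ^ N)" using a0[OF elim(2) k(1) elim(1), of N] by (simp add: mult.assoc)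
        finally show ?case using h by (simp only: mult_le_cancel_left_pos)
      qed
    qed
    have A_lim: "(\<lambda>a. A h (real (k a) / c a)) \<longlonglongrightarrow> A h y" if "0 < h" for h
      unfolding A_def using y0 that
      by (intro tendsto_intros isCont_tendsto_compose[OF isCont_Wcdf] k(2)) auto
    \<comment> \<open>The reference drops out of the comparison of two lengths, and the limit in
      \<open>a\<close> moves the base point to \<open>y\<close>.\<close>
    have cauchy: "\<bar>A \<eta> y - A h y\<bar> \<le> \<epsilon> * \<gamma> ^ N" if h: "0 < h" "h \<le> \<eta>0" for h
    proof (rule tendsto_upperbound[OF _ _ sequentially_bot])
      show "(\<lambda>a. \<bar>A \<eta> (real (k a) / c a) - A h (real (k a) / c a)\<bar>) \<longlonglongrightarrow> \<bar>A \<eta> y - A h y\<bar>"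
        by (intro tendsto_intros A_lim \<eta> h)
      show "\<forall>\<^sub>F a in sequentially. \<bar>A \<eta> (real (k a) / c a) - A h (real (k a) / c a)\<bar> \<le> \<epsilon> * \<gamma> ^ N"
        using near[OF \<eta>] near[OF h] by eventually_elim linarith
    qed
    \<comment> \<open>Shrinking the second window turns its average into the density.\<close>
    have "(\<lambda>i. \<bar>A \<eta> y - A (inverse (real (Suc i))) y\<bar>) \<longlonglongrightarrow> \<bar>A \<eta> y - real d * scaled_density N y\<bar>"
      unfolding A_def by (intro tendsto_intros Wcdf_quotient_tendsto[OF y0])
    moreover have "\<forall>\<^sub>F i in sequentially. \<bar>A \<eta> y - A (inverse (real (Suc i))) y\<bar> \<le> \<epsilon> * \<gamma> ^ N"
    proof -
      have "\<forall>\<^sub>F i in sequentially. inverse (real (Suc i)) < \<eta>0"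
        using LIMSEQ_inverse_real_of_nat \<eta>0(1) by (rule order_tendstoD)
      then show ?thesis by eventually_elim (intro cauchy, auto simp del: of_nat_Suc)
    qed
    ultimately have "\<bar>A \<eta> y - real d * scaled_density N y\<bar> \<le> \<epsilon> * \<gamma> ^ N"
      by (rule tendsto_upperbound[OF _ _ sequentially_bot])
    then show "\<bar>real d * ((Wcdf N (y + \<eta>) - Wcdf N y) / \<eta>) - real d * scaled_density N y\<bar> \<le> \<epsilon> * \<gamma> ^ N"
      by (simp add: A_def)
  qed
qed

text \<open>Point probability and density are both close to the same window average, for one fixed
  window length. The error of order \<open>\<gamma> ^ N\<close> is relative by the lower bound on
  the density.\<close>

lemma local_limit_uniform:
  assumes x: "0 < x1" "x1 \<le> x2" and \<epsilon>: "0 < \<epsilon>"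
  obtains a0 where "\<And>a N k. a \<ge> a0 \<Longrightarrow> int d dvd int k - int \<mu> \<Longrightarrow> real k / c a \<in> {x1..x2} \<Longrightarrow>
     \<bar>scaled_pmf N a k - real d * scaled_density N (real k / c a)\<bar> \<le> \<epsilon> * (real d * scaled_density N (real k / c a))"
proof -
  obtain w1 w2 where w1: "0 < w1" "\<And>t. x1 \<le> t \<Longrightarrow> t \<le> x2 \<Longrightarrow> w1 \<le> w t \<and> w t \<le> w2"
    by (rule w_bounds[OF x]) blast
  have d0: "0 < real d" using d_ge_1 by simp
  \<comment> \<open>Two such errors have to fit into \<epsilon> times the lower bound
    \<open>d * w1 * \<gamma> ^ N / 2\<close> of the limit.\<close>
  define e where "e = \<epsilon> * (real d * w1 / 2) / 2"
  have e: "0 < e" using \<epsilon> d0 w1 by (simp add: e_def)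
  obtain \<eta>1 where \<eta>1: "0 < \<eta>1" "\<And>\<eta>. 0 < \<eta> \<Longrightarrow> \<eta> \<le> \<eta>1 \<Longrightarrow> \<exists>a0\<ge>1. \<forall>a\<ge>a0. \<forall>N k. int d dvd int k - int \<mu> \<longrightarrow> real k / c a \<in> {x1..x2} \<longrightarrow>
     \<bar>\<eta> * scaled_pmf N a k - real d * (Wcdf N (real k / c a + \<eta>) - Wcdf N (real k / c a))\<bar> \<le> \<eta> * e * \<gamma> ^ N"
    by (rule scaled_pmf_window[OF x e]) blast
  obtain \<eta>2 where \<eta>2: "0 < \<eta>2" "\<And>\<eta> N y. 0 < \<eta> \<Longrightarrow> \<eta> \<le> \<eta>2 \<Longrightarrow> y \<in> {x1..x2} \<Longrightarrow>
     \<bar>real d * ((Wcdf N (y + \<eta>) - Wcdf N y) / \<eta>) - real d * scaled_density N y\<bar> \<le> e * \<gamma> ^ N"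
    by (rule density_window[OF x e]) blast
  define \<eta> where "\<eta> = min \<eta>1 \<eta>2"
  have \<eta>: "0 < \<eta>" "\<eta> \<le> \<eta>1" "\<eta> \<le> \<eta>2" using \<eta>1 \<eta>2 by (auto simp: \<eta>_def)
  from \<eta>1(2)[OF \<eta>(1,2)] obtain a0 where a0: "\<And>a N k. a \<ge> a0 \<Longrightarrow> int d dvd int k - int \<mu> \<Longrightarrow> real k / c a \<in> {x1..x2} \<Longrightarrow>
     \<bar>\<eta> * scaled_pmf N a k - real d * (Wcdf N (real k / c a + \<eta>) - Wcdf N (real k / c a))\<bar> \<le> \<eta> * e * \<gamma> ^ N" by blast
  show thesis
  proof (rule that[of a0])
    fix a N k assume *: "a0 \<le> a" "int d dvd int k - int \<mu>" "real k / c a \<in> {x1..x2}"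
    let ?y = "real k / c a"
    define Q where "Q = real d * ((Wcdf N (?y + \<eta>) - Wcdf N ?y) / \<eta>)"
    have y0: "0 < ?y" using *(3) x by auto
    have "\<eta> * \<bar>scaled_pmf N a k - Q\<bar> = \<bar>\<eta> * (scaled_pmf N a k - Q)\<bar>" using \<eta> by (simp add: abs_mult)
    also have "\<eta> * (scaled_pmf N a k - Q) = \<eta> * scaled_pmf N a k - real d * (Wcdf N (?y + \<eta>) - Wcdf N ?y)"
    proof -
      have "\<eta> * Q = real d * (Wcdf N (?y + \<eta>) - Wcdf N ?y)" using \<eta> by (simp add: Q_def)
      then show ?thesis by (simp only: right_diff_distrib[of \<eta>])
    qed
    also have "\<bar>\<dots>\<bar> \<le> \<eta> * (e * \<gamma> ^ N)" using a0[OF *, of N] by (simp add: mult.assoc)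
    finally have "\<bar>scaled_pmf N a k - Q\<bar> \<le> e * \<gamma> ^ N" using \<eta> by (simp only: mult_le_cancel_left_pos)
    moreover have "\<bar>Q - real d * scaled_density N ?y\<bar> \<le> e * \<gamma> ^ N"
      unfolding Q_def by (rule \<eta>2(2)[OF \<eta>(1,3) *(3)])
    ultimately have "\<bar>scaled_pmf N a k - real d * scaled_density N ?y\<bar> \<le> 2 * (e * \<gamma> ^ N)" by linarith
    also have "\<dots> = \<epsilon> * (real d * (\<gamma> ^ N / 2 * w1))" by (simp add: e_def)
    also have "\<dots> \<le> \<epsilon> * (real d * (\<gamma> ^ N / 2 * w ?y))"
      using w1(2)[of ?y] *(3) \<epsilon> d0 \<gamma>_pos by (intro mult_left_mono) auto
    also have "\<dots> \<le> \<epsilon> * (real d * scaled_density N ?y)"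
      using scaled_density_lower[OF y0, of N] \<epsilon> d0 by (intro mult_left_mono) auto
    finally show "\<bar>scaled_pmf N a k - real d * scaled_density N ?y\<bar> \<le> \<epsilon> * (real d * scaled_density N ?y)" .
  qed
qed

text \<open>The mass of \<open>m ^ N * W\<close> in \<open>(x1 / 2, x1]\<close> is at least
  \<open>q * \<gamma> ^ N / 2\<close>, which makes the uniform error relative.\<close>

lemma integral_limit_uniform:
  assumes x: "0 < x1" "x1 \<le> x2" and \<epsilon>: "0 < \<epsilon>"
  obtains a0 where "\<And>a N y. a \<ge> a0 \<Longrightarrow> y \<in> {x1..x2} \<Longrightarrow> \<bar>Zcdf N a y - Wcdf N y\<bar> \<le> \<epsilon> * Wcdf N y"
proof -
  define q where "q = Wcdf 0 x1 - Wcdf 0 (x1 / 2)"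
  have "q = prob {\<omega> \<in> space M. x1 / 2 < W \<omega> \<and> W \<omega> \<le> x1}"
    unfolding q_def using x Wcdf_diff[of "x1 / 2" x1 0] by (auto intro!: arg_cong[where f=prob])
  then have q: "0 < q" using prob_W_interval_pos[of "x1 / 2" x1] x by simp
  have "0 < \<epsilon> * q / 2" using \<epsilon> q by simp
  then obtain a0 where a0: "\<And>a N y. a \<ge> a0 \<Longrightarrow> x1 \<le> y \<Longrightarrow> y \<le> x2 \<Longrightarrow> \<bar>Zcdf N a y - Wcdf N y\<bar> \<le> \<epsilon> * q / 2 * \<gamma> ^ N"
    by (rule Zcdf_Wcdf_uniform[OF x]) blast
  show thesis
  proof (rule that[of a0])
    fix a N :: nat and y assume *: "a0 \<le> a" "y \<in> {x1..x2}"
    have "\<bar>Zcdf N a y - Wcdf N y\<bar> \<le> \<epsilon> * q / 2 * \<gamma> ^ N" using * by (intro a0) auto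
    also have "\<dots> = \<epsilon> * (\<gamma> ^ N / 2 * q)" by simp
    also have "\<dots> \<le> \<epsilon> * Wcdf N y"
    proof (intro mult_left_mono)
      have "\<gamma> ^ N / 2 * q \<le> Wcdf N x1 - Wcdf N (x1 / 2)"
        unfolding q_def using x by (intro Wcdf_lower) auto
      also have "\<dots> \<le> Wcdf N x1" by (simp add: Wcdf_def)
      also have "\<dots> \<le> Wcdf N y" unfolding Wcdf_def using * by (intro finite_measure_mono) auto
      finally show "\<gamma> ^ N / 2 * q \<le> Wcdf N y" .
    qed (use \<epsilon> in simp)
    finally show "\<bar>Zcdf N a y - Wcdf N y\<bar> \<le> \<epsilon> * Wcdf N y" .
  qed
qed

end

section \<open>From the uniform estimates to the stated asymptotics\<close>

theorem mainTheorem1: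
  fixes M :: "'a measure" and p :: "nat pmf" and \<xi> :: "nat \<Rightarrow> nat \<Rightarrow> 'a \<Rightarrow> nat"
    and c :: "nat \<Rightarrow> real" and W :: "'a \<Rightarrow> real" and w :: "real \<Rightarrow> real"
    and d \<mu> :: nat and k :: "nat \<Rightarrow> int"
  assumes gw: "gw_offspring_family M p \<xi>"
    and nondeg: "nondegenerate_law p"
    and supercrit: "supercritical_law p"
    and schroeder: "schroeder_type p"
    and type: "of_type p d \<mu>"
    and norming: "admissible_norming p c"
    and W_rv: "W \<in> borel_measurable M"
    and W_lim: "AE \<omega> in M. (\<lambda>n. real (gw_Z \<xi> n \<omega>) / c n) \<longlonglongrightarrow> W \<omega>"
    and W_nondeg: "\<not> (\<exists>x. AE \<omega> in M. W \<omega> = x)"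
    and w_cont: "continuous_on {0<..} w"
    and w_pos: "\<And>x. x > 0 \<Longrightarrow> w x > 0"
    and w_density: "\<And>A. A \<in> sets borel \<Longrightarrow> A \<subseteq> {0<..} \<Longrightarrow>
                      emeasure M {\<omega> \<in> space M. W \<omega> \<in> A} = (\<integral>\<^sup>+ x \<in> A. ennreal (w x) \<partial>lborel)"
    and k_cong: "\<And>n. k n mod int d = int \<mu> mod int d"
    and k_inf: "filterlim k at_top sequentially"
    and k_small: "(\<lambda>n. real_of_int (k n)) \<in> o(c)"
  defines "a \<equiv> (\<lambda>n. LEAST l. l \<ge> 1 \<and> c l \<ge> real_of_int (k n))"
    and "m \<equiv> offspring_mean p"
  shows "((\<lambda>n. measure M {\<omega> \<in> space M. int (gw_Z \<xi> n \<omega>) = k n}) \<sim>[sequentially]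
           (\<lambda>n. real d / (m powr (real n - real (a n)) * c (a n)) *
                w (real_of_int (k n) / (m powr (real n - real (a n)) * c (a n))))) \<and>
         ((\<lambda>n. measure M {\<omega> \<in> space M. 0 < gw_Z \<xi> n \<omega> \<and> int (gw_Z \<xi> n \<omega>) \<le> k n}) \<sim>[sequentially]
           (\<lambda>n. measure M {\<omega> \<in> space M. 0 < W \<omega> \<and>
                   W \<omega> < real_of_int (k n) / (m powr (real n - real (a n)) * c (a n))}))"
proof -
  interpret prob_space M using gw by (simp add: gw_offspring_family_def)
  interpret gw_lattice M p m \<xi> c W w d \<mu>
    by unfold_locales
       (use gw supercrit schroeder norming W_rv W_lim w_cont w_pos w_density type in \<open>simp_all add: m_def\<close>)
  define y where "y n = real_of_int (k n) / c (a n)" for n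
  define N where "N n = n - a n" for n
  have k_large: "\<forall>\<^sub>F n in sequentially. t < real_of_int (k n)" for t
  proof -
    have "\<forall>\<^sub>F n in sequentially. \<lfloor>t\<rfloor> + 1 \<le> k n" using k_inf by (simp add: filterlim_at_top)
    then show ?thesis by eventually_elim linarith
  qed
  have a: "1 \<le> a n \<and> real_of_int (k n) \<le> c (a n)" for n
  proof -
    have "\<forall>\<^sub>F l in sequentially. real_of_int (k n) \<le> c l" using c_at_top by (simp add: filterlim_at_top)
    with eventually_ge_at_top[of "1::nat"] have "\<forall>\<^sub>F l in sequentially. 1 \<le> l \<and> real_of_int (k n) \<le> c l"
      by eventually_elim simp
    then obtain l where "1 \<le> l \<and> real_of_int (k n) \<le> c l" by (auto simp: eventually_sequentially)
    then show ?thesis unfolding a_def by (rule LeastI)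
  qed
  have a_large: "\<forall>\<^sub>F n in sequentially. l \<le> a n" for l
    using k_large[of "c l"]
  proof eventually_elim
    case (elim n)
    then have "c l < c (a n)" using a[of n] by linarith
    then show ?case using c_mono[of "a n" l] by (cases "l \<le> a n") auto
  qed
  \<comment> \<open>As \<open>k = o(c)\<close>, the index \<open>n\<close> is eventually itself a
    candidate in the minimum, which makes \<open>n - a n\<close> a true difference.\<close>
  have a_le: "\<forall>\<^sub>F n in sequentially. a n \<le> n"
    using landau_o.smallD[OF k_small zero_less_one] eventually_ge_at_top[of 1]
  proof eventually_elim
    case (elim n)
    have "\<bar>real_of_int (k n)\<bar> \<le> c n" using elim(1) by simp
    then show ?case unfolding a_def using elim(2) by (intro Least_le) auto
  qed
  \<comment> \<open>Minimality gives \<open>c (a n - 1) < k n\<close>, and one step of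
    \<open>c\<close> gains at most the factor \<open>m\<close>. The index \<open>a n - 1\<close>
    competes in the minimum only if it is at least 1, hence \<open>a n \<ge> 2\<close>.\<close>
  have y_range: "\<forall>\<^sub>F n in sequentially. y n \<in> {1 / m..1}"
    using a_large[of 2]
  proof eventually_elim
    case (elim n)
    then have a2: "Suc (a n - 1) = a n" "a n - 1 \<ge> 1" "a n - 1 < a n" by auto
    then have "\<not> (1 \<le> a n - 1 \<and> real_of_int (k n) \<le> c (a n - 1))"
      unfolding a_def by (intro not_less_Least)
    then have "m * c (a n - 1) \<le> m * real_of_int (k n)" using a2 m_pos by (intro mult_left_mono) auto
    then have "c (a n) \<le> m * real_of_int (k n)" using c_Suc_le[of "a n - 1"] a2(1) by simp
    then show ?case using a[of n] m_pos by (simp add: y_def field_simps)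
  qed
  have x: "0 < 1 / m" "1 / m \<le> 1" using m_gt_1 by auto
  have scale: "real_of_int (k n) / (m powr (real n - real (a n)) * c (a n)) = y n / m ^ N n"
       "m powr (real n - real (a n)) = m ^ N n" if "a n \<le> n" for n
  proof -
    show "m powr (real n - real (a n)) = m ^ N n"
      using that m_pos by (simp add: N_def powr_realpow flip: of_nat_diff)
    then show "real_of_int (k n) / (m powr (real n - real (a n)) * c (a n)) = y n / m ^ N n"
      by (simp add: y_def mult.commute)
  qed
  have k_nat: "\<forall>\<^sub>F n in sequentially. 0 < nat (k n) \<and> int (nat (k n)) = k n"
    using k_large[of 0] by eventually_elim auto
  have cong: "int d dvd k n - int \<mu>" for n
    using k_cong[of n] by (simp add: mod_eq_dvd_iff)

  have "(\<lambda>n. measure M {\<omega> \<in> space M. int (gw_Z \<xi> n \<omega>) = k n}) \<sim>[sequentially]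
           (\<lambda>n. real d / (m powr (real n - real (a n)) * c (a n)) *
                w (real_of_int (k n) / (m powr (real n - real (a n)) * c (a n))))"
    (is "?f \<sim>[_] ?g")
  proof (rule smallo_imp_asymp_equiv, rule landau_o.smallI)
    fix \<epsilon> :: real assume \<epsilon>: "0 < \<epsilon>"
    obtain a0 where a0: "\<And>a N k. a \<ge> a0 \<Longrightarrow> int d dvd int k - int \<mu> \<Longrightarrow> real k / c a \<in> {1 / m..1} \<Longrightarrow>
     \<bar>scaled_pmf N a k - real d * scaled_density N (real k / c a)\<bar> \<le> \<epsilon> * (real d * scaled_density N (real k / c a))"
      by (rule local_limit_uniform[OF x \<epsilon>]) blast
    show "\<forall>\<^sub>F n in sequentially. norm (?f n - ?g n) \<le> \<epsilon> * norm (?g n)"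
      using a_large[of a0] a_le y_range k_nat
    proof eventually_elim
      case (elim n)
      have kr: "real (nat (k n)) = real_of_int (k n)" using elim(4) by (metis of_int_of_nat_eq)
      have f: "?f n = scaled_pmf (N n) (a n) (nat (k n)) / c (a n)"
      proof -
        have "{\<omega> \<in> space M. int (gw_Z \<xi> n \<omega>) = k n} = {\<omega> \<in> space M. gw_Z \<xi> n \<omega> = nat (k n)}"
          using elim(4) by auto
        then have "?f n = pmf (gw_law p n 1) (nat (k n))" by (simp only: prob_Z_eq)
        then show ?thesis using elim(2) by (simp add: scaled_pmf_def N_def)
      qed
      have g: "?g n = real d * scaled_density (N n) (y n) / c (a n)"
        unfolding scale(1)[OF elim(2)] by (simp add: scale(2)[OF elim(2)] scaled_density_def)
      have g0: "0 \<le> ?g n"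
      proof -
        have "0 < y n" by (rule less_le_trans[OF x(1)]) (use elim(3) in simp)
        then have "0 < w (y n / m ^ N n)" using m_pos by (intro w_pos) auto
        then show ?thesis unfolding g scaled_density_def using m_pos by (simp add: less_imp_le)
      qed
      have "\<bar>scaled_pmf (N n) (a n) (nat (k n)) - real d * scaled_density (N n) (y n)\<bar> \<le> \<epsilon> * (real d * scaled_density (N n) (y n))"
        using a0[OF elim(1), of "nat (k n)" "N n"] elim(3,4) cong[of n] by (simp add: kr y_def)
      from divide_right_mono[OF this c_nonneg[of "a n"]]
      have "\<bar>?f n - ?g n\<bar> \<le> \<epsilon> * ?g n"
        unfolding f g by (simp add: abs_divide abs_of_pos flip: diff_divide_distrib)
      then show ?case unfolding real_norm_def abs_of_nonneg[OF g0] .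
    qed
  qed
  moreover
  have "(\<lambda>n. measure M {\<omega> \<in> space M. 0 < gw_Z \<xi> n \<omega> \<and> int (gw_Z \<xi> n \<omega>) \<le> k n}) \<sim>[sequentially]
           (\<lambda>n. measure M {\<omega> \<in> space M. 0 < W \<omega> \<and>
                   W \<omega> < real_of_int (k n) / (m powr (real n - real (a n)) * c (a n))})"
    (is "?f \<sim>[_] ?g")
  proof (rule smallo_imp_asymp_equiv, rule landau_o.smallI)
    fix \<epsilon> :: real assume \<epsilon>: "0 < \<epsilon>"
    obtain a0 where a0: "\<And>a N y. a \<ge> a0 \<Longrightarrow> y \<in> {1 / m..1} \<Longrightarrow> \<bar>Zcdf N a y - Wcdf N y\<bar> \<le> \<epsilon> * Wcdf N y"
      by (rule integral_limit_uniform[OF x \<epsilon>]) blast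
    show "\<forall>\<^sub>F n in sequentially. norm (?f n - ?g n) \<le> \<epsilon> * norm (?g n)"
      using a_large[of a0] a_le y_range
    proof eventually_elim
      case (elim n)
      have mN: "0 < m ^ N n" using m_pos by simp
      have y0: "0 < y n" by (rule less_le_trans[OF x(1)]) (use elim(3) in simp)
      have f: "?f n = Zcdf (N n) (a n) (y n)"
      proof -
        have "int z \<le> k n \<longleftrightarrow> real z \<le> y n * c (a n)" for z
          unfolding y_def by simp linarith
        then show ?thesis using elim(2) by (simp add: Zcdf_def N_def)
      qed
      \<comment> \<open>The strict inequality in the claim and the weak one in \<open>Wcdf\<close>
        differ by a null set, as \<open>W\<close> has no atom at a positive point.\<close>
      have g: "?g n = Wcdf (N n) (y n)"
      proof -
        let ?t = "y n / m ^ N n"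
        have "0 < ?t" using y0 mN by simp
        from prob_W_atom[OF this] have 0: "emeasure M {\<omega> \<in> space M. W \<omega> = ?t} = 0"
          by (simp add: emeasure_eq_measure)
        have ne: "AE \<omega> in M. W \<omega> \<noteq> ?t"
          by (rule AE_I[OF _ 0]) auto
        have "?g n = prob {\<omega> \<in> space M. 0 < W \<omega> \<and> W \<omega> < ?t}" unfolding scale(1)[OF elim(2)] ..
        also have "\<dots> = prob {\<omega> \<in> space M. 0 < W \<omega> \<and> m ^ N n * W \<omega> \<le> y n}"
        proof (rule finite_measure_eq_AE)
          show "AE \<omega> in M. (\<omega> \<in> {\<omega> \<in> space M. 0 < W \<omega> \<and> W \<omega> < ?t}) = (\<omega> \<in> {\<omega> \<in> space M. 0 < W \<omega> \<and> m ^ N n * W \<omega> \<le> y n})"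
            using ne
          proof eventually_elim
            case (elim \<omega>)
            have "m ^ N n * W \<omega> \<le> y n \<longleftrightarrow> W \<omega> \<le> ?t" using mN by (simp add: pos_le_divide_eq mult.commute)
            then show ?case using elim by auto
          qed
        qed measurable
        finally show ?thesis by (simp add: Wcdf_def)
      qed
      have "\<bar>?f n - ?g n\<bar> \<le> \<epsilon> * ?g n" unfolding f g by (rule a0[OF elim(1,3)])
      then show ?case by simp
    qed
  qed
  ultimately show ?thesis by (rule conjI)
qed

end
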